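(* Suppose $\dim(\mathcal S)=1$, $\mathcal K_+^{\mathrm{dual}}\neq\emptyset$, and $R\in\mathrm{int}(\mathcal K)$. Then $\mathbb S(I\|\rho)=-\int_{\mathcal S}\mathrm{trace}(\log\rho)\,d\theta$ has a minimum over $\rho\in\mathfrak M_{R,+}$, which is unique and belongs to $$\mathfrak M_{\rm rat}=\{\rho=L^*(\lambda)^{-1}:\ \lambda\in\mathcal K_+^{\mathrm{dual}}\}.$$ Furthermore, for any $\lambda_0\in\mathcal K_+^{\mathrm{dual}}$, the solution $\lambda_t$ of the matrix differential equation $$\frac{d}{dt}\lambda_t=\big(\nabla h|_{\lambda_t}\big)^{-1}\big(R-L(L^*(\lambda_t)^{-1})\big)\qquad(\ast)$$ with initial value $\lambda_0$, where $$\nabla h|_{\lambda_t}:\mathfrak R\to\mathfrak R,\qquad \delta\mapsto L\big(L^*(\lambda_t)^{-1}L^*(\delta)L^*(\lambda_t)^{-1}\big),$$ belongs to $\mathcal K_+^{\mathrm{dual}}$ for all $t\in[0,\infty)$ and converges as $t\to\infty$ to a point $\hat\lambda\in\mathcal K_+^{\mathrm{dual}}$ corresponding to the unique minimizer $\rho=L^*(\hat\lambda)^{-1}$ of $\mathbb S(I\|\rho)$ satisfying $R=L(\rho)$. The differential equation $(\ast)$ is exponentially convergent, as the square distance $V(\lambda_t)=\|R-L(L^*(\lambda_t)^{-1})\|^2$ satisfies $$\frac{dV(\lambda_t)}{dt}=-2V(\lambda_t).$$ Conversely, if $R\in\mathfrak R$, $R\notin\mathrm{int}(\mathcal K)$ and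 $\dim(\mathcal S)=1$, then the differential equation $(\ast)$ (started at any $\lambda_0\in\mathcal K_+^{\mathrm{dual}}$) diverges, i.e. $\lambda_t$ is unbounded on its maximal interval of existence in $\mathcal K_+^{\mathrm{dual}}$, $t\ge0$.
   Context: Let $\mathcal S$ be a closed interval of $\mathbb R$ or a multi-dimensional closed interval in $\mathbb R^k$ (compact, with nonempty interior); $\dim(\mathcal S)=1$ means $\mathcal S$ is a closed interval of $\mathbb R$. Let $\mathbb M$ be the real Hilbert space of square-integrable measurable functions on $\mathcal S$ with values in Hermitian $m\times m$ matrices, with inner product $\langle m_1,m_2\rangle=\int_{\mathcal S}\mathrm{trace}(m_1(\theta)m_2(\theta))\,d\theta$; let $\mathfrak M$ and $\mathfrak M_+$ be the cones of elements of $\mathbb M$ that are nonnegative definite, respectively positive definite, for all $\theta\in\mathcal S$. Let $G_{\rm left}:\mathcal S\to\mathbb C^{n_{\rm left}\times m}$ and $G_{\rm right}:\mathcal S\to\mathbb C^{m\times n_{\rm right}}$ be continuously differentiable, and let $$L(\rho)=\int_{\mathcal S}G_{\rm left}(\theta)\rho(\theta)G_{\rm right}(\theta)\,d\theta,\qquad \rho\in\mathbb M,$$ with range $\mathfrak R=L(\mathbb M)\subseteq\mathbb C^{n_{\rm left}\times n_{\rm right}}$, regarded as a real linear space with inner product $\langle\lambda,R\rangle=\mathrm{Re}\,\mathrm{trace}(\lambda^*R)$ and the associated norm $\|\cdot\|$. The adjoint is $L^*:\mathfrak R\to\mathbb M$, $L^*(\lambda)(\theta)=\big(G_{\rm left}(\theta)^*\lambda\,G_{\rm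 right}(\theta)^*\big)_{\rm Herm}$, where $(M)_{\rm Herm}=\frac12(M+M^* )$. Inverses, products and logarithms of matrix-valued functions on $\mathcal S$ are taken pointwise in $\theta$. Define $\mathcal K=\overline{L(\mathfrak M)}$ (closure in $\mathfrak R$), $\mathrm{int}(\mathcal K)=L(\mathfrak M_+)$, $\mathcal K_+^{\mathrm{dual}}=\{\lambda\in\mathfrak R: L^*(\lambda)\in\mathfrak M_+\}$, and, for $R\in\mathfrak R$, $\mathfrak M_{R,+}=\{\rho\in\mathfrak M_+: L(\rho)=R\}$.
   Formalization: The operator ∇h at λ is taken with a minus sign, δ ↦ −L(L*(λ)⁻¹L*(δ)L*(λ)⁻¹), the actual derivative of h(λ)=L(L*(λ)⁻¹); with the printed sign one gets dV/dt=+2V, and convergence and the converse fail (e.g. S=[0,1], G=1). *)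

theory Defs
  imports "HOL-Analysis.Analysis"
begin

section \<open>Complex matrices\<close>

definition cadj :: "complex^'n^'m \<Rightarrow> complex^'m^'n" where
  "cadj A = (\<chi> i j. cnj (A $ j $ i))"

definition hermitian :: "complex^'n^'n \<Rightarrow> bool" where
  "hermitian A \<longleftrightarrow> cadj A = A"

definition herm_part :: "complex^'n^'n \<Rightarrow> complex^'n^'n" where
  "herm_part A = (1/2) *\<^sub>R (A + cadj A)"

text \<open>The library inner product of \<open>complex^'n\<close> is the real one, so that
  \<open>x \<bullet> (A *v x)\<close> is the real part of the Hermitian form \<open>x\<^sup>* A x\<close>.  Likewise the library
  inner product of matrices is \<open>Re trace (A\<^sup>* B)\<close>, as recorded below, and the library norm
  of matrices is the associated (Frobenius) norm.\<close>

definition pos_def :: "complex^'n^'n \<Rightarrow> bool" where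
  "pos_def A \<longleftrightarrow> hermitian A \<and> (\<forall>x. x \<noteq> 0 \<longrightarrow> 0 < x \<bullet> (A *v x))"

lemma inner_matrix_eq_trace:
  fixes A B :: "complex^'n^'m"
  shows "A \<bullet> B = Re (trace (cadj A ** B))"
proof -
  have "A \<bullet> B = (\<Sum>i\<in>UNIV. \<Sum>j\<in>UNIV. Re (cnj (A $ i $ j) * B $ i $ j))"
    by (simp add: inner_vec_def inner_complex_def)
  also have "\<dots> = (\<Sum>j\<in>UNIV. \<Sum>i\<in>UNIV. Re (cnj (A $ i $ j) * B $ i $ j))"
    by (rule sum.swap)
  also have "\<dots> = Re (trace (cadj A ** B))"
    by (simp add: trace_def matrix_matrix_mult_def cadj_def)
  finally show ?thesis .
qed

definition real_diag :: "('n::finite \<Rightarrow> real) \<Rightarrow> complex^'n^'n" where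
  "real_diag d = (\<chi> i j. if i = j then complex_of_real (d i) else 0)"

text \<open>The logarithm of a positive definite matrix, by the spectral functional calculus:
  if \<open>A = U diag(d) U\<^sup>*\<close> with \<open>U\<close> unitary and \<open>d > 0\<close>, then \<open>log A = U diag(ln d) U\<^sup>*\<close>, which
  does not depend on the choice of \<open>U\<close> and \<open>d\<close>.\<close>

definition mat_log :: "complex^'n^'n \<Rightarrow> complex^'n^'n" where
  "mat_log A = (THE B. \<exists>(U :: complex^'n^'n) d. cadj U ** U = mat 1 \<and> (\<forall>i. 0 < d i) \<and>
      A = U ** real_diag d ** cadj U \<and> B = U ** real_diag (\<lambda>i. ln (d i)) ** cadj U)"

section \<open>Square-integrable matrix densities and the moment map\<close>

text \<open>Elements of the Hilbert space are represented by functions, not by classes modulo null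
  sets.  Every class that is positive definite almost everywhere has a representative that is
  positive definite everywhere on \<open>S\<close>; uniqueness statements are accordingly made up to
  equality almost everywhere.\<close>

definition herm_L2 :: "'k::euclidean_space set \<Rightarrow> ('k \<Rightarrow> complex^'m^'m) set" where
  "herm_L2 S = {\<rho>. \<rho> \<in> borel_measurable (lebesgue_on S) \<and>
      integrable (lebesgue_on S) (\<lambda>\<theta>. (norm (\<rho> \<theta>))\<^sup>2) \<and> (\<forall>\<theta>\<in>S. hermitian (\<rho> \<theta>))}"

definition herm_L2_pos :: "'k::euclidean_space set \<Rightarrow> ('k \<Rightarrow> complex^'m^'m) set" where
  "herm_L2_pos S = {\<rho> \<in> herm_L2 S. \<forall>\<theta>\<in>S. pos_def (\<rho> \<theta>)}"

definition moment_map :: "'k::euclidean_space set \<Rightarrow> ('k \<Rightarrow> complex^'m^'nl) \<Rightarrow>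
    ('k \<Rightarrow> complex^'nr^'m) \<Rightarrow> ('k \<Rightarrow> complex^'m^'m) \<Rightarrow> complex^'nr^'nl" where
  "moment_map S Gl Gr \<rho> = (LINT \<theta>|lebesgue_on S. Gl \<theta> ** \<rho> \<theta> ** Gr \<theta>)"

definition moment_range :: "'k::euclidean_space set \<Rightarrow> ('k \<Rightarrow> complex^'m^'nl) \<Rightarrow>
    ('k \<Rightarrow> complex^'nr^'m) \<Rightarrow> (complex^'nr^'nl) set" where
  "moment_range S Gl Gr = moment_map S Gl Gr ` herm_L2 S"

definition moment_adj :: "('k \<Rightarrow> complex^'m^'nl) \<Rightarrow> ('k \<Rightarrow> complex^'nr^'m) \<Rightarrow>
    complex^'nr^'nl \<Rightarrow> 'k \<Rightarrow> complex^'m^'m" where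
  "moment_adj Gl Gr lam \<theta> = herm_part (cadj (Gl \<theta>) ** lam ** cadj (Gr \<theta>))"

text \<open>The set \<open>int(K)\<close>, which is by definition the image of the positive definite densities.\<close>

definition moment_int :: "'k::euclidean_space set \<Rightarrow> ('k \<Rightarrow> complex^'m^'nl) \<Rightarrow>
    ('k \<Rightarrow> complex^'nr^'m) \<Rightarrow> (complex^'nr^'nl) set" where
  "moment_int S Gl Gr = moment_map S Gl Gr ` herm_L2_pos S"

definition dual_pos :: "'k::euclidean_space set \<Rightarrow> ('k \<Rightarrow> complex^'m^'nl) \<Rightarrow>
    ('k \<Rightarrow> complex^'nr^'m) \<Rightarrow> (complex^'nr^'nl) set" where
  "dual_pos S Gl Gr = {lam \<in> moment_range S Gl Gr. moment_adj Gl Gr lam \<in> herm_L2_pos S}"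

definition densities :: "'k::euclidean_space set \<Rightarrow> ('k \<Rightarrow> complex^'m^'nl) \<Rightarrow>
    ('k \<Rightarrow> complex^'nr^'m) \<Rightarrow> complex^'nr^'nl \<Rightarrow> ('k \<Rightarrow> complex^'m^'m) set" where
  "densities S Gl Gr R = {\<rho> \<in> herm_L2_pos S. moment_map S Gl Gr \<rho> = R}"

definition rat_density :: "('k \<Rightarrow> complex^'m^'nl) \<Rightarrow> ('k \<Rightarrow> complex^'nr^'m) \<Rightarrow>
    complex^'nr^'nl \<Rightarrow> 'k \<Rightarrow> complex^'m^'m" where
  "rat_density Gl Gr lam \<theta> = matrix_inv (moment_adj Gl Gr lam \<theta>)"

definition rat_densities :: "'k::euclidean_space set \<Rightarrow> ('k \<Rightarrow> complex^'m^'nl) \<Rightarrow>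
    ('k \<Rightarrow> complex^'nr^'m) \<Rightarrow> ('k \<Rightarrow> complex^'m^'m) set" where
  "rat_densities S Gl Gr = rat_density Gl Gr ` dual_pos S Gl Gr"

section \<open>Relative entropy\<close>

text \<open>For \<open>\<rho>\<close> in \<open>herm_L2_pos S\<close>, with \<open>S\<close> of finite measure, the positive part of
  \<open>trace (log \<rho>) \<le> trace \<rho>\<close> is integrable.  Hence the integrand fails to be integrable only if
  minus its integral is \<open>+\<infinity>\<close>.\<close>

definition entropy :: "'k::euclidean_space set \<Rightarrow> ('k \<Rightarrow> complex^'m^'m) \<Rightarrow> ereal" where
  "entropy S \<rho> =
    (if integrable (lebesgue_on S) (\<lambda>\<theta>. Re (trace (mat_log (\<rho> \<theta>))))
     then ereal (- (LINT \<theta>|lebesgue_on S. Re (trace (mat_log (\<rho> \<theta>)))))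
     else \<infinity>)"

definition entropy_minimizer :: "'k::euclidean_space set \<Rightarrow> ('k \<Rightarrow> complex^'m^'nl) \<Rightarrow>
    ('k \<Rightarrow> complex^'nr^'m) \<Rightarrow> complex^'nr^'nl \<Rightarrow> ('k \<Rightarrow> complex^'m^'m) \<Rightarrow> bool" where
  "entropy_minimizer S Gl Gr R \<rho> \<longleftrightarrow> is_arg_min (entropy S) (\<lambda>\<sigma>. \<sigma> \<in> densities S Gl Gr R) \<rho>"

definition unique_entropy_minimizer :: "'k::euclidean_space set \<Rightarrow> ('k \<Rightarrow> complex^'m^'nl) \<Rightarrow>
    ('k \<Rightarrow> complex^'nr^'m) \<Rightarrow> complex^'nr^'nl \<Rightarrow> ('k \<Rightarrow> complex^'m^'m) \<Rightarrow> bool" where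
  "unique_entropy_minimizer S Gl Gr R \<rho> \<longleftrightarrow> entropy_minimizer S Gl Gr R \<rho> \<and>
     (\<forall>\<sigma>. entropy_minimizer S Gl Gr R \<sigma> \<longrightarrow> (AE \<theta> in lebesgue_on S. \<sigma> \<theta> = \<rho> \<theta>))"

section \<open>The differential equation\<close>

text \<open>Continuous differentiability with one-sided derivatives at the ends of an interval.\<close>

definition C1_on :: "real set \<Rightarrow> (real \<Rightarrow> 'b::real_normed_vector) \<Rightarrow> bool" where
  "C1_on S f \<longleftrightarrow> (\<exists>f'. continuous_on S f' \<and>
      (\<forall>x\<in>S. (f has_vector_derivative f' x) (at x within S)))"

text \<open>The map \<open>h \<lambda> = L (L\<^sup>*(\<lambda>)\<^sup>-\<^sup>1)\<close> and its derivative.  Since inversion has the derivative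
  \<open>X \<mapsto> - P\<^sup>-\<^sup>1 X P\<^sup>-\<^sup>1\<close> at \<open>P\<close>, the derivative of \<open>h\<close> carries a minus sign.  The source prints
  \<open>\<nabla>h\<close> without that sign; with it omitted, the squared residual of the differential
  equation would satisfy \<open>V' = 2 V\<close> instead of \<open>V' = - 2 V\<close>.\<close>

definition hmap :: "'k::euclidean_space set \<Rightarrow> ('k \<Rightarrow> complex^'m^'nl) \<Rightarrow>
    ('k \<Rightarrow> complex^'nr^'m) \<Rightarrow> complex^'nr^'nl \<Rightarrow> complex^'nr^'nl" where
  "hmap S Gl Gr lam = moment_map S Gl Gr (rat_density Gl Gr lam)"

definition grad_h :: "'k::euclidean_space set \<Rightarrow> ('k \<Rightarrow> complex^'m^'nl) \<Rightarrow>
    ('k \<Rightarrow> complex^'nr^'m) \<Rightarrow> complex^'nr^'nl \<Rightarrow> complex^'nr^'nl \<Rightarrow> complex^'nr^'nl" where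
  "grad_h S Gl Gr lam \<delta> = - moment_map S Gl Gr
     (\<lambda>\<theta>. rat_density Gl Gr lam \<theta> ** moment_adj Gl Gr \<delta> \<theta> ** rat_density Gl Gr lam \<theta>)"

text \<open>The points at which the right-hand side of the differential equation is meaningful.\<close>

definition ode_dom :: "'k::euclidean_space set \<Rightarrow> ('k \<Rightarrow> complex^'m^'nl) \<Rightarrow>
    ('k \<Rightarrow> complex^'nr^'m) \<Rightarrow> (complex^'nr^'nl) set" where
  "ode_dom S Gl Gr = {lam \<in> moment_range S Gl Gr.
      (\<forall>\<theta>\<in>S. invertible (moment_adj Gl Gr lam \<theta>)) \<and>
      bij_betw (grad_h S Gl Gr lam) (moment_range S Gl Gr) (moment_range S Gl Gr)}"

definition ode_rhs :: "'k::euclidean_space set \<Rightarrow> ('k \<Rightarrow> complex^'m^'nl) \<Rightarrow>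
    ('k \<Rightarrow> complex^'nr^'m) \<Rightarrow> complex^'nr^'nl \<Rightarrow> complex^'nr^'nl \<Rightarrow> complex^'nr^'nl" where
  "ode_rhs S Gl Gr R lam =
     inv_into (moment_range S Gl Gr) (grad_h S Gl Gr lam) (R - hmap S Gl Gr lam)"

definition ode_solution :: "'k::euclidean_space set \<Rightarrow> ('k \<Rightarrow> complex^'m^'nl) \<Rightarrow>
    ('k \<Rightarrow> complex^'nr^'m) \<Rightarrow> complex^'nr^'nl \<Rightarrow> complex^'nr^'nl \<Rightarrow> real set \<Rightarrow>
    (real \<Rightarrow> complex^'nr^'nl) \<Rightarrow> bool" where
  "ode_solution S Gl Gr R lam0 J lam \<longleftrightarrow>
     is_interval J \<and> 0 \<in> J \<and> J \<subseteq> {0..} \<and> lam 0 = lam0 \<and>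
     (\<forall>t\<in>J. lam t \<in> ode_dom S Gl Gr \<and>
        (lam has_vector_derivative ode_rhs S Gl Gr R (lam t)) (at t within J))"

definition maximal_dual_solution :: "'k::euclidean_space set \<Rightarrow> ('k \<Rightarrow> complex^'m^'nl) \<Rightarrow>
    ('k \<Rightarrow> complex^'nr^'m) \<Rightarrow> complex^'nr^'nl \<Rightarrow> complex^'nr^'nl \<Rightarrow> real set \<Rightarrow>
    (real \<Rightarrow> complex^'nr^'nl) \<Rightarrow> bool" where
  "maximal_dual_solution S Gl Gr R lam0 J lam \<longleftrightarrow>
     ode_solution S Gl Gr R lam0 J lam \<and> lam ` J \<subseteq> dual_pos S Gl Gr \<and>
     (\<forall>J' lam'. ode_solution S Gl Gr R lam0 J' lam' \<and> lam' ` J' \<subseteq> dual_pos S Gl Gr \<and>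
        J \<subseteq> J' \<and> (\<forall>t\<in>J. lam' t = lam t) \<longrightarrow> J' = J)"

end

theory Submission
  imports Defs
begin

text \<open>Write \<open>h \<lambda> = L (L\<^sup>*(\<lambda>)\<^sup>-\<^sup>1)\<close>.  On the open convex set of all \<open>\<lambda>\<close> with \<open>L\<^sup>*(\<lambda>) > 0\<close>
  the map \<open>h\<close> is strictly monotone (decreasing) on the range of \<open>L\<close>, hence injective, and its
  derivative is invertible, so that it is a diffeomorphism onto an open set.  A curve solves the
  differential equation iff \<open>R - h \<lambda>\<^sub>t = exp (-t) (R - h \<lambda>\<^sub>0)\<close>: solutions are obtained by applying
  the inverse of \<open>h\<close> to the segment from \<open>h \<lambda>\<^sub>0\<close> to \<open>R\<close>, without any theory of differential equations.

  The segment stays in the image of \<open>h\<close> as long as \<open>\<lambda>\<^sub>t\<close> stays in a compact set.  If \<open>\<lambda>\<^sub>t\<close> is bounded,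
  then pairing \<open>h \<lambda>\<^sub>t\<close> with \<open>\<lambda>\<^sub>0\<close> bounds the integral of \<open>trace (L\<^sup>*(\<lambda>\<^sub>t)\<^sup>-\<^sup>1)\<close>; since \<open>L\<^sup>*(\<lambda>\<^sub>t)\<close> is Lipschitz on
  an interval, this keeps it uniformly positive definite.  Thus boundedness implies \<open>R = h \<lambda>\<close> for some \<open>\<lambda>\<close>,
  which is the converse statement.  If \<open>R = L \<rho>\<close> with \<open>\<rho> > 0\<close>, boundedness follows from the coercivity
  of \<open>\<lambda> \<mapsto> \<langle>\<lambda>, R\<rangle>\<close> on the dual cone and the identity \<open>\<langle>\<lambda>, h \<lambda>\<rangle> = m (b - a)\<close>.  Optimality of \<open>L\<^sup>*(\<lambda>)\<^sup>-\<^sup>1\<close> is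
  Klein's inequality for the logarithm, integrated over the interval.\<close>

section \<open>Complex matrices as a real inner product space\<close>

text \<open>Two obstacles shape the proof. The range \<open>RR\<close> is in general a proper
  subspace, whereas invariance of domain and the inverse function theorem are used on the whole
  matrix space; so positivity of the adjoint is studied for all \<open>lam\<close>, and the
  component orthogonal to \<open>RR\<close> is controlled by an added term. Secondly,
  \<open>ode_dom\<close> asks only for invertibility, so a competing solution could a priori leave
  the cone; it cannot, because a semidefinite invertible matrix is definite. Exact resolvent
  identities give both the monotonicity and the derivative of \<open>h\<close>. One positivity fact,
  that X |-> A X B is positive for positive definite A and B, then serves the injectivity of both.
  Dimension one is essential in one estimate: if the adjoint has a small value q of its quadratic
  form at a point c, the trace of its inverse is at least 1 / (q + k |x - c|), and the integral of
  this bound over an interval diverges like -ln q as q tends to 0. In higher dimensions the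
  corresponding integral stays bounded.\<close>

lemma cadj_cadj [simp]: "cadj (cadj A) = A"
  by (simp add: cadj_def vec_eq_iff)

lemma cadj_mult: "cadj (A ** B) = cadj B ** cadj A"
  by (simp add: cadj_def vec_eq_iff matrix_matrix_mult_def mult.commute)

lemma cadj_mat_1 [simp]: "cadj (mat 1) = mat 1"
  by (auto simp: cadj_def vec_eq_iff mat_def)

lemma cadj_add: "cadj (A + B) = cadj A + cadj B"
  and cadj_diff: "cadj (A - B) = cadj A - cadj B"
  and cadj_scaleR: "cadj (r *\<^sub>R A) = r *\<^sub>R cadj A"
  by (simp_all add: cadj_def vec_eq_iff)

lemma inner_matrix_vector_left:
  fixes A :: "complex^'n^'m"
  shows "(A *v x) \<bullet> y = x \<bullet> (cadj A *v y)"
proof -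
  have "(A *v x) \<bullet> y = (\<Sum>i\<in>UNIV. \<Sum>j\<in>UNIV. (A $ i $ j * x $ j) \<bullet> y $ i)"
    by (simp add: inner_vec_def matrix_vector_mult_def inner_sum_left)
  also have "\<dots> = (\<Sum>j\<in>UNIV. \<Sum>i\<in>UNIV. x $ j \<bullet> (cnj (A $ i $ j) * y $ i))"
    by (subst sum.swap) (simp add: inner_complex_def algebra_simps)
  also have "\<dots> = x \<bullet> (cadj A *v y)"
    by (simp add: inner_vec_def matrix_vector_mult_def inner_sum_right cadj_def)
  finally show ?thesis .
qed

lemma trace_mult_commute:
  fixes A :: "'a::comm_semiring_1^'n^'m" and B :: "'a^'m^'n"
  shows "trace (A ** B) = trace (B ** A)"
  by (simp add: trace_def matrix_matrix_mult_def mult.commute) (rule sum.swap)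

lemma inner_mult_left:
  fixes X :: "complex^'n^'m"
  shows "(X ** Y) \<bullet> Z = Y \<bullet> (cadj X ** Z)"
  by (simp add: inner_matrix_eq_trace cadj_mult matrix_mul_assoc)

lemma inner_mult_right:
  fixes X :: "complex^'n^'m"
  shows "(X ** Y) \<bullet> Z = X \<bullet> (Z ** cadj Y)"
  unfolding inner_matrix_eq_trace cadj_mult
  by (metis trace_mult_commute matrix_mul_assoc)

lemma cadj_inner_cadj: "cadj A \<bullet> cadj B = A \<bullet> B"
  unfolding inner_matrix_eq_trace cadj_cadj
  by (simp add: trace_def matrix_matrix_mult_def cadj_def sum_distrib_left mult.commute) (rule sum.swap)

lemma bilinear_matrix_mult:
  "bilinear ((**) :: complex^'n^'m \<Rightarrow> complex^'p^'n \<Rightarrow> complex^'p^'m)"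
  by (auto simp: bilinear_def linear_iff matrix_matrix_mult_def vec_eq_iff algebra_simps
      sum.distrib scaleR_sum_right)

interpretation matmul: bounded_bilinear "(**) :: complex^'n^'m \<Rightarrow> complex^'p^'n \<Rightarrow> complex^'p^'m"
  using bilinear_matrix_mult by (simp add: bilinear_conv_bounded_bilinear)

lemma bilinear_matrix_vector_mult:
  "bilinear ((*v) :: complex^'n^'m \<Rightarrow> complex^'n \<Rightarrow> complex^'m)"
  by (auto simp: bilinear_def linear_iff matrix_vector_mult_def vec_eq_iff algebra_simps
      sum.distrib scaleR_sum_right)

interpretation matvec: bounded_bilinear "(*v) :: complex^'n^'m \<Rightarrow> complex^'n \<Rightarrow> complex^'m"
  using bilinear_matrix_vector_mult by (simp add: bilinear_conv_bounded_bilinear)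

lemma linear_herm_part: "linear (herm_part :: complex^'n^'n \<Rightarrow> complex^'n^'n)"
  by (auto simp: linear_iff herm_part_def cadj_add cadj_scaleR algebra_simps)

lemma bounded_linear_herm_part: "bounded_linear (herm_part :: complex^'n^'n \<Rightarrow> complex^'n^'n)"
  using linear_herm_part by (simp add: linear_conv_bounded_linear)

lemma linear_cadj: "linear (cadj :: complex^'n^'m \<Rightarrow> complex^'m^'n)"
  by (auto simp: linear_iff cadj_add cadj_scaleR algebra_simps)

lemma bounded_linear_cadj: "bounded_linear (cadj :: complex^'n^'m \<Rightarrow> complex^'m^'n)"
  using linear_cadj by (simp add: linear_conv_bounded_linear)

lemma hermitian_herm_part [simp]: "hermitian (herm_part A)"
  by (simp add: hermitian_def herm_part_def cadj_add cadj_scaleR add.commute)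

lemma inner_herm_part:
  assumes "hermitian B" shows "herm_part A \<bullet> B = A \<bullet> B"
proof -
  have "cadj A \<bullet> B = A \<bullet> B"
    by (metis assms cadj_inner_cadj hermitian_def)
  then show ?thesis
    by (simp add: herm_part_def inner_add_left)
qed

lemma matrix_mult_eq_mat_1_commute:
  fixes A B :: "complex^'n^'n"
  shows "A ** B = mat 1 \<longleftrightarrow> B ** A = mat 1"
  using matrix_left_right_inverse by blast

section \<open>Real diagonal matrices and estimates for the Frobenius norm\<close>

lemma real_diag_nth: "real_diag d $ i $ j = (if i = j then complex_of_real (d i) else 0)"
  by (simp add: real_diag_def)

lemma cadj_real_diag [simp]: "cadj (real_diag d) = real_diag d"
  by (auto simp: cadj_def vec_eq_iff real_diag_nth)

lemma matrix_mult_real_diag_nth: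
  "(A ** real_diag d) $ i $ j = A $ i $ j * complex_of_real (d j)"
  by (simp add: matrix_matrix_mult_def real_diag_nth if_distrib cong: if_cong)

lemma real_diag_matrix_mult_nth:
  "(real_diag d ** A) $ i $ j = complex_of_real (d i) * A $ i $ j"
  by (simp add: matrix_matrix_mult_def real_diag_nth if_distrib if_distribR cong: if_cong)

lemma real_diag_vec_nth: "(real_diag d *v x) $ i = complex_of_real (d i) * x $ i"
  by (simp add: matrix_vector_mult_def real_diag_nth if_distrib if_distribR cong: if_cong)

lemma real_diag_mult: "real_diag d ** real_diag e = real_diag (\<lambda>i. d i * e i)"
  by (auto simp: vec_eq_iff matrix_mult_real_diag_nth real_diag_nth)

lemma real_diag_one: "real_diag (\<lambda>i. 1) = mat 1"
  by (auto simp: vec_eq_iff real_diag_nth mat_def)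

lemma inner_real_diag: "real_diag d \<bullet> A = (\<Sum>i\<in>UNIV. d i * Re (A $ i $ i))"
proof -
  have "real_diag d \<bullet> A = (\<Sum>i\<in>UNIV. \<Sum>j\<in>UNIV. if i = j then d i * Re (A $ i $ j) else 0)"
    unfolding inner_vec_def real_diag_nth by (intro sum.cong refl) (auto simp: inner_complex_def)
  then show ?thesis by simp
qed

lemma norm_unitary_vec:
  fixes U :: "complex^'n^'n"
  assumes "cadj U ** U = mat 1"
  shows "norm (U *v x) = norm x"
  unfolding norm_eq_sqrt_inner inner_matrix_vector_left matrix_vector_mul_assoc assms by simp

text \<open>Cauchy-Schwarz bounds each entry of the product by a row norm of \<open>A\<close> times
  a column norm of \<open>B\<close>; the sum of the squares then factorizes.\<close>

lemma norm_matrix_mult_le: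
  fixes A :: "complex^'n^'m" and B :: "complex^'p^'n"
  shows "norm (A ** B) \<le> norm A * norm B"
proof -
  have sq: "(norm X)\<^sup>2 = (\<Sum>i\<in>UNIV. \<Sum>j\<in>UNIV. (norm (X $ i $ j))\<^sup>2)" for X :: "complex^'u^'v"
    by (simp add: power2_norm_eq_inner inner_vec_def)
  have "(norm ((A ** B) $ i $ j))\<^sup>2 \<le>
      (\<Sum>k\<in>UNIV. (norm (A $ i $ k))\<^sup>2) * (\<Sum>k\<in>UNIV. (norm (B $ k $ j))\<^sup>2)" for i j
  proof -
    have "norm ((A ** B) $ i $ j) \<le> (\<Sum>k\<in>UNIV. norm (A $ i $ k) * norm (B $ k $ j))"
      by (simp add: matrix_matrix_mult_def norm_mult[symmetric] norm_sum)
    then have "(norm ((A ** B) $ i $ j))\<^sup>2 \<le> (\<Sum>k\<in>UNIV. norm (A $ i $ k) * norm (B $ k $ j))\<^sup>2"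
      by (intro power_mono) auto
    also have "\<dots> \<le> (\<Sum>k\<in>UNIV. (norm (A $ i $ k))\<^sup>2) * (\<Sum>k\<in>UNIV. (norm (B $ k $ j))\<^sup>2)"
      by (rule Cauchy_Schwarz_ineq_sum)
    finally show ?thesis .
  qed
  then have "(norm (A ** B))\<^sup>2 \<le> (\<Sum>i\<in>UNIV. \<Sum>j\<in>UNIV.
      (\<Sum>k\<in>UNIV. (norm (A $ i $ k))\<^sup>2) * (\<Sum>k\<in>UNIV. (norm (B $ k $ j))\<^sup>2))"
    unfolding sq[of "A ** B"] by (intro sum_mono)
  also have "\<dots> = (norm A)\<^sup>2 * (\<Sum>j\<in>UNIV. \<Sum>k\<in>UNIV. (norm (B $ k $ j))\<^sup>2)"
    unfolding sq[of A] sum_product ..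
  also have "(\<Sum>j\<in>UNIV. \<Sum>k\<in>UNIV. (norm (B $ k $ j))\<^sup>2) = (norm B)\<^sup>2"
    unfolding sq[of B] by (rule sum.swap)
  finally have "(norm (A ** B))\<^sup>2 \<le> (norm A * norm B)\<^sup>2" by (simp add: power_mult_distrib)
  then show ?thesis by (rule power2_le_imp_le) simp
qed

lemma norm_matrix_mult3_le:
  fixes A :: "complex^'n^'m" and B :: "complex^'p^'n" and C :: "complex^'q^'p"
  shows "norm (A ** B ** C) \<le> norm A * norm B * norm C"
  by (rule order_trans[OF norm_matrix_mult_le mult_right_mono[OF norm_matrix_mult_le]]) simp

lemma norm_matrix_vector_mult_le:
  fixes A :: "complex^'n^'m"
  shows "norm (A *v x) \<le> norm A * norm x"
proof -
  \<comment> \<open>The vector is read as a one-column matrix, so that the matrix estimate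
    applies.\<close>
  define X :: "complex^1^'n" where "X = (\<chi> i j. x $ i)"
  have "norm (A ** X) = norm (A *v x)" and "norm X = norm x"
    by (simp_all add: norm_eq_sqrt_inner inner_vec_def X_def matrix_matrix_mult_def matrix_vector_mult_def)
  then show ?thesis using norm_matrix_mult_le[of A X] by simp
qed

lemma norm_cadj [simp]: "norm (cadj A) = norm A"
  by (simp add: norm_eq_sqrt_inner cadj_inner_cadj)

lemma norm_herm_part_le: "norm (herm_part A) \<le> norm A"
proof -
  have "norm (herm_part A) \<le> (1/2) * (norm A + norm (cadj A))"
    unfolding herm_part_def norm_scaleR using norm_triangle_ineq[of A "cadj A"] by simp
  then show ?thesis by simp
qed

section \<open>Spectral theorem and positive definite matrices\<close>

text \<open>The library inner product is only the real part, so unitarity has to be expressed by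
  this sesquilinear form, conjugate-linear in the first argument.\<close>

definition herm_prod :: "complex^'n \<Rightarrow> complex^'n \<Rightarrow> complex" where
  "herm_prod x y = (\<Sum>k\<in>UNIV. cnj (x $ k) * y $ k)"

lemma herm_prod_eq_Complex: "herm_prod x y = Complex (x \<bullet> y) ((\<i> *s x) \<bullet> y)"
  by (simp add: herm_prod_def complex_eq_iff inner_vec_def inner_complex_def algebra_simps)

text \<open>Induction on the index set: a maximizer of the Rayleigh quotient on the complement of
  the eigenvectors found so far is a further eigenvector.\<close>

lemma exists_orthonormal_eigenfamily:
  fixes A :: "complex^'n^'n" and I :: "'n set"
  assumes "hermitian A" and "finite I"
  shows "\<exists>u d. (\<forall>i\<in>I. A *v u i = d i *\<^sub>R u i) \<and>
           (\<forall>i\<in>I. \<forall>j\<in>I. herm_prod (u i) (u j) = (if i = j then 1 else 0))"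
  using assms(2)
proof induction
  case empty
  show ?case by simp
next
  case (insert j I)
  then obtain u d where ev: "\<And>i. i \<in> I \<Longrightarrow> A *v u i = d i *\<^sub>R u i"
    and on: "\<And>i k. i \<in> I \<Longrightarrow> k \<in> I \<Longrightarrow> herm_prod (u i) (u k) = (if i = k then 1 else 0)"
    by blast
  have Aadj: "(A *v x) \<bullet> y = x \<bullet> (A *v y)" for x y
    using assms(1) by (simp add: inner_matrix_vector_left hermitian_def)
  \<comment> \<open>With the multiples by the imaginary unit included, the real orthogonal
    complement of \<open>T\<close> is the complex one. It is invariant since \<open>A\<close> is
    self-adjoint and scales every element of \<open>T\<close>.\<close>
  define T where "T = u ` I \<union> (\<lambda>i. \<i> *s u i) ` I"
  have finT: "finite T" using insert.hyps by (simp add: T_def)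
  have "card T \<le> card (u ` I) + card ((\<lambda>i. \<i> *s u i) ` I)"
    unfolding T_def by (rule card_Un_le)
  also have "\<dots> \<le> card I + card I"
    by (intro add_mono card_image_le insert.hyps)
  finally have "card T \<le> 2 * card I" by simp
  moreover have "card (insert j I) \<le> CARD('n)" by (rule card_mono) auto
  \<comment> \<open>The real dimension is twice \<open>CARD('n)\<close>, and \<open>I\<close> misses
    at least the index \<open>j\<close>, so \<open>T\<close> cannot span.\<close>
  ultimately have "card T < DIM(complex^'n)"
    using insert.hyps by simp
  moreover have "dim (span T) \<le> card T"
    using finT by (simp add: dim_le_card')
  ultimately have "dim (span T) < DIM(complex^'n)" by linarith
  then have "dim T < DIM(complex^'n)" by simp
  then obtain w0 where w0: "w0 \<noteq> 0" "\<And>y. y \<in> span T \<Longrightarrow> orthogonal w0 y"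
    using orthogonal_to_subspace_exists by blast
  define W where "W = {x. \<forall>y\<in>T. y \<bullet> x = 0}"
  have "w0 \<in> W"
    using w0(2) span_base by (auto simp: W_def orthogonal_def inner_commute)
  have W_lin: "r *\<^sub>R x + s *\<^sub>R y \<in> W" if "x \<in> W" "y \<in> W" for r s x y
    using that by (auto simp: W_def inner_add_right)
  have A_i: "A *v (\<i> *s x) = \<i> *s (A *v x)" for x
    by (simp add: vec_eq_iff matrix_vector_mult_def sum_distrib_left mult.left_commute)
  have ev_i: "A *v (\<i> *s u i) = d i *\<^sub>R (\<i> *s u i)" if "i \<in> I" for i
    by (simp add: A_i ev that vec_eq_iff)
  have W_A: "A *v x \<in> W" if "x \<in> W" for x
  proof -
    have "y \<bullet> (A *v x) = 0" if "y \<in> T" for y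
    proof -
      obtain r where "A *v y = r *\<^sub>R y" using \<open>y \<in> T\<close> ev ev_i by (auto simp: T_def)
      then show ?thesis using \<open>x \<in> W\<close> \<open>y \<in> T\<close> by (simp add: Aadj[symmetric] W_def)
    qed
    then show ?thesis by (simp add: W_def)
  qed
  have "compact (sphere 0 1 \<inter> W)"
  proof (rule compact_Int_closed)
    have "W = (\<Inter>y\<in>T. {x. y \<bullet> x = 0})" by (auto simp: W_def)
    then show "closed W" by (simp add: closed_INT closed_hyperplane)
  qed simp
  moreover have "(1 / norm w0) *\<^sub>R w0 \<in> sphere 0 1 \<inter> W"
    using w0 W_lin[OF \<open>w0 \<in> W\<close> \<open>w0 \<in> W\<close>, of "1 / norm w0" 0] by simp
  moreover have cont: "continuous_on X (\<lambda>x. x \<bullet> (A *v x))" for X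
    by (intro continuous_intros matvec.continuous_on)
  ultimately obtain v where v: "v \<in> sphere 0 1 \<inter> W"
    and vmax: "\<And>x. x \<in> sphere 0 1 \<inter> W \<Longrightarrow> x \<bullet> (A *v x) \<le> v \<bullet> (A *v v)"
    using continuous_attains_sup[of "sphere 0 1 \<inter> W" "\<lambda>x. x \<bullet> (A *v x)"] by blast
  define m where "m = v \<bullet> (A *v v)"
  have vW: "v \<in> W" and v1: "norm v = 1" using v by auto
  have bound: "x \<bullet> (A *v x) \<le> m * (x \<bullet> x)" if "x \<in> W" for x
  proof (cases "x = 0")
    case False
    have "(1 / norm x) *\<^sub>R x \<in> sphere 0 1 \<inter> W"
      using False W_lin[OF that that, of "1 / norm x" 0] by simp
    from vmax[OF this] have "(1 / norm x)\<^sup>2 * (x \<bullet> (A *v x)) \<le> m"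
      by (simp add: m_def matvec.scaleR_right power2_eq_square)
    then show ?thesis using False by (simp add: field_simps power2_norm_eq_inner)
  qed simp
  define y where "y = A *v v - m *\<^sub>R v"
  have yW: "y \<in> W"
    using W_lin[OF W_A[OF vW] vW, of 1 "-m"] by (simp add: y_def)
  \<comment> \<open>Expanding the Rayleigh bound at v + t y, the terms linear in t leave 2 t |y|^2,
    while \<open>c\<close> collects the quadratic ones.\<close>
  define c where "c = m * (y \<bullet> y) - y \<bullet> (A *v y)"
  have c: "2 * t * (y \<bullet> y) \<le> t\<^sup>2 * c" for t
  proof -
    have "v + t *\<^sub>R y \<in> W" using W_lin[OF vW yW, of 1 t] by simp
    from bound[OF this]
    have "(v + t *\<^sub>R y) \<bullet> (A *v (v + t *\<^sub>R y)) \<le> m * ((v + t *\<^sub>R y) \<bullet> (v + t *\<^sub>R y))" .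
    moreover have "v \<bullet> (A *v y) = y \<bullet> (A *v v)"
      by (metis Aadj inner_commute)
    then have "(v + t *\<^sub>R y) \<bullet> (A *v (v + t *\<^sub>R y)) =
        m + 2 * t * (y \<bullet> (A *v v)) + t\<^sup>2 * (y \<bullet> (A *v y))"
      by (simp add: matvec.add_right matvec.scaleR_right inner_add_left inner_add_right
          m_def power2_eq_square algebra_simps)
    moreover have "(v + t *\<^sub>R y) \<bullet> (v + t *\<^sub>R y) = 1 + 2 * t * (y \<bullet> v) + t\<^sup>2 * (y \<bullet> y)"
      using v1 by (simp add: inner_add_left inner_add_right power2_eq_square norm_eq_1
          inner_commute[of v y] distrib_left)
    ultimately have "m + 2 * t * (y \<bullet> (A *v v)) + t\<^sup>2 * (y \<bullet> (A *v y)) \<le>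
        m * (1 + 2 * t * (y \<bullet> v) + t\<^sup>2 * (y \<bullet> y))"
      by simp
    moreover have "y \<bullet> (A *v v) = y \<bullet> y + m * (y \<bullet> v)"
      by (subst (2) y_def) (simp add: inner_diff_right)
    ultimately have "m + 2 * t * (y \<bullet> y + m * (y \<bullet> v)) + t\<^sup>2 * (y \<bullet> (A *v y)) \<le>
        m * (1 + 2 * t * (y \<bullet> v) + t\<^sup>2 * (y \<bullet> y))"
      by (simp only:)
    then show ?thesis by (simp add: c_def algebra_simps)
  qed
  have "y \<bullet> y \<le> 0"
  proof (rule ccontr)
    assume pos: "\<not> y \<bullet> y \<le> 0"
    \<comment> \<open>Small enough that t c is at most |y|^2, against the required lower bound 2
      |y|^2; the summand 1 keeps the denominator positive.\<close>
    define t where "t = (y \<bullet> y) / (\<bar>c\<bar> + 1)"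
    have t0: "t > 0" unfolding t_def by (rule divide_pos_pos) (use pos in linarith)+
    have "2 * (y \<bullet> y) \<le> t * c" using c[of t] t0 by (simp add: power2_eq_square)
    also have "\<dots> \<le> t * (\<bar>c\<bar> + 1)" using t0 by (intro mult_left_mono) auto
    also have "\<dots> = y \<bullet> y" by (simp add: t_def field_simps)
    finally show False using pos by simp
  qed
  then have "y = 0" by (metis inner_gt_zero_iff not_le)
  then have evv: "A *v v = m *\<^sub>R v" by (simp add: y_def)
  have hv: "herm_prod (u i) v = 0" if "i \<in> I" for i
    using vW that by (simp add: W_def T_def herm_prod_eq_Complex complex_eq_iff)
  have hv': "herm_prod v (u i) = 0" if "i \<in> I" for i
  proof -
    have "herm_prod v (u i) = cnj (herm_prod (u i) v)"
      by (simp add: herm_prod_def mult.commute)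
    then show ?thesis using hv[OF that] by simp
  qed
  have hvv: "herm_prod v v = 1"
    using v1 by (simp add: herm_prod_eq_Complex complex_eq_iff norm_eq_1)
      (simp add: inner_vec_def inner_complex_def)
  show ?case
  proof (intro exI conjI)
    show "\<forall>i\<in>insert j I. A *v (u(j := v)) i = (d(j := m)) i *\<^sub>R (u(j := v)) i"
      using ev evv insert.hyps by auto
    show "\<forall>i\<in>insert j I. \<forall>k\<in>insert j I. herm_prod ((u(j := v)) i) ((u(j := v)) k) = (if i = k then 1 else 0)"
      using on hv hv' hvv insert.hyps by auto
  qed
qed

lemma hermitian_spectral:
  fixes A :: "complex^'n^'n"
  assumes "hermitian A"
  obtains U :: "complex^'n^'n" and d
  where "cadj U ** U = mat 1" and "A = U ** real_diag d ** cadj U"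
proof -
  obtain u :: "'n \<Rightarrow> complex^'n" and d where ev: "\<And>i. A *v u i = d i *\<^sub>R u i"
    and on: "\<And>i j. herm_prod (u i) (u j) = (if i = j then 1 else 0)"
    using exists_orthonormal_eigenfamily[OF assms finite_class.finite_UNIV] by auto
  define U where "U = (\<chi> i j. u j $ i)"
  have UU: "cadj U ** U = mat 1"
    using on by (simp add: vec_eq_iff matrix_matrix_mult_def cadj_def U_def mat_def herm_prod_def)
  have "A ** U = U ** real_diag d"
  proof -
    have "(A ** U) $ i $ j = (U ** real_diag d) $ i $ j" for i j
    proof -
      have "(A ** U) $ i $ j = (A *v u j) $ i"
        by (simp add: matrix_matrix_mult_def matrix_vector_mult_def U_def)
      also have "\<dots> = (U ** real_diag d) $ i $ j"
        by (simp add: ev matrix_mult_real_diag_nth U_def scaleR_conv_of_real[where 'a=complex] mult.commute)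
      finally show ?thesis .
    qed
    then show ?thesis by (simp add: vec_eq_iff)
  qed
  then have "A ** (U ** cadj U) = U ** real_diag d ** cadj U"
    by (simp add: matrix_mul_assoc)
  moreover have "U ** cadj U = mat 1"
    using UU matrix_mult_eq_mat_1_commute by blast
  ultimately show ?thesis
    using UU that[of U d] by simp
qed

lemma inner_spectral_vec:
  fixes U :: "complex^'n^'n"
  shows "x \<bullet> ((U ** real_diag d ** cadj U) *v x) = (\<Sum>i\<in>UNIV. d i * (norm ((cadj U *v x) $ i))\<^sup>2)"
proof -
  have "x \<bullet> ((U ** real_diag d ** cadj U) *v x) = (cadj U *v x) \<bullet> (real_diag d *v (cadj U *v x))"
    by (simp add: inner_matrix_vector_left matrix_vector_mul_assoc matrix_mul_assoc)
  also have "\<dots> = (\<Sum>i\<in>UNIV. d i * (norm ((cadj U *v x) $ i))\<^sup>2)"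
    by (simp add: inner_vec_def real_diag_vec_nth scaleR_conv_of_real[symmetric] power2_norm_eq_inner)
  finally show ?thesis .
qed

lemma spectral_vector:
  fixes U :: "complex^'n^'n"
  assumes "cadj U ** U = mat 1"
  obtains x where "norm x = 1" and "x \<bullet> ((U ** real_diag d ** cadj U) *v x) = d i"
    and "(U ** real_diag d ** cadj U) *v x = d i *\<^sub>R x"
proof
  have *: "cadj U *v (U *v axis i 1) = axis i 1"
    by (simp add: matrix_vector_mul_assoc assms)
  have axis_sq: "(norm ((axis i 1 :: complex^'n) $ k))\<^sup>2 = (if k = i then 1 else 0)" for k
    by (simp add: axis_def)
  show "norm (U *v axis i 1) = 1" by (simp add: norm_unitary_vec assms)
  show "(U *v axis i 1) \<bullet> ((U ** real_diag d ** cadj U) *v (U *v axis i 1)) = d i"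
    unfolding inner_spectral_vec * axis_sq by (simp add: if_distrib cong: if_cong)
  have "real_diag d *v axis i 1 = d i *\<^sub>R axis i 1"
    by (auto simp: vec_eq_iff real_diag_vec_nth axis_def scaleR_conv_of_real[where 'a=complex])
  then show "(U ** real_diag d ** cadj U) *v (U *v axis i 1) = d i *\<^sub>R (U *v axis i 1)"
    by (metis * matrix_vector_mul_assoc matvec.scaleR_right)
qed

text \<open>The Loewner bound A >= e I. For e = 0 it is semidefiniteness; unlike
  \<open>pos_def\<close> it is a closed condition and carries a constant that can be made
  uniform.\<close>

definition herm_ge :: "real \<Rightarrow> complex^'n^'n \<Rightarrow> bool" where
  "herm_ge e A \<longleftrightarrow> hermitian A \<and> (\<forall>x. e * (x \<bullet> x) \<le> x \<bullet> (A *v x))"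

lemma herm_ge_mono: "herm_ge e A \<Longrightarrow> e' \<le> e \<Longrightarrow> herm_ge e' A"
  unfolding herm_ge_def by (meson inner_ge_zero mult_right_mono order_trans)

lemma hermitian_spectral_form [simp]: "hermitian (U ** real_diag d ** cadj U)"
  by (simp add: hermitian_def cadj_mult matrix_mul_assoc)

lemma herm_ge_spectral:
  fixes U :: "complex^'n^'n"
  assumes "cadj U ** U = mat 1"
  shows "herm_ge e (U ** real_diag d ** cadj U) \<longleftrightarrow> (\<forall>i. e \<le> d i)"
proof
  assume ge: "herm_ge e (U ** real_diag d ** cadj U)"
  show "\<forall>i. e \<le> d i"
  proof
    fix i
    obtain x where "norm x = 1" "x \<bullet> ((U ** real_diag d ** cadj U) *v x) = d i"
      using spectral_vector[OF assms] by metis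
    then show "e \<le> d i"
      using ge unfolding herm_ge_def by (metis mult.right_neutral norm_eq_1)
  qed
next
  assume d: "\<forall>i. e \<le> d i"
  have "cadj (cadj U) ** cadj U = mat 1"
    using assms matrix_mult_eq_mat_1_commute by auto
  then have *: "(cadj U *v x) \<bullet> (cadj U *v x) = x \<bullet> x" for x
    by (metis norm_unitary_vec power2_norm_eq_inner)
  have "e * (x \<bullet> x) \<le> x \<bullet> ((U ** real_diag d ** cadj U) *v x)" for x
    unfolding inner_spectral_vec *[of x, symmetric]
    using d by (simp add: inner_vec_def sum_distrib_left power2_norm_eq_inner sum_mono mult_right_mono)
  then show "herm_ge e (U ** real_diag d ** cadj U)"
    by (simp add: herm_ge_def)
qed

lemma pos_def_imp_herm_ge:
  fixes A :: "complex^'n^'n"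
  assumes "pos_def A" obtains e where "e > 0" "herm_ge e A"
proof -
  obtain U :: "complex^'n^'n" and d where U: "cadj U ** U = mat 1" and A: "A = U ** real_diag d ** cadj U"
    using assms hermitian_spectral pos_def_def by blast
  have "0 < d i" for i
  proof -
    obtain x where "norm x = 1" "x \<bullet> (A *v x) = d i"
      using spectral_vector[OF U, of d i] A by metis
    then show ?thesis
      using assms unfolding pos_def_def by (metis norm_zero zero_neq_one)
  qed
  then have "0 < Min (range d)" by simp
  moreover have "herm_ge (Min (range d)) A" by (simp add: A herm_ge_spectral[OF U])
  ultimately show ?thesis using that by blast
qed

lemma herm_ge_imp_pos_def: "herm_ge e A \<Longrightarrow> e > 0 \<Longrightarrow> pos_def A"
  unfolding herm_ge_def pos_def_def
  by (metis inner_gt_zero_iff less_le_trans mult_pos_pos)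

lemma pos_def_imp_herm_ge_0: "pos_def A \<Longrightarrow> herm_ge 0 A"
  by (meson herm_ge_mono less_imp_le pos_def_imp_herm_ge)

lemma herm_ge_spectralE:
  fixes A :: "complex^'n^'n"
  assumes "herm_ge e A"
  obtains U :: "complex^'n^'n" and d
  where "cadj U ** U = mat 1" and "A = U ** real_diag d ** cadj U" and "\<And>i. e \<le> d i"
  using assms hermitian_spectral herm_ge_spectral by (metis herm_ge_def)

lemma pos_def_spectralE:
  fixes A :: "complex^'n^'n"
  assumes "pos_def A"
  obtains U :: "complex^'n^'n" and d
  where "cadj U ** U = mat 1" and "A = U ** real_diag d ** cadj U" and "\<And>i. 0 < d i"
  using assms by (metis herm_ge_spectralE pos_def_imp_herm_ge less_le_trans)

lemma pos_def_spectral: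
  fixes U :: "complex^'n^'n"
  assumes "cadj U ** U = mat 1" and "\<And>i. 0 < d i"
  shows "pos_def (U ** real_diag d ** cadj U)"
proof (rule herm_ge_imp_pos_def)
  show "herm_ge (Min (range d)) (U ** real_diag d ** cadj U)" by (simp add: herm_ge_spectral[OF assms(1)])
  show "0 < Min (range d)" using assms(2) by simp
qed

section \<open>Inverse and logarithm through the spectral decomposition\<close>

lemma matrix_inv_eqI:
  fixes A B :: "complex^'n^'n"
  assumes "A ** B = mat 1"
  shows "matrix_inv A = B"
proof -
  have BA: "B ** A = mat 1" using assms matrix_mult_eq_mat_1_commute by blast
  have "A ** matrix_inv A = mat 1 \<and> matrix_inv A ** A = mat 1"
    unfolding matrix_inv_def by (rule someI[of _ B]) (simp add: assms BA)
  then show ?thesis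
    by (metis BA matrix_mul_assoc matrix_mul_lid matrix_mul_rid)
qed

lemma unitary_conj_mult:
  fixes U :: "complex^'n^'n"
  assumes "cadj U ** U = mat 1"
  shows "(U ** X ** cadj U) ** (U ** Y ** cadj U) = U ** (X ** Y) ** cadj U"
  by (metis (no_types, lifting) assms matrix_mul_assoc matrix_mul_rid)

lemma matrix_inv_spectral:
  fixes U :: "complex^'n^'n"
  assumes "cadj U ** U = mat 1" and "\<And>i. d i \<noteq> 0"
  shows "matrix_inv (U ** real_diag d ** cadj U) = U ** real_diag (\<lambda>i. 1 / d i) ** cadj U"
proof (rule matrix_inv_eqI)
  have "U ** cadj U = mat 1" using assms matrix_mult_eq_mat_1_commute by blast
  then show "(U ** real_diag d ** cadj U) ** (U ** real_diag (\<lambda>i. 1 / d i) ** cadj U) = mat 1"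
    by (simp add: unitary_conj_mult assms real_diag_mult real_diag_one)
qed

lemma pos_def_matrix_inv:
  fixes A :: "complex^'n^'n"
  assumes "pos_def A"
  shows "pos_def (matrix_inv A)" and "A ** matrix_inv A = mat 1" and "matrix_inv A ** A = mat 1"
    and "invertible A"
proof -
  obtain U :: "complex^'n^'n" and d where U: "cadj U ** U = mat 1"
    and A: "A = U ** real_diag d ** cadj U" and d: "\<And>i. 0 < d i"
    using pos_def_spectralE[OF assms] by metis
  have d0: "d i \<noteq> 0" for i using d[of i] by simp
  have inv: "matrix_inv A = U ** real_diag (\<lambda>i. 1 / d i) ** cadj U"
    unfolding A by (rule matrix_inv_spectral[OF U d0])
  show "pos_def (matrix_inv A)"
    unfolding inv using d by (intro pos_def_spectral[OF U]) simp
  have "U ** cadj U = mat 1" using U matrix_mult_eq_mat_1_commute by blast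
  then show *: "A ** matrix_inv A = mat 1"
    unfolding inv by (simp add: A unitary_conj_mult U real_diag_mult d0 real_diag_one)
  then show "matrix_inv A ** A = mat 1" using matrix_mult_eq_mat_1_commute by blast
  with * show "invertible A" by (auto simp: invertible_def)
qed

lemma norm_unitary_conj:
  fixes U W :: "complex^'n^'n"
  assumes "cadj U ** U = mat 1" and "cadj W ** W = mat 1"
  shows "norm (U ** X ** cadj W) = norm X"
proof -
  have "(U ** X ** cadj W) \<bullet> (U ** X ** cadj W) = X \<bullet> (cadj U ** (U ** X ** cadj W) ** W)"
    unfolding inner_mult_right[of "U ** X" "cadj W"] inner_mult_left[of U X] cadj_cadj matrix_mul_assoc ..
  also have "cadj U ** (U ** X ** cadj W) ** W = X"
    by (metis assms matrix_mul_assoc matrix_mul_lid matrix_mul_rid)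
  finally show ?thesis by (simp add: norm_eq_sqrt_inner)
qed

text \<open>After diagonalization the Frobenius norm is estimated by the sum of the row norms, each
  at most 1 / e; hence the crude factor \<open>CARD('n)\<close>.\<close>

lemma norm_matrix_inv_le:
  fixes A :: "complex^'n^'n"
  assumes "herm_ge e A" and "e > 0"
  shows "norm (matrix_inv A) \<le> real CARD('n) / e"
proof -
  obtain U :: "complex^'n^'n" and d where U: "cadj U ** U = mat 1" and A: "A = U ** real_diag d ** cadj U"
    and d: "\<And>i. e \<le> d i"
    using assms herm_ge_spectralE by metis
  have d0: "0 < d i" for i using d[of i] assms(2) by linarith
  have "norm (matrix_inv A) = norm (real_diag (\<lambda>i. 1 / d i) :: complex^'n^'n)"
    unfolding A using d0 by (subst matrix_inv_spectral[OF U]) (auto simp: norm_unitary_conj[OF U U] less_imp_neq[symmetric])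
  also have "\<dots> \<le> (\<Sum>i\<in>UNIV. norm (real_diag (\<lambda>i. 1 / d i) $ i :: complex^'n))"
    unfolding norm_vec_def by (rule L2_set_le_sum) simp
  also have "\<dots> \<le> (\<Sum>i\<in>(UNIV::'n set). 1 / e)"
  proof (rule sum_mono)
    fix i :: 'n
    have "real_diag (\<lambda>i. 1 / d i) $ i = (1 / d i) *\<^sub>R (axis i 1 :: complex^'n)"
      by (auto simp: vec_eq_iff real_diag_nth axis_def scaleR_conv_of_real[where 'a=complex])
    then have "norm (real_diag (\<lambda>i. 1 / d i) $ i :: complex^'n) = 1 / d i"
      using d0[of i] by simp
    then show "norm (real_diag (\<lambda>i. 1 / d i) $ i :: complex^'n) \<le> 1 / e"
      using d[of i] assms(2) by (simp add: frac_le)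
  qed
  finally show ?thesis by simp
qed

text \<open>With Q = W^* U the equation becomes Q diag(d) = diag(e) Q, that is Q_ij (d_j - e_i) = 0
  for each entry. This criterion survives applying one function to all eigenvalues, which makes the
  logarithm well defined, and it also settles the equality case of Klein's inequality.\<close>

lemma spectral_eq_iff:
  fixes U W :: "complex^'n^'n"
  assumes U: "cadj U ** U = mat 1" and W: "cadj W ** W = mat 1"
  shows "U ** real_diag d ** cadj U = W ** real_diag e ** cadj W \<longleftrightarrow>
    (\<forall>i j. (cadj W ** U) $ i $ j = 0 \<or> d j = e i)"
proof -
  define Q where "Q = cadj W ** U"
  have U': "U ** cadj U = mat 1" and W': "W ** cadj W = mat 1"
    using U W matrix_mult_eq_mat_1_commute by blast+
  have "U ** real_diag d ** cadj U = W ** real_diag e ** cadj W \<longleftrightarrow>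
      Q ** real_diag d = real_diag e ** Q"
  proof
    assume eq: "U ** real_diag d ** cadj U = W ** real_diag e ** cadj W"
    have "Q ** real_diag d = cadj W ** (U ** real_diag d ** cadj U) ** U"
      unfolding Q_def by (metis U matrix_mul_assoc matrix_mul_rid)
    also have "\<dots> = real_diag e ** Q"
      unfolding eq Q_def by (simp add: W matrix_mul_assoc)
    finally show "Q ** real_diag d = real_diag e ** Q" .
  next
    assume eq: "Q ** real_diag d = real_diag e ** Q"
    have "U ** real_diag d ** cadj U = W ** (Q ** real_diag d) ** cadj U"
      unfolding Q_def by (simp add: W' matrix_mul_assoc)
    also have "\<dots> = W ** real_diag e ** cadj W"
      unfolding eq unfolding Q_def by (metis U' matrix_mul_assoc matrix_mul_rid)
    finally show "U ** real_diag d ** cadj U = W ** real_diag e ** cadj W" .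
  qed
  also have "\<dots> \<longleftrightarrow> (\<forall>i j. Q $ i $ j = 0 \<or> d j = e i)"
    by (simp add: vec_eq_iff matrix_mult_real_diag_nth real_diag_matrix_mult_nth)
  finally show ?thesis by (simp add: Q_def)
qed

lemma mat_log_spectral:
  fixes U :: "complex^'n^'n"
  assumes U: "cadj U ** U = mat 1" and d: "\<And>i. 0 < d i"
  shows "mat_log (U ** real_diag d ** cadj U) = U ** real_diag (\<lambda>i. ln (d i)) ** cadj U"
  unfolding mat_log_def
proof (rule the_equality)
  fix B
  assume "\<exists>(W :: complex^'n^'n) e. cadj W ** W = mat 1 \<and> (\<forall>i. 0 < e i) \<and>
      U ** real_diag d ** cadj U = W ** real_diag e ** cadj W \<and>
      B = W ** real_diag (\<lambda>i. ln (e i)) ** cadj W"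
  then obtain W :: "complex^'n^'n" and e where W: "cadj W ** W = mat 1"
    and eq: "U ** real_diag d ** cadj U = W ** real_diag e ** cadj W"
    and B: "B = W ** real_diag (\<lambda>i. ln (e i)) ** cadj W"
    by blast
  have "\<forall>i j. (cadj W ** U) $ i $ j = 0 \<or> d j = e i"
    using eq unfolding spectral_eq_iff[OF U W] .
  then have "\<forall>i j. (cadj W ** U) $ i $ j = 0 \<or> ln (d j) = ln (e i)" by metis
  then show "B = U ** real_diag (\<lambda>i. ln (d i)) ** cadj U"
    unfolding B using spectral_eq_iff[OF U W, of "\<lambda>i. ln (d i)" "\<lambda>i. ln (e i)"] by simp
qed (use U d in blast)

lemma cmod_square: "(cmod z)\<^sup>2 = Re z * Re z + Im z * Im z"
  unfolding cmod_power2 by (simp add: power2_eq_square)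

text \<open>The squared overlaps of the two bases act as weights; for unitary \<open>U\<close> and
  \<open>W\<close> they form a doubly stochastic matrix by \<open>unitary_sums\<close>.\<close>

lemma inner_spectral_spectral:
  fixes U W :: "complex^'n^'n"
  shows "(W ** real_diag f ** cadj W) \<bullet> (U ** real_diag d ** cadj U) =
    (\<Sum>i\<in>UNIV. \<Sum>j\<in>UNIV. f i * d j * (norm ((cadj W ** U) $ i $ j))\<^sup>2)"
proof -
  define Q where "Q = cadj W ** U"
  have "(W ** real_diag f ** cadj W) \<bullet> (U ** real_diag d ** cadj U)
      = real_diag f \<bullet> (Q ** real_diag d ** cadj Q)"
    unfolding inner_mult_right[of "W ** real_diag f" "cadj W"] inner_mult_left[of W]
    by (simp add: Q_def cadj_mult matrix_mul_assoc)
  also have "\<dots> = (\<Sum>i\<in>UNIV. f i * (\<Sum>j\<in>UNIV. d j * (norm (Q $ i $ j))\<^sup>2))"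
  proof -
    have "Re ((Q ** real_diag d ** cadj Q) $ i $ i) = (\<Sum>j\<in>UNIV. d j * (norm (Q $ i $ j))\<^sup>2)" for i
      unfolding matrix_matrix_mult_def[of "Q ** real_diag d"] cmod_square
      by (simp add: matrix_mult_real_diag_nth cadj_def algebra_simps)
    then show ?thesis by (simp add: inner_real_diag)
  qed
  finally show ?thesis by (simp add: Q_def sum_distrib_left mult.assoc)
qed

lemma unitary_sums:
  fixes Q :: "complex^'n^'n"
  assumes "cadj Q ** Q = mat 1"
  shows "(\<Sum>j\<in>UNIV. (norm (Q $ i $ j))\<^sup>2) = 1" and "(\<Sum>i\<in>UNIV. (norm (Q $ i $ j))\<^sup>2) = 1"
proof -
  have "Q ** cadj Q = mat 1" using assms matrix_mult_eq_mat_1_commute by blast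
  then have "Re ((Q ** cadj Q) $ i $ i) = 1" by (simp add: mat_def)
  then show "(\<Sum>j\<in>UNIV. (norm (Q $ i $ j))\<^sup>2) = 1"
    unfolding cmod_square by (simp add: matrix_matrix_mult_def cadj_def)
  have "Re ((cadj Q ** Q) $ j $ j) = 1" using assms by (simp add: mat_def)
  then show "(\<Sum>i\<in>UNIV. (norm (Q $ i $ j))\<^sup>2) = 1"
    unfolding cmod_square by (simp add: matrix_matrix_mult_def cadj_def)
qed

lemma unitary_cadj_mult:
  fixes U W :: "complex^'n^'n"
  assumes U: "cadj U ** U = mat 1" and W: "cadj W ** W = mat 1"
  shows "cadj (cadj W ** U) ** (cadj W ** U) = mat 1"
proof -
  have "W ** cadj W = mat 1" using W matrix_mult_eq_mat_1_commute by blast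
  then show ?thesis
    by (metis U cadj_cadj cadj_mult matrix_mul_assoc matrix_mul_rid)
qed

section \<open>Trace inequalities for positive definite matrices\<close>

lemma Re_trace_eq_inner: "Re (trace A) = mat 1 \<bullet> A"
  by (simp add: inner_matrix_eq_trace)

lemma Re_trace_spectral:
  fixes U :: "complex^'n^'n"
  assumes U: "cadj U ** U = mat 1"
  shows "Re (trace (U ** real_diag d ** cadj U)) = (\<Sum>j\<in>UNIV. d j)"
proof -
  have "trace (U ** real_diag d ** cadj U) = trace (real_diag d)"
    by (subst trace_mult_commute) (simp add: matrix_mul_assoc U)
  then show ?thesis by (simp add: trace_def real_diag_nth)
qed

text \<open>The least eigenvalue is at most the Rayleigh quotient at \<open>v\<close>, and its
  reciprocal is one of the positive summands of the trace of the inverse.\<close>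

lemma Re_trace_inv_ge:
  fixes A :: "complex^'n^'n"
  assumes "pos_def A" and "norm v = 1"
  shows "1 / (v \<bullet> (A *v v)) \<le> Re (trace (matrix_inv A))"
proof -
  obtain U :: "complex^'n^'n" and d where U: "cadj U ** U = mat 1"
    and A: "A = U ** real_diag d ** cadj U" and d: "\<And>i. 0 < d i"
    using pos_def_spectralE[OF assms(1)] by metis
  have d0: "d i \<noteq> 0" for i using d[of i] by simp
  have "Min (range d) \<in> range d" by (rule Min_in) auto
  then obtain i where i: "d i = Min (range d)" by force
  have "herm_ge (d i) A" unfolding A herm_ge_spectral[OF U] by (simp add: i)
  then have "d i * (v \<bullet> v) \<le> v \<bullet> (A *v v)" by (simp add: herm_ge_def)
  then have "d i \<le> v \<bullet> (A *v v)" using assms(2) by (simp add: norm_eq_1)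
  then have "1 / (v \<bullet> (A *v v)) \<le> 1 / d i" using d[of i] by (simp add: frac_le)
  also have "\<dots> \<le> (\<Sum>j\<in>UNIV. 1 / d j)" 
    using d by (intro member_le_sum[of i UNIV "\<lambda>j. 1 / d j"]) (auto simp: less_imp_le)
  also have "\<dots> = Re (trace (matrix_inv A))"
    unfolding A matrix_inv_spectral[OF U d0] Re_trace_spectral[OF U] ..
  finally show ?thesis .
qed

text \<open>Klein's inequality for the logarithm.  In eigenbases of the two matrices it is the
  elementary inequality \<open>ln x \<le> x - 1\<close>, averaged with doubly stochastic weights.\<close>

lemma Klein_log:
  fixes A B :: "complex^'n^'n"
  assumes "pos_def A" and "pos_def B"
  shows "Re (trace (mat_log A)) - Re (trace (mat_log B)) \<le> matrix_inv B \<bullet> A - real CARD('n)" (is ?ineq)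
    and "Re (trace (mat_log A)) - Re (trace (mat_log B)) = matrix_inv B \<bullet> A - real CARD('n) \<Longrightarrow> A = B"
proof -
  obtain U :: "complex^'n^'n" and d where U: "cadj U ** U = mat 1"
    and A: "A = U ** real_diag d ** cadj U" and d: "\<And>i. 0 < d i"
    using pos_def_spectralE[OF assms(1)] by metis
  obtain W :: "complex^'n^'n" and e where W: "cadj W ** W = mat 1"
    and B: "B = W ** real_diag e ** cadj W" and e: "\<And>i. 0 < e i"
    using pos_def_spectralE[OF assms(2)] by metis
  have d0: "d i \<noteq> 0" and e0: "e i \<noteq> 0" for i using d[of i] e[of i] by simp_all
  define q where "q i j = (norm ((cadj W ** U) $ i $ j))\<^sup>2" for i j
  define g where "g i j = q i j * (d j / e i - 1 - ln (d j / e i))" for i j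
  have q0: "q i j \<ge> 0" for i j by (simp add: q_def)
  have qs: "(\<Sum>j\<in>UNIV. q i j) = 1" "(\<Sum>i\<in>UNIV. q i j) = 1" for i j
    unfolding q_def by (rule unitary_sums[OF unitary_cadj_mult[OF U W]])+
  have g0: "g i j \<ge> 0" for i j
    unfolding g_def using ln_le_minus_one[of "d j / e i"] d[of j] e[of i] q0[of i j]
    by (intro mult_nonneg_nonneg) auto
  have "(\<Sum>i\<in>UNIV. \<Sum>j\<in>UNIV. g i j) = (\<Sum>i\<in>UNIV. \<Sum>j\<in>UNIV. 1 / e i * d j * q i j) -
      (\<Sum>i\<in>UNIV. \<Sum>j\<in>UNIV. q i j) - (\<Sum>i\<in>UNIV. \<Sum>j\<in>UNIV. ln (d j) * q i j) +
      (\<Sum>i\<in>UNIV. \<Sum>j\<in>UNIV. ln (e i) * q i j)"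
    unfolding g_def sum_subtractf[symmetric] sum.distrib[symmetric]
    by (intro sum.cong refl) (simp add: ln_div d e d0 e0 algebra_simps)
  also have "(\<Sum>i\<in>UNIV. \<Sum>j\<in>UNIV. 1 / e i * d j * q i j) = matrix_inv B \<bullet> A"
    unfolding A B matrix_inv_spectral[OF W e0] inner_spectral_spectral q_def ..
  also have "(\<Sum>i\<in>UNIV. \<Sum>j\<in>UNIV. q i j) = real CARD('n)" by (simp add: qs)
  also have "(\<Sum>i\<in>UNIV. \<Sum>j\<in>UNIV. ln (e i) * q i j) = Re (trace (mat_log B))"
    unfolding B mat_log_spectral[OF W e] Re_trace_spectral[OF W]
    by (simp add: sum_distrib_left[symmetric] qs)
  also have "(\<Sum>i\<in>UNIV. \<Sum>j\<in>UNIV. ln (d j) * q i j) = Re (trace (mat_log A))"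
    unfolding A mat_log_spectral[OF U d] Re_trace_spectral[OF U]
    by (subst sum.swap) (simp add: sum_distrib_left[symmetric] qs)
  finally have eq: "(\<Sum>i\<in>UNIV. \<Sum>j\<in>UNIV. g i j) =
    matrix_inv B \<bullet> A - real CARD('n) - Re (trace (mat_log A)) + Re (trace (mat_log B))" .
  have "0 \<le> (\<Sum>i\<in>UNIV. \<Sum>j\<in>UNIV. g i j)" by (intro sum_nonneg g0)
  with eq show ?ineq by simp
  assume "Re (trace (mat_log A)) - Re (trace (mat_log B)) = matrix_inv B \<bullet> A - real CARD('n)"
  with eq have "(\<Sum>i\<in>UNIV. \<Sum>j\<in>UNIV. g i j) = 0" by simp
  then have gz: "g i j = 0" for i j
    by (simp add: sum_nonneg_eq_0_iff sum_nonneg g0)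
  \<comment> \<open>Equality in ln x <= x - 1 holds only at x = 1, so wherever the overlap is
    nonzero the eigenvalues agree.\<close>
  have "(cadj W ** U) $ i $ j = 0 \<or> d j = e i" for i j
    using gz[of i j] ln_eq_minus_one[of "d j / e i"] d[of j] e[of i] by (auto simp: g_def q_def)
  then show "A = B" unfolding A B spectral_eq_iff[OF U W] by blast
qed

text \<open>In eigenbases every eigenvalue of \<open>B\<close> may be lowered to \<open>e\<close>,
  because the eigenvalues of \<open>A\<close> and the weights are nonnegative.\<close>

lemma inner_herm_ge:
  fixes A B :: "complex^'n^'n"
  assumes "herm_ge 0 A" and "herm_ge e B"
  shows "e * Re (trace A) \<le> A \<bullet> B"
proof -
  obtain U :: "complex^'n^'n" and d where U: "cadj U ** U = mat 1"
    and A: "A = U ** real_diag d ** cadj U" and d: "\<And>i. 0 \<le> d i"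
    using herm_ge_spectralE[OF assms(1)] by metis
  obtain W :: "complex^'n^'n" and f where W: "cadj W ** W = mat 1"
    and B: "B = W ** real_diag f ** cadj W" and f: "\<And>i. e \<le> f i"
    using herm_ge_spectralE[OF assms(2)] by metis
  define q where "q i j = (norm ((cadj U ** W) $ i $ j))\<^sup>2" for i j
  have qs: "(\<Sum>j\<in>UNIV. q i j) = 1" for i
    unfolding q_def by (rule unitary_sums[OF unitary_cadj_mult[OF W U]])+
  have "e * Re (trace A) = (\<Sum>i\<in>UNIV. \<Sum>j\<in>UNIV. d i * e * q i j)"
    unfolding A Re_trace_spectral[OF U]
    by (simp add: sum_distrib_left[symmetric] qs sum_distrib_right[symmetric] mult.commute)
  also have "\<dots> \<le> (\<Sum>i\<in>UNIV. \<Sum>j\<in>UNIV. d i * f j * q i j)"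
    by (intro sum_mono mult_right_mono mult_left_mono d f) (simp add: q_def)
  also have "\<dots> = A \<bullet> B" unfolding A B inner_spectral_spectral q_def ..
  finally show ?thesis .
qed

lemma Re_trace_pos:
  fixes A :: "complex^'n^'n"
  assumes "herm_ge 0 A" and "A \<noteq> 0"
  shows "0 < Re (trace A)"
proof -
  obtain U :: "complex^'n^'n" and d where U: "cadj U ** U = mat 1"
    and A: "A = U ** real_diag d ** cadj U" and d: "\<And>i. 0 \<le> d i"
    using herm_ge_spectralE[OF assms(1)] by metis
  have "\<exists>i. d i \<noteq> 0"
  proof (rule ccontr)
    assume "\<nexists>i. d i \<noteq> 0"
    then have "real_diag d = (0 :: complex^'n^'n)" by (simp add: vec_eq_iff real_diag_nth)
    then show False using assms(2) A by (simp add: matmul.zero_left matmul.zero_right)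
  qed
  then have "0 < (\<Sum>i\<in>UNIV. d i)" using d by (metis UNIV_I finite_class.finite_UNIV less_eq_real_def sum_pos2)
  then show ?thesis unfolding A Re_trace_spectral[OF U] .
qed

lemma inner_pos_def_eq_0:
  fixes A B :: "complex^'n^'n"
  assumes "herm_ge 0 A" and "pos_def B" and "A \<bullet> B = 0"
  shows "A = 0"
proof (rule ccontr)
  assume "A \<noteq> 0"
  obtain e where e: "e > 0" "herm_ge e B" using assms(2) pos_def_imp_herm_ge by blast
  then have "0 < e * Re (trace A)" using Re_trace_pos[OF assms(1) \<open>A \<noteq> 0\<close>] by simp
  also have "\<dots> \<le> 0" using inner_herm_ge[OF assms(1) e(2)] assms(3) by simp
  finally show False by simp
qed

text \<open>In eigenbases of \<open>A\<close> and \<open>B\<close> the form is a sum of squared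
  entries with weights d_i e_j > 0. Allowing \<open>A\<close> and \<open>B\<close> to differ lets
  the same fact handle finite differences and derivatives of \<open>h\<close>.\<close>

lemma inner_sandwich_pos:
  fixes A B X :: "complex^'n^'n"
  assumes "pos_def A" and "pos_def B" and "X \<noteq> 0"
  shows "0 < (A ** X ** B) \<bullet> X"
proof -
  obtain U :: "complex^'n^'n" and d where U: "cadj U ** U = mat 1"
    and A: "A = U ** real_diag d ** cadj U" and d: "\<And>i. 0 < d i"
    using pos_def_spectralE[OF assms(1)] by metis
  obtain W :: "complex^'n^'n" and e where W: "cadj W ** W = mat 1"
    and B: "B = W ** real_diag e ** cadj W" and e: "\<And>i. 0 < e i"
    using pos_def_spectralE[OF assms(2)] by metis
  define Y where "Y = cadj U ** X ** W"
  have "A ** X ** B = U ** (real_diag d ** Y ** real_diag e) ** cadj W"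
    by (simp add: A B Y_def matrix_mul_assoc)
  also have "\<dots> \<bullet> X = (real_diag d ** Y ** real_diag e) \<bullet> Y"
    unfolding inner_mult_right[of _ "cadj W"] inner_mult_left[of U]
    by (simp add: Y_def matrix_mul_assoc)
  also have "\<dots> = (\<Sum>i\<in>UNIV. \<Sum>j\<in>UNIV. d i * e j * (norm (Y $ i $ j))\<^sup>2)"
  proof -
    have "(real_diag d ** Y ** real_diag e) $ i $ j = (d i * e j) *\<^sub>R (Y $ i $ j)" for i j
      by (simp add: matrix_mult_real_diag_nth real_diag_matrix_mult_nth scaleR_conv_of_real)
    then show ?thesis by (simp add: inner_vec_def[where 'a="complex^'n"] inner_vec_def[where 'a=complex]
          power2_norm_eq_inner)
  qed
  finally have eq: "(A ** X ** B) \<bullet> X = (\<Sum>i\<in>UNIV. \<Sum>j\<in>UNIV. d i * e j * (norm (Y $ i $ j))\<^sup>2)" .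
  have "cadj (cadj U) ** cadj U = mat 1" "cadj (cadj W) ** cadj W = mat 1"
    using U W matrix_mult_eq_mat_1_commute by auto
  from norm_unitary_conj[OF this, of X] have "norm Y = norm X" by (simp add: Y_def)
  with assms(3) have "Y \<noteq> 0" by auto
  then obtain i j where ij: "Y $ i $ j \<noteq> 0" by (auto simp: vec_eq_iff)
  have nn: "0 \<le> d i * e j * (norm (Y $ i $ j))\<^sup>2" for i j
    using d[of i] e[of j] by simp
  have "0 < d i * e j * (norm (Y $ i $ j))\<^sup>2" using d[of i] e[of j] ij by simp
  then have "0 < (\<Sum>j\<in>UNIV. d i * e j * (norm (Y $ i $ j))\<^sup>2)"
    using nn by (intro sum_pos2[of UNIV j]) auto
  then show ?thesis
    unfolding eq 
    by (intro sum_pos2[of UNIV i "\<lambda>i. \<Sum>j\<in>UNIV. d i * e j * (norm (Y $ i $ j))\<^sup>2"]) (auto intro: sum_nonneg nn)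
qed

text \<open>A zero eigenvalue would give a kernel vector. This is what prevents a solution of the
  differential equation from crossing the boundary of the cone.\<close>

lemma herm_ge_0_invertible_imp_pos_def:
  fixes A :: "complex^'n^'n"
  assumes "herm_ge 0 A" and "invertible A"
  shows "pos_def A"
proof -
  obtain U :: "complex^'n^'n" and d where U: "cadj U ** U = mat 1"
    and A: "A = U ** real_diag d ** cadj U" and d: "\<And>i. 0 \<le> d i"
    using herm_ge_spectralE[OF assms(1)] by metis
  have "0 < d i" for i
  proof (rule ccontr)
    assume "\<not> 0 < d i"
    with d[of i] have "d i = 0" by simp
    then obtain x where x: "norm x = 1" "A *v x = 0"
      using spectral_vector[OF U, of d i] A by (metis scaleR_zero_left)
    obtain A' where "A' ** A = mat 1" using assms(2) invertible_def by blast
    then have "x = A' *v (A *v x)" by (simp add: matrix_vector_mul_assoc)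
    with x show False by (simp add: matvec.zero_right)
  qed
  then show ?thesis unfolding A by (rule pos_def_spectral[OF U])
qed

text \<open>Resolvent identities. The first yields exact monotonicity of \<open>h\<close>;
  substituting it into its version with \<open>A\<close> and \<open>B\<close> exchanged yields the
  second, a remainder quadratic in \<open>A - B\<close> that identifies the derivative of
  inversion.\<close>

lemma matrix_inv_diff:
  fixes A B :: "complex^'n^'n"
  assumes "pos_def A" and "pos_def B"
  shows "matrix_inv A - matrix_inv B = - (matrix_inv A ** (A - B) ** matrix_inv B)"
    and "matrix_inv A - matrix_inv B + matrix_inv B ** (A - B) ** matrix_inv B =
      matrix_inv B ** (A - B) ** matrix_inv A ** (A - B) ** matrix_inv B"
proof -
  note inv = pos_def_matrix_inv(2,3)[OF assms(1)] pos_def_matrix_inv(2,3)[OF assms(2)]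
  have *: "matrix_inv X - matrix_inv Y = - (matrix_inv X ** (X - Y) ** matrix_inv Y)"
    if "matrix_inv X ** X = mat 1" "Y ** matrix_inv Y = mat 1" for X Y :: "complex^'n^'n"
    using that by (simp add: matmul.diff_left matmul.diff_right matrix_mul_assoc[symmetric])
  show 1: "matrix_inv A - matrix_inv B = - (matrix_inv A ** (A - B) ** matrix_inv B)"
    using inv by (intro *)
  have 2: "matrix_inv B - matrix_inv A = - (matrix_inv B ** (B - A) ** matrix_inv A)"
    using inv by (intro *)
  have "matrix_inv A - matrix_inv B + matrix_inv B ** (A - B) ** matrix_inv B =
      matrix_inv B ** (A - B) ** (matrix_inv B - matrix_inv A)"
    using 2 by (simp add: matmul.diff_right matmul.diff_left algebra_simps)
  also have "\<dots> = matrix_inv B ** (A - B) ** matrix_inv A ** (A - B) ** matrix_inv B"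
    unfolding minus_diff_eq[of "matrix_inv A" "matrix_inv B", symmetric] 1
    by (simp add: matrix_mul_assoc)
  finally show "matrix_inv A - matrix_inv B + matrix_inv B ** (A - B) ** matrix_inv B =
      matrix_inv B ** (A - B) ** matrix_inv A ** (A - B) ** matrix_inv B" .
qed

lemma hermitian_sandwich: "hermitian A \<Longrightarrow> hermitian X \<Longrightarrow> hermitian (A ** X ** A)"
  by (simp add: hermitian_def cadj_mult matrix_mul_assoc)

section \<open>The moment map on an interval\<close>

text \<open>A basis of the orthogonal complement works, since a subspace equals its double
  complement.\<close>

lemma subspace_perp_family:
  fixes V :: "'e::euclidean_space set"
  assumes "subspace V"
  obtains B where "finite B" and "\<And>x. x \<in> V \<longleftrightarrow> (\<forall>b\<in>B. x \<bullet> b = 0)"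
proof -
  obtain B where B: "B \<subseteq> V\<^sup>\<bottom>" "independent B" "V\<^sup>\<bottom> \<subseteq> span B"
    using basis_exists by metis
  show ?thesis
  proof (rule that[of B])
    show "finite B" using B(2) by (rule independent_imp_finite)
    fix x
    have "x \<in> V" if x: "\<forall>b\<in>B. x \<bullet> b = 0"
    proof -
      have "orthogonal x y" if "y \<in> V\<^sup>\<bottom>" for y
        using orthogonal_to_span[of y B x] B(3) that x by (auto simp: orthogonal_def)
      then have "x \<in> V\<^sup>\<bottom>\<^sup>\<bottom>" by (auto simp: orthogonal_comp_def orthogonal_commute)
      then show ?thesis by (simp add: orthogonal_comp_self[OF assms])
    qed
    moreover have "x \<bullet> b = 0" if "x \<in> V" "b \<in> B" for b
      using B(1) that by (auto simp: orthogonal_comp_def orthogonal_def inner_commute)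
    ultimately show "x \<in> V \<longleftrightarrow> (\<forall>b\<in>B. x \<bullet> b = 0)" by blast
  qed
qed

lemma C1_on_imp_continuous_on: "C1_on S f \<Longrightarrow> continuous_on S f"
  unfolding C1_on_def continuous_on_eq_continuous_within
  by (meson has_vector_derivative_continuous)

text \<open>The derivative is continuous, hence bounded on the compact interval, and the mean value
  inequality applies.\<close>

lemma C1_on_Icc_lipschitz:
  fixes f :: "real \<Rightarrow> 'b::real_normed_vector"
  assumes "C1_on {a..b} f"
  obtains K where "K \<ge> 0" and "\<And>x y. x \<in> {a..b} \<Longrightarrow> y \<in> {a..b} \<Longrightarrow> norm (f x - f y) \<le> K * \<bar>x - y\<bar>"
proof -
  obtain f' where cont: "continuous_on {a..b} f'"
    and der: "\<And>x. x \<in> {a..b} \<Longrightarrow> (f has_vector_derivative f' x) (at x within {a..b})"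
    using assms unfolding C1_on_def by blast
  have "bounded (f' ` {a..b})"
    by (intro compact_imp_bounded compact_continuous_image cont) simp
  then obtain K where K: "\<And>x. x \<in> {a..b} \<Longrightarrow> norm (f' x) \<le> K"
    unfolding bounded_iff by blast
  have K': "norm (f' x) \<le> \<bar>K\<bar>" if "x \<in> {a..b}" for x using K[OF that] by linarith
  show ?thesis
  proof (rule that[of "\<bar>K\<bar>"])
    fix x y assume xy: "x \<in> {a..b}" "y \<in> {a..b}"
    have "norm (f x - f y) \<le> \<bar>K\<bar> * norm (x - y)"
    proof (rule differentiable_bound[OF _ _ _ xy])
      show "convex {a..b}" by simp
      show "(f has_derivative (\<lambda>h. h *\<^sub>R f' z)) (at z within {a..b})" if "z \<in> {a..b}" for z
        using der[OF that] by (simp add: has_vector_derivative_def)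
      show "onorm (\<lambda>h. h *\<^sub>R f' z) \<le> \<bar>K\<bar>" if "z \<in> {a..b}" for z
        by (rule onorm_le) (use K'[OF that] in \<open>simp add: mult.commute[of "\<bar>K\<bar>"] mult_left_mono\<close>)
    qed
    then show "norm (f x - f y) \<le> \<bar>K\<bar> * \<bar>x - y\<bar>" by simp
  qed simp
qed

lemma moment_adj_add: "moment_adj Gl Gr (x + y) \<theta> = moment_adj Gl Gr x \<theta> + moment_adj Gl Gr y \<theta>"
  and moment_adj_diff: "moment_adj Gl Gr (x - y) \<theta> = moment_adj Gl Gr x \<theta> - moment_adj Gl Gr y \<theta>"
  and moment_adj_scaleR: "moment_adj Gl Gr (r *\<^sub>R x) \<theta> = r *\<^sub>R moment_adj Gl Gr x \<theta>"
  by (simp_all add: moment_adj_def matmul.add_left matmul.add_right matmul.diff_left matmul.diff_right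
      matmul.scaleR_left matmul.scaleR_right
      linear_add[OF linear_herm_part] linear_diff[OF linear_herm_part]
      linear_scale[OF linear_herm_part])

lemma hermitian_moment_adj [simp]: "hermitian (moment_adj Gl Gr x \<theta>)"
  by (simp add: moment_adj_def)

lemma inner_moment_adj:
  assumes "hermitian P"
  shows "moment_adj Gl Gr lam \<theta> \<bullet> P = lam \<bullet> (Gl \<theta> ** P ** Gr \<theta>)"
  unfolding moment_adj_def inner_herm_part[OF assms] inner_mult_right[of _ "cadj (Gr \<theta>)"]
    inner_mult_left[of "cadj (Gl \<theta>)"]
  by (simp add: matrix_mul_assoc)

lemma hermitian_add: "hermitian A \<Longrightarrow> hermitian B \<Longrightarrow> hermitian (A + B)"
  and hermitian_scaleR: "hermitian A \<Longrightarrow> hermitian (r *\<^sub>R A)"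
  by (simp_all add: hermitian_def cadj_add cadj_scaleR)

lemma pos_def_imp_hermitian: "pos_def A \<Longrightarrow> hermitian A"
  by (simp add: pos_def_def)

text \<open>The value grows like -(ln q) / k as q tends to 0; this divergence drives
  \<open>Om_ge_uniform\<close>. Both one-sided forms are stated because a point near an end of the
  interval has room on one side only.\<close>

lemma has_integral_reciprocal:
  fixes q k l c :: real
  assumes "0 < q" and "0 < k" and "0 \<le> l"
  shows "((\<lambda>x. 1 / (q + k * \<bar>x - c\<bar>)) has_integral (ln (q + k * l) - ln q) / k) {c..c + l}"
    and "((\<lambda>x. 1 / (q + k * \<bar>x - c\<bar>)) has_integral (ln (q + k * l) - ln q) / k) {c - l..c}"
proof -
  have der: "((\<lambda>x. ln (q + k * (x - c)) / k) has_real_derivative 1 / (q + k * (x - c))) (at x within X)"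
    if "x \<ge> c" for x X
  proof -
    have "q + k * (x - c) > 0" using assms that by (simp add: add_pos_nonneg)
    then have "((\<lambda>x. ln (q + k * (x - c))) has_real_derivative k * (1 / (q + k * (x - c)))) (at x within X)"
      by (auto intro!: derivative_eq_intros)
    from DERIV_cdivide[OF this, of k] show ?thesis using assms by simp
  qed
  have "((\<lambda>x. 1 / (q + k * (x - c))) has_integral
      ln (q + k * ((c + l) - c)) / k - ln (q + k * (c - c)) / k) {c..c + l}"
    by (rule fundamental_theorem_of_calculus[where f="\<lambda>x. ln (q + k * (x - c)) / k"])
      (use assms der in \<open>auto simp: has_real_derivative_iff_has_vector_derivative[symmetric]\<close>)
  moreover have "1 / (q + k * \<bar>x - c\<bar>) = 1 / (q + k * (x - c))" if "x \<in> {c..c + l}" for x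
    using that by simp
  ultimately show "((\<lambda>x. 1 / (q + k * \<bar>x - c\<bar>)) has_integral (ln (q + k * l) - ln q) / k) {c..c + l}"
    by (subst has_integral_cong) (auto simp: diff_divide_distrib)
  have der: "((\<lambda>x. - ln (q + k * (c - x)) / k) has_real_derivative 1 / (q + k * (c - x))) (at x within X)"
    if "x \<le> c" for x X
  proof -
    have "q + k * (c - x) > 0" using assms that by (simp add: add_pos_nonneg)
    then have "((\<lambda>x. - ln (q + k * (c - x))) has_real_derivative k * (1 / (q + k * (c - x)))) (at x within X)"
      by (auto intro!: derivative_eq_intros)
    from DERIV_cdivide[OF this, of k] show ?thesis using assms by simp
  qed
  have "((\<lambda>x. 1 / (q + k * (c - x))) has_integral
      (- ln (q + k * (c - c)) / k) - (- ln (q + k * (c - (c - l))) / k)) {c - l..c}"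
    by (rule fundamental_theorem_of_calculus[where f="\<lambda>x. - ln (q + k * (c - x)) / k"])
      (use assms der in \<open>auto simp: has_real_derivative_iff_has_vector_derivative[symmetric]\<close>)
  moreover have "1 / (q + k * \<bar>x - c\<bar>) = 1 / (q + k * (c - x))" if "x \<in> {c - l..c}" for x
    using that by simp
  ultimately show "((\<lambda>x. 1 / (q + k * \<bar>x - c\<bar>)) has_integral (ln (q + k * l) - ln q) / k) {c - l..c}"
    by (subst has_integral_cong) (auto simp: diff_divide_distrib)
qed

lemma pos_def_convex:
  assumes "pos_def A" and "pos_def B" and "0 \<le> u" and "0 \<le> v" and "u + v = 1"
  shows "pos_def (u *\<^sub>R A + v *\<^sub>R B)"
proof -
  have "0 < u * (x \<bullet> (A *v x)) + v * (x \<bullet> (B *v x))" if "x \<noteq> 0" for x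
  proof -
    have A: "0 < x \<bullet> (A *v x)" and B: "0 < x \<bullet> (B *v x)"
      using assms(1,2) that by (auto simp: pos_def_def)
    show ?thesis
    proof (cases "u = 0")
      case False
      then show ?thesis using A B assms(3,4) by (intro add_pos_nonneg) auto
    qed (use assms(5) B in simp)
  qed
  then show ?thesis
    using assms by (simp add: pos_def_def hermitian_add hermitian_scaleR matvec.add_left
        matvec.scaleR_left inner_add_right)
qed

section \<open>Bounds, integrability and adjointness for the moment operators\<close>

locale moment_problem =
  fixes a b :: real and S :: "real set"
    and Gl :: "real \<Rightarrow> complex^'m^'nl" and Gr :: "real \<Rightarrow> complex^'nr^'m"
  assumes ab: "a < b" and S_eq: "S = {a..b}" and C1_Gl: "C1_on S Gl" and C1_Gr: "C1_on S Gr"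
begin

abbreviation "Ls \<equiv> moment_adj Gl Gr"
abbreviation "L \<equiv> moment_map S Gl Gr"
abbreviation "Q \<equiv> rat_density Gl Gr"
abbreviation "RR \<equiv> moment_range S Gl Gr"

lemma compact_S: "compact S" and S_sets [simp]: "S \<in> sets lebesgue" and S_nonempty: "S \<noteq> {}"
  using ab by (simp_all add: S_eq)

lemma integral_const_S: "(LINT \<theta>|lebesgue_on S. c) = (b - a) *\<^sub>R (c :: 'e::euclidean_space)"
  using ab by (simp add: S_eq measure_restrict_space)

lemma cont_integrable:
  fixes f :: "real \<Rightarrow> 'e::euclidean_space"
  shows "continuous_on S f \<Longrightarrow> integrable (lebesgue_on S) f"
  unfolding S_eq by (rule continuous_imp_integrable_real)

lemma norm_LINT_le:
  fixes f :: "real \<Rightarrow> 'e::euclidean_space"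
  assumes "integrable (lebesgue_on S) f" and "\<And>\<theta>. \<theta> \<in> S \<Longrightarrow> norm (f \<theta>) \<le> B"
  shows "norm (LINT \<theta>|lebesgue_on S. f \<theta>) \<le> (b - a) * B"
proof -
  have "norm (LINT \<theta>|lebesgue_on S. f \<theta>) \<le> (LINT \<theta>|lebesgue_on S. B)"
    by (rule Bochner_Integration.integral_norm_bound_integral) (use assms in \<open>auto intro: cont_integrable\<close>)
  then show ?thesis unfolding integral_const_S by simp
qed

lemma cont_measurable:
  "continuous_on S f \<Longrightarrow> f \<in> borel_measurable (lebesgue_on S)"
  by (rule continuous_imp_measurable_on_sets_lebesgue[OF _ S_sets])

lemma cont_Gl: "continuous_on S Gl" and cont_Gr: "continuous_on S Gr"
  using C1_Gl C1_Gr C1_on_imp_continuous_on by blast+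

lemma G_bound: obtains B where "B > 0" "\<And>\<theta>. \<theta> \<in> S \<Longrightarrow> norm (Gl \<theta>) \<le> B" "\<And>\<theta>. \<theta> \<in> S \<Longrightarrow> norm (Gr \<theta>) \<le> B"
proof -
  have "bounded (Gl ` S)" "bounded (Gr ` S)"
    using cont_Gl cont_Gr compact_S by (auto intro: compact_imp_bounded compact_continuous_image)
  then obtain B1 B2 where "\<forall>\<theta>\<in>S. norm (Gl \<theta>) \<le> B1" "\<forall>\<theta>\<in>S. norm (Gr \<theta>) \<le> B2"
    unfolding bounded_iff by (metis imageI)
  then show ?thesis by (intro that[of "\<bar>B1\<bar> + \<bar>B2\<bar> + 1"]) force+
qed

lemma cont_Ls: "continuous_on S (Ls lam)"
  unfolding moment_adj_def[abs_def]
  by (intro bounded_linear.continuous_on[OF bounded_linear_herm_part] matmul.continuous_on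
      bounded_linear.continuous_on[OF bounded_linear_cadj] cont_Gl cont_Gr continuous_on_const)

lemma Ls_bound: obtains C where "C > 0" "\<And>lam \<theta>. \<theta> \<in> S \<Longrightarrow> norm (Ls lam \<theta>) \<le> C * norm lam"
proof -
  obtain B where B: "B > 0" "\<And>\<theta>. \<theta> \<in> S \<Longrightarrow> norm (Gl \<theta>) \<le> B" "\<And>\<theta>. \<theta> \<in> S \<Longrightarrow> norm (Gr \<theta>) \<le> B"
    using G_bound by blast
  show ?thesis
  proof (rule that[of "B * B"])
    show "B * B > 0" using B by simp
    fix lam :: "complex^'nr^'nl" and \<theta> assume \<theta>: "\<theta> \<in> S"
    have "norm (Ls lam \<theta>) \<le> norm (cadj (Gl \<theta>) ** lam ** cadj (Gr \<theta>))"
      unfolding moment_adj_def by (rule norm_herm_part_le)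
    also have "\<dots> \<le> norm (cadj (Gl \<theta>)) * norm lam * norm (cadj (Gr \<theta>))"
      by (rule norm_matrix_mult3_le)
    also have "\<dots> \<le> (B * norm lam) * B"
      using B \<theta> by (intro mult_mono) auto
    finally show "norm (Ls lam \<theta>) \<le> B * B * norm lam" by (simp add: mult_ac)
  qed
qed

lemma Ls_lipschitz:
  obtains K where "K > 0" "\<And>lam \<theta> \<theta>'. \<theta> \<in> S \<Longrightarrow> \<theta>' \<in> S \<Longrightarrow>
    norm (Ls lam \<theta> - Ls lam \<theta>') \<le> K * norm lam * \<bar>\<theta> - \<theta>'\<bar>"
proof -
  obtain B where B: "B > 0" "\<And>\<theta>. \<theta> \<in> S \<Longrightarrow> norm (Gl \<theta>) \<le> B" "\<And>\<theta>. \<theta> \<in> S \<Longrightarrow> norm (Gr \<theta>) \<le> B"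
    using G_bound by blast
  obtain K1 where K1: "K1 \<ge> 0" "\<And>x y. x \<in> S \<Longrightarrow> y \<in> S \<Longrightarrow> norm (Gl x - Gl y) \<le> K1 * \<bar>x - y\<bar>"
    using C1_on_Icc_lipschitz C1_Gl unfolding S_eq by metis
  obtain K2 where K2: "K2 \<ge> 0" "\<And>x y. x \<in> S \<Longrightarrow> y \<in> S \<Longrightarrow> norm (Gr x - Gr y) \<le> K2 * \<bar>x - y\<bar>"
    using C1_on_Icc_lipschitz C1_Gr unfolding S_eq by metis
  show ?thesis
  \<comment> \<open>The summand 1 makes the constant strictly positive; it later enters a
    denominator.\<close>
  proof (rule that[of "(K1 + K2) * B + 1"])
    show "(K1 + K2) * B + 1 > 0" using K1(1) K2(1) B(1) by (simp add: add_nonneg_pos)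
    fix lam :: "complex^'nr^'nl" and x y assume x: "x \<in> S" and y: "y \<in> S"
    define X where "X = cadj (Gl x - Gl y) ** lam ** cadj (Gr x)"
    define Y where "Y = cadj (Gl y) ** lam ** cadj (Gr x - Gr y)"
    have "Ls lam x - Ls lam y = herm_part (X + Y)"
      unfolding moment_adj_def linear_diff[OF linear_herm_part, symmetric] X_def Y_def
      by (simp add: cadj_diff matmul.diff_left matmul.diff_right)
    then have "norm (Ls lam x - Ls lam y) \<le> norm X + norm Y"
      by (metis norm_herm_part_le norm_triangle_ineq order_trans)
    also have "norm X \<le> (norm (Gl x - Gl y) * norm lam) * norm (Gr x)"
      unfolding X_def using norm_matrix_mult3_le[of "cadj (Gl x - Gl y)" lam "cadj (Gr x)"] by simp
    also have "\<dots> \<le> ((K1 * \<bar>x - y\<bar>) * norm lam) * B"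
      using K1 B x y by (intro mult_mono) auto
    also have "norm Y \<le> (norm (Gl y) * norm lam) * norm (Gr x - Gr y)"
      unfolding Y_def using norm_matrix_mult3_le[of "cadj (Gl y)" lam "cadj (Gr x - Gr y)"] by simp
    also have "\<dots> \<le> (B * norm lam) * (K2 * \<bar>x - y\<bar>)"
      using K2 B x y by (intro mult_mono) auto
    also have "((K1 * \<bar>x - y\<bar>) * norm lam) * B + (B * norm lam) * (K2 * \<bar>x - y\<bar>) \<le>
        ((K1 + K2) * B + 1) * norm lam * \<bar>x - y\<bar>"
      by (simp add: algebra_simps)
    finally show "norm (Ls lam x - Ls lam y) \<le> ((K1 + K2) * B + 1) * norm lam * \<bar>x - y\<bar>" by simp
  qed
qed

lemma cont_herm_L2: "continuous_on S \<rho> \<Longrightarrow> (\<And>\<theta>. \<theta> \<in> S \<Longrightarrow> hermitian (\<rho> \<theta>)) \<Longrightarrow> \<rho> \<in> herm_L2 S"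
  unfolding herm_L2_def
  by (auto intro!: cont_measurable cont_integrable continuous_intros)

lemma L2_integrable:
  assumes "\<rho> \<in> borel_measurable (lebesgue_on S)" and "integrable (lebesgue_on S) (\<lambda>\<theta>. (norm (\<rho> \<theta> :: complex^'m^'m))\<^sup>2)"
  shows "integrable (lebesgue_on S) (\<lambda>\<theta>. Gl \<theta> ** \<rho> \<theta> ** Gr \<theta>)"
proof -
  obtain B where B: "B > 0" "\<And>\<theta>. \<theta> \<in> S \<Longrightarrow> norm (Gl \<theta>) \<le> B" "\<And>\<theta>. \<theta> \<in> S \<Longrightarrow> norm (Gr \<theta>) \<le> B"
    using G_bound by blast
  have meas: "(\<lambda>\<theta>. Gl \<theta> ** \<rho> \<theta> ** Gr \<theta>) \<in> borel_measurable (lebesgue_on S)"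
    by (intro borel_measurable_continuous_Pair[where H="(**)"] assms cont_measurable cont_Gl cont_Gr
        matmul.continuous_on continuous_intros)
  show ?thesis
  proof (rule Bochner_Integration.integrable_bound[OF _ meas])
    \<comment> \<open>Square integrability controls the first power through x <= 1 + x^2, as
      \<open>S\<close> has finite measure.\<close>
    show "integrable (lebesgue_on S) (\<lambda>\<theta>. B * B * (1 + (norm (\<rho> \<theta>))\<^sup>2))"
      by (intro integrable_mult_right Bochner_Integration.integrable_add assms cont_integrable continuous_on_const)
    show "AE \<theta> in lebesgue_on S. norm (Gl \<theta> ** \<rho> \<theta> ** Gr \<theta>) \<le> norm (B * B * (1 + (norm (\<rho> \<theta>))\<^sup>2))"
    proof (rule AE_I2)
      fix \<theta> assume "\<theta> \<in> space (lebesgue_on S)"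
      then have \<theta>: "\<theta> \<in> S" by simp
      have "norm (Gl \<theta> ** \<rho> \<theta> ** Gr \<theta>) \<le> (norm (Gl \<theta>) * norm (\<rho> \<theta>)) * norm (Gr \<theta>)"
        by (rule norm_matrix_mult3_le)
      also have "\<dots> \<le> (B * norm (\<rho> \<theta>)) * B"
        using B \<theta> by (intro mult_mono) auto
      also have "\<dots> \<le> B * B * (1 + (norm (\<rho> \<theta>))\<^sup>2)"
      proof -
        have "norm (\<rho> \<theta>) \<le> 1 + (norm (\<rho> \<theta>))\<^sup>2"
          using zero_le_power2[of "norm (\<rho> \<theta>) - 1"] norm_ge_zero[of "\<rho> \<theta>"]
          unfolding power2_diff by (simp, linarith)
        then show ?thesis using B(1) by (simp add: mult_ac)
      qed
      also have "\<dots> \<le> norm (B * B * (1 + (norm (\<rho> \<theta>))\<^sup>2))" by simp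
      finally show "norm (Gl \<theta> ** \<rho> \<theta> ** Gr \<theta>) \<le> norm (B * B * (1 + (norm (\<rho> \<theta>))\<^sup>2))" .
    qed
  qed
qed

lemma herm_L2_integrable: "\<rho> \<in> herm_L2 S \<Longrightarrow> integrable (lebesgue_on S) (\<lambda>\<theta>. Gl \<theta> ** \<rho> \<theta> ** Gr \<theta>)"
  by (rule L2_integrable) (auto simp: herm_L2_def)

text \<open>The adjoint relation, valid for every matrix \<open>lam\<close> and not only for those
  in \<open>RR\<close>; pointwise it is \<open>inner_moment_adj\<close>.\<close>

lemma
  assumes "\<rho> \<in> herm_L2 S"
  shows pairing_integrable: "integrable (lebesgue_on S) (\<lambda>\<theta>. Ls lam \<theta> \<bullet> \<rho> \<theta>)"
    and pairing: "lam \<bullet> L \<rho> = (LINT \<theta>|lebesgue_on S. Ls lam \<theta> \<bullet> \<rho> \<theta>)"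
proof -
  have eq: "Ls lam \<theta> \<bullet> \<rho> \<theta> = lam \<bullet> (Gl \<theta> ** \<rho> \<theta> ** Gr \<theta>)" if "\<theta> \<in> S" for \<theta>
    using assms that by (intro inner_moment_adj) (auto simp: herm_L2_def)
  have bl: "bounded_linear ((\<bullet>) lam)" by (rule bounded_linear_inner_right)
  have "integrable (lebesgue_on S) (\<lambda>\<theta>. lam \<bullet> (Gl \<theta> ** \<rho> \<theta> ** Gr \<theta>))"
    by (rule integrable_bounded_linear[OF bl herm_L2_integrable[OF assms]])
  then show "integrable (lebesgue_on S) (\<lambda>\<theta>. Ls lam \<theta> \<bullet> \<rho> \<theta>)"
    by (rule Bochner_Integration.integrable_cong[THEN iffD1, rotated 2]) (simp_all add: eq)
  have "(LINT \<theta>|lebesgue_on S. Ls lam \<theta> \<bullet> \<rho> \<theta>) = (LINT \<theta>|lebesgue_on S. lam \<bullet> (Gl \<theta> ** \<rho> \<theta> ** Gr \<theta>))"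
    by (rule Bochner_Integration.integral_cong) (simp_all add: eq)
  also have "\<dots> = lam \<bullet> L \<rho>"
    unfolding moment_map_def by (rule integral_bounded_linear[OF bl herm_L2_integrable[OF assms]])
  finally show "lam \<bullet> L \<rho> = (LINT \<theta>|lebesgue_on S. Ls lam \<theta> \<bullet> \<rho> \<theta>)" by simp
qed

lemma herm_L2_scaleR: "\<rho> \<in> herm_L2 S \<Longrightarrow> (\<lambda>\<theta>. r *\<^sub>R \<rho> \<theta>) \<in> herm_L2 S"
  by (auto simp: herm_L2_def hermitian_scaleR power_mult_distrib)

lemma herm_L2_add:
  assumes "\<rho> \<in> herm_L2 S" and "\<sigma> \<in> herm_L2 S"
  shows "(\<lambda>\<theta>. \<rho> \<theta> + \<sigma> \<theta> :: complex^'m^'m) \<in> herm_L2 S"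
proof -
  have meas: "\<rho> \<in> borel_measurable (lebesgue_on S)" "\<sigma> \<in> borel_measurable (lebesgue_on S)"
    using assms by (auto simp: herm_L2_def)
  have "integrable (lebesgue_on S) (\<lambda>\<theta>. (norm (\<rho> \<theta> + \<sigma> \<theta>))\<^sup>2)"
  proof (rule Bochner_Integration.integrable_bound)
    show "integrable (lebesgue_on S) (\<lambda>\<theta>. 2 * ((norm (\<rho> \<theta>))\<^sup>2 + (norm (\<sigma> \<theta>))\<^sup>2))"
      using assms by (auto simp: herm_L2_def)
    show "(\<lambda>\<theta>. (norm (\<rho> \<theta> + \<sigma> \<theta>))\<^sup>2) \<in> borel_measurable (lebesgue_on S)"
      using meas by measurable
    show "AE \<theta> in lebesgue_on S. norm ((norm (\<rho> \<theta> + \<sigma> \<theta>))\<^sup>2) \<le> norm (2 * ((norm (\<rho> \<theta>))\<^sup>2 + (norm (\<sigma> \<theta>))\<^sup>2))"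
    proof (rule AE_I2)
      fix \<theta>
      have "(norm (\<rho> \<theta> + \<sigma> \<theta>))\<^sup>2 \<le> (norm (\<rho> \<theta>) + norm (\<sigma> \<theta>))\<^sup>2"
        by (intro power_mono norm_triangle_ineq) simp
      also have "\<dots> \<le> 2 * ((norm (\<rho> \<theta>))\<^sup>2 + (norm (\<sigma> \<theta>))\<^sup>2)"
        using zero_le_power2[of "norm (\<rho> \<theta>) - norm (\<sigma> \<theta>)"] unfolding power2_diff power2_sum by simp
      finally show "norm ((norm (\<rho> \<theta> + \<sigma> \<theta>))\<^sup>2) \<le> norm (2 * ((norm (\<rho> \<theta>))\<^sup>2 + (norm (\<sigma> \<theta>))\<^sup>2))"
        by simp
    qed
  qed
  then show ?thesis using assms meas by (auto simp: herm_L2_def hermitian_add)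
qed

lemma L_add:
  assumes "\<rho> \<in> herm_L2 S" and "\<sigma> \<in> herm_L2 S"
  shows "L (\<lambda>\<theta>. \<rho> \<theta> + \<sigma> \<theta>) = L \<rho> + L \<sigma>"
  unfolding moment_map_def matmul.add_left matmul.add_right
  by (rule Bochner_Integration.integral_add[OF herm_L2_integrable herm_L2_integrable]) (use assms in auto)

lemma L_scaleR:
  assumes "\<rho> \<in> herm_L2 S"
  shows "L (\<lambda>\<theta>. r *\<^sub>R \<rho> \<theta>) = r *\<^sub>R L \<rho>"
  unfolding moment_map_def matmul.scaleR_left matmul.scaleR_right by simp

lemma subspace_RR: "subspace RR"
  unfolding subspace_def
proof (intro conjI ballI allI)
  have "(\<lambda>\<theta>. 0) \<in> herm_L2 S" by (rule cont_herm_L2) (auto simp: hermitian_def cadj_def vec_eq_iff)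
  moreover have "L (\<lambda>\<theta>. 0) = 0" by (simp add: moment_map_def matmul.zero_left matmul.zero_right)
  ultimately show "0 \<in> RR" unfolding moment_range_def by (metis imageI)
  fix x y assume "x \<in> RR" "y \<in> RR"
  then show "x + y \<in> RR" unfolding moment_range_def using L_add herm_L2_add by (smt (verit) imageE imageI)
next
  fix c x assume "x \<in> RR"
  then show "c *\<^sub>R x \<in> RR" unfolding moment_range_def using L_scaleR herm_L2_scaleR by (smt (verit) imageE imageI)
qed

text \<open>The adjoint is injective on the range: writing \<delta> = L \<rho> turns |\<delta>|^2
  into the pairing of \<open>Ls \<delta>\<close> with \<rho>.\<close>

lemma RR_eq_0:
  assumes "\<delta> \<in> RR" and "AE \<theta> in lebesgue_on S. Ls \<delta> \<theta> = 0"
  shows "\<delta> = 0"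
proof -
  obtain \<rho> where \<rho>: "\<rho> \<in> herm_L2 S" "\<delta> = L \<rho>" using assms(1) by (auto simp: moment_range_def)
  have "\<delta> \<bullet> \<delta> = (LINT \<theta>|lebesgue_on S. Ls \<delta> \<theta> \<bullet> \<rho> \<theta>)" using pairing[OF \<rho>(1)] \<rho>(2) by simp
  also have "\<dots> = 0"
    by (rule integral_eq_zero_AE) (use assms(2) in auto)
  finally show ?thesis by simp
qed

section \<open>The map \<open>h\<close> and its derivative\<close>

text \<open>Neither this set nor \<open>Om\<close> is confined to \<open>RR\<close>, so that
  \<open>Om\<close> is open in the whole space. The sets \<open>Om_ge e\<close> with e > 0 are
  closed and exhaust \<open>Om\<close>; bounded pieces of them are therefore compact.\<close>

definition Om_ge :: "real \<Rightarrow> (complex^'nr^'nl) set" where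
  "Om_ge e = {lam. \<forall>\<theta>\<in>S. herm_ge e (Ls lam \<theta>)}"

definition Om :: "(complex^'nr^'nl) set" where
  "Om = {lam. \<forall>\<theta>\<in>S. pos_def (Ls lam \<theta>)}"

lemma Om_geD: "lam \<in> Om_ge e \<Longrightarrow> \<theta> \<in> S \<Longrightarrow> e * (x \<bullet> x) \<le> x \<bullet> (Ls lam \<theta> *v x)"
  by (simp add: Om_ge_def herm_ge_def)

lemma closed_Om_ge: "closed (Om_ge e)"
proof -
  have "Om_ge e = (\<Inter>\<theta>\<in>S. \<Inter>x. {lam. e * (x \<bullet> x) \<le> x \<bullet> (Ls lam \<theta> *v x)})"
    by (auto simp: Om_ge_def herm_ge_def)
  moreover have "continuous_on UNIV (\<lambda>lam. Ls lam \<theta>)" for \<theta>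
    by (intro linear_continuous_on linear_conv_bounded_linear[THEN iffD1])
      (simp add: linear_iff moment_adj_add moment_adj_scaleR)
  ultimately show ?thesis
    by (auto intro!: closed_INT closed_Collect_le matvec.continuous_on continuous_intros)
qed

lemma Om_ge_subset_Om: "e > 0 \<Longrightarrow> Om_ge e \<subseteq> Om"
  by (auto simp: Om_ge_def Om_def intro: herm_ge_imp_pos_def)

text \<open>The quadratic form attains a positive minimum on the compact product of \<open>S\<close>
  with the unit sphere.\<close>

lemma Om_imp_Om_ge: assumes "lam \<in> Om" obtains e where "e > 0" "lam \<in> Om_ge e"
proof -
  define f where "f p = snd p \<bullet> (Ls lam (fst p) *v snd p)" for p :: "real \<times> (complex^'m)"
  let ?X = "S \<times> sphere (0 :: complex^'m) 1"
  obtain x0 :: "complex^'m" where x0: "x0 \<in> sphere 0 1"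
    using vector_choose_size[of 1] by (metis dist_0_norm mem_sphere zero_le_one)
  have "continuous_on ?X (\<lambda>p. Ls lam (fst p))"
    by (rule continuous_on_compose2[OF cont_Ls continuous_on_fst[OF continuous_on_id]]) auto
  then have "continuous_on ?X f"
    unfolding f_def by (intro continuous_intros matvec.continuous_on)
  moreover have "compact ?X" by (intro compact_Times compact_S compact_sphere)
  moreover have "?X \<noteq> {}" using S_nonempty x0 by auto
  ultimately obtain p where p: "p \<in> ?X" "\<And>p'. p' \<in> ?X \<Longrightarrow> f p \<le> f p'"
    using continuous_attains_inf by metis
  have e: "f p > 0"
  proof -
    have "fst p \<in> S" "snd p \<noteq> 0" using p(1) by auto
    then show ?thesis using assms by (auto simp: f_def Om_def pos_def_def)
  qed
  have "f p * (x \<bullet> x) \<le> x \<bullet> (Ls lam \<theta> *v x)" if \<theta>: "\<theta> \<in> S" for \<theta> x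
  proof (cases "x = 0")
    case False
    have "(1 / norm x) *\<^sub>R x \<in> sphere 0 1" using False by simp
    then have "f p \<le> f (\<theta>, (1 / norm x) *\<^sub>R x)" using p(2) \<theta> by simp
    also have "\<dots> = (x \<bullet> (Ls lam \<theta> *v x)) / (norm x)\<^sup>2"
      by (simp add: f_def matvec.scaleR_right power2_eq_square)
    finally show ?thesis using False by (simp add: field_simps power2_norm_eq_inner)
  qed simp
  then have "lam \<in> Om_ge (f p)" by (simp add: Om_ge_def herm_ge_def)
  with e that show ?thesis by blast
qed

lemma Om_perturb:
  assumes "e > 0" obtains d where "d > 0" "\<And>lam \<mu>. lam \<in> Om_ge e \<Longrightarrow> norm (\<mu> - lam) \<le> d \<Longrightarrow> \<mu> \<in> Om_ge (e / 2)"
proof -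
  obtain C where C: "C > 0" "\<And>lam \<theta>. \<theta> \<in> S \<Longrightarrow> norm (Ls lam \<theta>) \<le> C * norm lam" using Ls_bound by blast
  show ?thesis
  \<comment> \<open>The quadratic form changes by at most C |\<mu> - lam| |x|^2, so this radius
    costs half of \<open>e\<close>; it is the same for all \<open>lam\<close> in
    \<open>Om_ge e\<close>.\<close>
  proof (rule that[of "e / (2 * C)"])
    show "e / (2 * C) > 0" using assms C by simp
    fix lam \<mu> assume lam: "lam \<in> Om_ge e" and d: "norm (\<mu> - lam) \<le> e / (2 * C)"
    have "e / 2 * (x \<bullet> x) \<le> x \<bullet> (Ls \<mu> \<theta> *v x)" if \<theta>: "\<theta> \<in> S" for \<theta> x
    proof -
      have "\<bar>x \<bullet> (Ls (\<mu> - lam) \<theta> *v x)\<bar> \<le> norm x * norm (Ls (\<mu> - lam) \<theta> *v x)"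
        by (rule Cauchy_Schwarz_ineq2)
      also have "\<dots> \<le> norm x * (norm (Ls (\<mu> - lam) \<theta>) * norm x)"
        by (intro mult_left_mono norm_matrix_vector_mult_le) simp
      also have "\<dots> \<le> norm x * ((C * (e / (2 * C))) * norm x)"
        using C(1) d by (intro mult_left_mono mult_right_mono order_trans[OF C(2)[OF \<theta>]]) auto
      also have "\<dots> = e / 2 * (x \<bullet> x)"
        using C(1) by (simp add: power2_norm_eq_inner[symmetric] power2_eq_square)
      finally have "- (e / 2 * (x \<bullet> x)) \<le> x \<bullet> (Ls (\<mu> - lam) \<theta> *v x)" by linarith
      moreover have "x \<bullet> (Ls \<mu> \<theta> *v x) = x \<bullet> (Ls lam \<theta> *v x) + x \<bullet> (Ls (\<mu> - lam) \<theta> *v x)"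
        by (simp add: moment_adj_diff matvec.diff_left inner_diff_right)
      moreover have "e * (x \<bullet> x) \<le> x \<bullet> (Ls lam \<theta> *v x)" using Om_geD[OF lam \<theta>] .
      ultimately show ?thesis by linarith
    qed
    then show "\<mu> \<in> Om_ge (e / 2)" by (simp add: Om_ge_def herm_ge_def)
  qed
qed

lemma open_Om: "open Om"
  unfolding open_dist
proof
  fix lam assume "lam \<in> Om"
  then obtain e where e: "e > 0" "lam \<in> Om_ge e" using Om_imp_Om_ge by blast
  obtain d where "d > 0" "\<And>\<mu>. norm (\<mu> - lam) \<le> d \<Longrightarrow> \<mu> \<in> Om_ge (e / 2)"
    using Om_perturb[OF e(1)] e(2) by metis
  then show "\<exists>d>0. \<forall>\<mu>. dist \<mu> lam < d \<longrightarrow> \<mu> \<in> Om"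
    using Om_ge_subset_Om[of "e / 2"] e(1) by (intro exI[of _ d]) (auto simp: dist_norm)
qed

lemma dual_pos_eq: "dual_pos S Gl Gr = RR \<inter> Om"
  using cont_herm_L2[OF cont_Ls] by (auto simp: dual_pos_def herm_L2_pos_def Om_def)

lemma matrix_inv_Q: "lam \<in> Om \<Longrightarrow> \<theta> \<in> S \<Longrightarrow> matrix_inv (Q lam \<theta>) = Ls lam \<theta>"
  unfolding rat_density_def Om_def by (intro matrix_inv_eqI pos_def_matrix_inv(3)) simp

lemma inner_Ls_Q:
  assumes "lam \<in> Om" and "\<theta> \<in> S" shows "Ls lam \<theta> \<bullet> Q lam \<theta> = real CARD('m)"
proof -
  have pd: "pos_def (Ls lam \<theta>)" using assms by (simp add: Om_def)
  have "cadj (Ls lam \<theta>) = Ls lam \<theta>"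
    by (rule hermitian_moment_adj[unfolded hermitian_def])
  then have "Ls lam \<theta> \<bullet> Q lam \<theta> = Re (trace (Ls lam \<theta> ** matrix_inv (Ls lam \<theta>)))"
    by (simp add: inner_matrix_eq_trace rat_density_def)
  also have "\<dots> = real CARD('m)"
    unfolding pos_def_matrix_inv(2)[OF pd] by (simp add: trace_def mat_def)
  finally show ?thesis .
qed

lemma Q_pos_def: "lam \<in> Om \<Longrightarrow> \<theta> \<in> S \<Longrightarrow> pos_def (Q lam \<theta>)"
  unfolding rat_density_def Om_def by (blast intro: pos_def_matrix_inv)

lemma Q_bound:
  assumes "e > 0" and "lam \<in> Om_ge e" and "\<theta> \<in> S"
  shows "norm (Q lam \<theta>) \<le> real CARD('m) / e"
  using assms unfolding rat_density_def Om_ge_def by (intro norm_matrix_inv_le) auto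

lemma Q_diff:
  assumes "lam \<in> Om" and "\<mu> \<in> Om" and "\<theta> \<in> S"
  shows "Q \<mu> \<theta> - Q lam \<theta> = - (Q \<mu> \<theta> ** Ls (\<mu> - lam) \<theta> ** Q lam \<theta>)"
    and "Q \<mu> \<theta> - Q lam \<theta> + Q lam \<theta> ** Ls (\<mu> - lam) \<theta> ** Q lam \<theta> =
      Q lam \<theta> ** Ls (\<mu> - lam) \<theta> ** Q \<mu> \<theta> ** Ls (\<mu> - lam) \<theta> ** Q lam \<theta>"
  using assms unfolding rat_density_def moment_adj_diff Om_def by (auto intro!: matrix_inv_diff)

lemma cont_Q:
  assumes "lam \<in> Om" shows "continuous_on S (Q lam)"
  unfolding continuous_on_def
proof
  fix x assume x: "x \<in> S"
  obtain e where e: "e > 0" "lam \<in> Om_ge e" using Om_imp_Om_ge[OF assms] by blast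
  define B where "B = real CARD('m) / e"
  have B: "norm (Q lam y) \<le> B" if "y \<in> S" for y using Q_bound[OF e that] by (simp add: B_def)
  have lim: "((\<lambda>y. B * norm (Ls lam y - Ls lam x) * B) \<longlongrightarrow> 0) (at x within S)"
    using cont_Ls[of lam] x unfolding continuous_on_def
    by (intro tendsto_mult_left_zero tendsto_mult_right_zero tendsto_norm_zero LIM_zero) auto
  have "norm (Q lam y - Q lam x) \<le> B * norm (Ls lam y - Ls lam x) * B" if y: "y \<in> S" for y
  proof -
    have pd: "pos_def (Ls lam y)" "pos_def (Ls lam x)" using assms x y by (auto simp: Om_def)
    have "norm (Q lam y - Q lam x) = norm (Q lam y ** (Ls lam y - Ls lam x) ** Q lam x)"
      using matrix_inv_diff(1)[OF pd] by (simp add: rat_density_def)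
    also have "\<dots> \<le> norm (Q lam y) * norm (Ls lam y - Ls lam x) * norm (Q lam x)"
      by (rule norm_matrix_mult3_le)
    also have "\<dots> \<le> B * norm (Ls lam y - Ls lam x) * B"
      using B[OF x] B[OF y] order_trans[OF norm_ge_zero B[OF x]] by (intro mult_mono) auto
    finally show ?thesis .
  qed
  then have "((\<lambda>y. Q lam y - Q lam x) \<longlongrightarrow> 0) (at x within S)"
    by (intro Lim_null_comparison[OF _ lim]) (auto simp: eventually_at_filter)
  then show "(Q lam \<longlongrightarrow> Q lam x) (at x within S)" by (rule LIM_zero_cancel)
qed

lemma Q_herm_L2_pos: "lam \<in> Om \<Longrightarrow> Q lam \<in> herm_L2_pos S"
  using cont_herm_L2[OF cont_Q] Q_pos_def pos_def_imp_hermitian by (auto simp: herm_L2_pos_def)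

lemma Q_herm_L2: "lam \<in> Om \<Longrightarrow> Q lam \<in> herm_L2 S"
  using Q_herm_L2_pos by (simp add: herm_L2_pos_def)

lemma sandwich_herm_L2: "lam \<in> Om \<Longrightarrow> (\<lambda>\<theta>. Q lam \<theta> ** Ls \<delta> \<theta> ** Q lam \<theta>) \<in> herm_L2 S"
  by (intro cont_herm_L2 matmul.continuous_on cont_Q cont_Ls hermitian_sandwich pos_def_imp_hermitian
      Q_pos_def hermitian_moment_adj)

abbreviation "h \<equiv> hmap S Gl Gr"
abbreviation "h' \<equiv> grad_h S Gl Gr"

lemma hmap_RR: "lam \<in> Om \<Longrightarrow> h lam \<in> RR"
  unfolding hmap_def moment_range_def using Q_herm_L2 by blast

lemma grad_RR: "lam \<in> Om \<Longrightarrow> h' lam \<delta> \<in> RR"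
  unfolding grad_h_def using sandwich_herm_L2 subspace_RR
  by (metis (no_types, lifting) image_eqI moment_range_def subspace_neg)

lemma linear_grad: assumes "lam \<in> Om" shows "linear (h' lam)"
proof (rule linearI)
  fix x y r
  show "h' lam (x + y) = h' lam x + h' lam y"
    unfolding grad_h_def moment_adj_add matmul.add_left matmul.add_right
      L_add[OF sandwich_herm_L2[OF assms] sandwich_herm_L2[OF assms]] by simp
  show "h' lam (r *\<^sub>R x) = r *\<^sub>R h' lam x"
    unfolding grad_h_def moment_adj_scaleR matmul.scaleR_left matmul.scaleR_right
      L_scaleR[OF sandwich_herm_L2[OF assms]] by simp
qed

text \<open>The second resolvent identity under the integral: an exact remainder with two factors
  \<open>Ls (\<mu> - lam)\<close>.\<close>

lemma hmap_diff:
  assumes "lam \<in> Om" and "\<mu> \<in> Om"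
  shows "h \<mu> - h lam - h' lam (\<mu> - lam) = (LINT \<theta>|lebesgue_on S. Gl \<theta> **
    (Q lam \<theta> ** Ls (\<mu> - lam) \<theta> ** Q \<mu> \<theta> ** Ls (\<mu> - lam) \<theta> ** Q lam \<theta>) ** Gr \<theta>)"
proof -
  let ?s = "\<lambda>\<theta>. Q lam \<theta> ** Ls (\<mu> - lam) \<theta> ** Q lam \<theta>"
  note int = herm_L2_integrable[OF Q_herm_L2[OF assms(1)]] herm_L2_integrable[OF Q_herm_L2[OF assms(2)]]
    herm_L2_integrable[OF sandwich_herm_L2[OF assms(1)]]
  have "h \<mu> - h lam - h' lam (\<mu> - lam) = (LINT \<theta>|lebesgue_on S. (Gl \<theta> ** Q \<mu> \<theta> ** Gr \<theta> -
      Gl \<theta> ** Q lam \<theta> ** Gr \<theta>) + Gl \<theta> ** ?s \<theta> ** Gr \<theta>)"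
    unfolding hmap_def grad_h_def moment_map_def
    by (subst Bochner_Integration.integral_add) (use int in \<open>auto intro!: Bochner_Integration.integrable_diff\<close>)
  also have "\<dots> = (LINT \<theta>|lebesgue_on S. Gl \<theta> ** (Q lam \<theta> ** Ls (\<mu> - lam) \<theta> ** Q \<mu> \<theta> ** Ls (\<mu> - lam) \<theta> ** Q lam \<theta>) ** Gr \<theta>)"
  proof (rule Bochner_Integration.integral_cong[OF refl])
    fix \<theta> assume "\<theta> \<in> space (lebesgue_on S)"
    then have "\<theta> \<in> S" by simp
    from Q_diff(2)[OF assms this, symmetric]
    show "(Gl \<theta> ** Q \<mu> \<theta> ** Gr \<theta> - Gl \<theta> ** Q lam \<theta> ** Gr \<theta>) + Gl \<theta> ** ?s \<theta> ** Gr \<theta> =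
      Gl \<theta> ** (Q lam \<theta> ** Ls (\<mu> - lam) \<theta> ** Q \<mu> \<theta> ** Ls (\<mu> - lam) \<theta> ** Q lam \<theta>) ** Gr \<theta>"
      by (simp add: matmul.add_left matmul.add_right matmul.diff_left matmul.diff_right)
  qed
  finally show ?thesis .
qed

lemma has_derivative_hmap:
  assumes lam: "lam \<in> Om" shows "(h has_derivative h' lam) (at lam)"
proof -
  obtain e where e: "e > 0" "lam \<in> Om_ge e" using Om_imp_Om_ge[OF lam] by blast
  obtain d where d: "d > 0" "\<And>\<mu>. norm (\<mu> - lam) \<le> d \<Longrightarrow> \<mu> \<in> Om_ge (e / 2)"
    using Om_perturb[OF e(1)] e(2) by metis
  obtain C where C: "C > 0" "\<And>lam \<theta>. \<theta> \<in> S \<Longrightarrow> norm (Ls lam \<theta>) \<le> C * norm lam" using Ls_bound by blast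
  obtain B where B: "B > 0" "\<And>\<theta>. \<theta> \<in> S \<Longrightarrow> norm (Gl \<theta>) \<le> B" "\<And>\<theta>. \<theta> \<in> S \<Longrightarrow> norm (Gr \<theta>) \<le> B"
    using G_bound by blast
  define q where "q = real CARD('m) / (e / 2)"
  have q0: "q \<ge> 0" using e by (simp add: q_def)
  have e_half: "lam \<in> Om_ge (e / 2)" using e by (auto simp: Om_ge_def intro: herm_ge_mono)
  \<comment> \<open>One factor for each ingredient of the remainder: the length of the interval, two
    values of \<open>Gl\<close> and \<open>Gr\<close>, three inverses bounded by \<open>q\<close>,
    and two adjoints bounded by \<open>C\<close>.\<close>
  define K where "K = (b - a) * (B * (q * C * q * C * q) * B)"
  have quad: "norm (h \<mu> - h lam - h' lam (\<mu> - lam)) \<le>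
      K * (norm (\<mu> - lam) * norm (\<mu> - lam))"
    if close: "norm (\<mu> - lam) \<le> d" for \<mu>
  proof -
    have \<mu>: "\<mu> \<in> Om_ge (e / 2)" "\<mu> \<in> Om"
      using d(2)[OF close] Om_ge_subset_Om[of "e / 2"] e(1) by auto
    let ?n = "norm (\<mu> - lam)"
    have "norm (h \<mu> - h lam - h' lam (\<mu> - lam)) \<le>
        (b - a) * (B * (q * (C * ?n) * q * (C * ?n) * q) * B)"
      unfolding hmap_diff[OF lam \<mu>(2)]
    proof (rule norm_LINT_le)
      show "integrable (lebesgue_on S) (\<lambda>\<theta>. Gl \<theta> **
          (Q lam \<theta> ** Ls (\<mu> - lam) \<theta> ** Q \<mu> \<theta> ** Ls (\<mu> - lam) \<theta> ** Q lam \<theta>) ** Gr \<theta>)"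
        by (intro cont_integrable matmul.continuous_on cont_Gl cont_Gr cont_Q cont_Ls lam \<mu>)
      fix \<theta> assume \<theta>: "\<theta> \<in> S"
      have bQ: "norm (Q lam \<theta>) \<le> q" "norm (Q \<mu> \<theta>) \<le> q"
        using Q_bound[OF _ e_half \<theta>] Q_bound[OF _ \<mu>(1) \<theta>] e(1) by (auto simp: q_def)
      have bL: "norm (Ls (\<mu> - lam) \<theta>) \<le> C * ?n" using C(2)[OF \<theta>] .
      have "norm (Q lam \<theta> ** Ls (\<mu> - lam) \<theta> ** Q \<mu> \<theta> ** Ls (\<mu> - lam) \<theta> ** Q lam \<theta>) \<le>
          norm (Q lam \<theta> ** Ls (\<mu> - lam) \<theta> ** Q \<mu> \<theta>) * norm (Ls (\<mu> - lam) \<theta>) * norm (Q lam \<theta>)"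
        by (rule norm_matrix_mult3_le)
      also have "\<dots> \<le> (norm (Q lam \<theta>) * norm (Ls (\<mu> - lam) \<theta>) * norm (Q \<mu> \<theta>)) * norm (Ls (\<mu> - lam) \<theta>) * norm (Q lam \<theta>)"
        by (intro mult_right_mono norm_matrix_mult3_le) auto
      also have "\<dots> \<le> q * (C * ?n) * q * (C * ?n) * q"
        using C(1) q0 by (intro mult_mono bQ bL) auto
      finally have inner: "norm (Q lam \<theta> ** Ls (\<mu> - lam) \<theta> ** Q \<mu> \<theta> ** Ls (\<mu> - lam) \<theta> ** Q lam \<theta>) \<le>
          q * (C * ?n) * q * (C * ?n) * q" .
      show "norm (Gl \<theta> ** (Q lam \<theta> ** Ls (\<mu> - lam) \<theta> ** Q \<mu> \<theta> ** Ls (\<mu> - lam) \<theta> ** Q lam \<theta>) ** Gr \<theta>)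
          \<le> B * (q * (C * ?n) * q * (C * ?n) * q) * B"
        by (rule order_trans[OF norm_matrix_mult3_le])
          (use B \<theta> C(1) q0 in \<open>intro mult_mono inner; auto\<close>)
    qed
    then show ?thesis by (simp add: K_def mult_ac)
  qed
  have K0: "K \<ge> 0" using ab B C q0 by (simp add: K_def)
  show ?thesis
    unfolding has_derivative_iff_norm
  proof
    show "bounded_linear (h' lam)" using linear_grad[OF lam] by (simp add: linear_conv_bounded_linear)
    have lim: "((\<lambda>\<mu>. K * norm (\<mu> - lam)) \<longlongrightarrow> 0) (at lam)"
      by (intro tendsto_mult_right_zero tendsto_norm_zero LIM_zero tendsto_ident_at)
    have ev: "\<forall>\<^sub>F \<mu> in at lam. norm (norm (h \<mu> - h lam - h' lam (\<mu> - lam)) / norm (\<mu> - lam)) \<le> K * norm (\<mu> - lam)"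
      unfolding eventually_at
    proof (intro exI[of _ d] conjI ballI impI d(1))
      fix \<mu> assume "\<mu> \<noteq> lam \<and> dist \<mu> lam < d"
      then have "\<mu> \<noteq> lam" "norm (\<mu> - lam) \<le> d" by (auto simp: dist_norm)
      with quad[of \<mu>] show "norm (norm (h \<mu> - h lam - h' lam (\<mu> - lam)) / norm (\<mu> - lam)) \<le> K * norm (\<mu> - lam)"
        by (simp add: divide_le_eq mult.assoc)
    qed
    show "((\<lambda>\<mu>. norm (h \<mu> - h lam - h' lam (\<mu> - lam)) / norm (\<mu> - lam)) \<longlongrightarrow> 0) (at lam)"
      by (rule Lim_null_comparison[OF ev lim])
  qed
qed

text \<open>The integrand is nonnegative by \<open>inner_sandwich_pos\<close>. If its integral
  vanishes, \<open>Ls \<delta>\<close> is zero almost everywhere, and \<open>RR_eq_0\<close>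
  applies. Distinct points serve injectivity, equal points the derivative.\<close>

lemma LINT_sandwich_nonneg:
  assumes "lam \<in> Om" and "\<mu> \<in> Om"
  shows "0 \<le> (LINT \<theta>|lebesgue_on S. (Q \<mu> \<theta> ** Ls \<delta> \<theta> ** Q lam \<theta>) \<bullet> Ls \<delta> \<theta>)"
    and "\<delta> \<in> RR \<Longrightarrow> (LINT \<theta>|lebesgue_on S. (Q \<mu> \<theta> ** Ls \<delta> \<theta> ** Q lam \<theta>) \<bullet> Ls \<delta> \<theta>) \<le> 0 \<Longrightarrow> \<delta> = 0"
proof -
  let ?I = "LINT \<theta>|lebesgue_on S. (Q \<mu> \<theta> ** Ls \<delta> \<theta> ** Q lam \<theta>) \<bullet> Ls \<delta> \<theta>"
  have nn: "0 \<le> (Q \<mu> \<theta> ** Ls \<delta> \<theta> ** Q lam \<theta>) \<bullet> Ls \<delta> \<theta>" if "\<theta> \<in> S" for \<theta>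
    using inner_sandwich_pos[OF Q_pos_def[OF assms(2) that] Q_pos_def[OF assms(1) that], of "Ls \<delta> \<theta>"]
    by (cases "Ls \<delta> \<theta> = 0") auto
  then show ge: "0 \<le> ?I" by (intro Bochner_Integration.integral_nonneg) simp
  assume "\<delta> \<in> RR" and "?I \<le> 0"
  then have "?I = 0" using ge by simp
  moreover have "integrable (lebesgue_on S) (\<lambda>\<theta>. (Q \<mu> \<theta> ** Ls \<delta> \<theta> ** Q lam \<theta>) \<bullet> Ls \<delta> \<theta>)"
    by (intro cont_integrable continuous_on_inner matmul.continuous_on cont_Q cont_Ls assms)
  ultimately have "AE \<theta> in lebesgue_on S. (Q \<mu> \<theta> ** Ls \<delta> \<theta> ** Q lam \<theta>) \<bullet> Ls \<delta> \<theta> = 0"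
    by (subst (asm) integral_nonneg_eq_0_iff_AE) (auto intro!: AE_I2 nn)
  moreover have "Ls \<delta> \<theta> = 0" if "\<theta> \<in> S" "(Q \<mu> \<theta> ** Ls \<delta> \<theta> ** Q lam \<theta>) \<bullet> Ls \<delta> \<theta> = 0" for \<theta>
    using inner_sandwich_pos[OF Q_pos_def[OF assms(2) that(1)] Q_pos_def[OF assms(1) that(1)], of "Ls \<delta> \<theta>"]
      that(2) by auto
  ultimately have "AE \<theta> in lebesgue_on S. Ls \<delta> \<theta> = 0"
    using AE_space[of "lebesgue_on S"] by (auto elim: eventually_elim2)
  then show "\<delta> = 0" using RR_eq_0 \<open>\<delta> \<in> RR\<close> by blast
qed

lemma grad_inner:
  assumes "lam \<in> Om"
  shows "\<delta> \<bullet> h' lam \<delta> = - (LINT \<theta>|lebesgue_on S. (Q lam \<theta> ** Ls \<delta> \<theta> ** Q lam \<theta>) \<bullet> Ls \<delta> \<theta>)"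
  unfolding grad_h_def inner_minus_right pairing[OF sandwich_herm_L2[OF assms]] by (simp add: inner_commute)

text \<open>The first resolvent identity gives the finite difference exactly, with one inverse at
  each endpoint, so no integration along the segment is involved.\<close>

lemma hmap_monotone:
  assumes "lam \<in> Om" and "\<mu> \<in> Om"
  shows "(\<mu> - lam) \<bullet> (h \<mu> - h lam) =
    - (LINT \<theta>|lebesgue_on S. (Q \<mu> \<theta> ** Ls (\<mu> - lam) \<theta> ** Q lam \<theta>) \<bullet> Ls (\<mu> - lam) \<theta>)"
proof -
  have "(\<mu> - lam) \<bullet> (h \<mu> - h lam) =
      (LINT \<theta>|lebesgue_on S. Ls (\<mu> - lam) \<theta> \<bullet> Q \<mu> \<theta> - Ls (\<mu> - lam) \<theta> \<bullet> Q lam \<theta>)"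
    unfolding hmap_def inner_diff_right pairing[OF Q_herm_L2[OF assms(1)]] pairing[OF Q_herm_L2[OF assms(2)]]
    by (rule Bochner_Integration.integral_diff[symmetric]) (intro pairing_integrable Q_herm_L2 assms)+
  also have "\<dots> = (LINT \<theta>|lebesgue_on S. - ((Q \<mu> \<theta> ** Ls (\<mu> - lam) \<theta> ** Q lam \<theta>) \<bullet> Ls (\<mu> - lam) \<theta>))"
  proof (rule Bochner_Integration.integral_cong[OF refl])
    fix \<theta> assume "\<theta> \<in> space (lebesgue_on S)"
    then have "\<theta> \<in> S" by simp
    then show "Ls (\<mu> - lam) \<theta> \<bullet> Q \<mu> \<theta> - Ls (\<mu> - lam) \<theta> \<bullet> Q lam \<theta> =
        - ((Q \<mu> \<theta> ** Ls (\<mu> - lam) \<theta> ** Q lam \<theta>) \<bullet> Ls (\<mu> - lam) \<theta>)"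
      unfolding inner_diff_right[symmetric] Q_diff(1)[OF assms \<open>\<theta> \<in> S\<close>]
      by (simp add: inner_commute)
  qed
  finally show ?thesis by simp
qed

section \<open>The inverse of \<open>h\<close>\<close>

definition "perp_basis = (SOME B. finite B \<and> (\<forall>x. x \<in> RR \<longleftrightarrow> (\<forall>b\<in>B. x \<bullet> b = 0)))"

lemma finite_perp_basis: "finite perp_basis" and RR_iff: "x \<in> RR \<longleftrightarrow> (\<forall>b\<in>perp_basis. x \<bullet> b = 0)"
proof -
  have "\<exists>B. finite B \<and> (\<forall>x. x \<in> RR \<longleftrightarrow> (\<forall>b\<in>B. x \<bullet> b = 0))"
    using subspace_perp_family[OF subspace_RR] by metis
  from someI_ex[OF this] show "finite perp_basis" "x \<in> RR \<longleftrightarrow> (\<forall>b\<in>perp_basis. x \<bullet> b = 0)"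
    unfolding perp_basis_def[symmetric] by blast+
qed

text \<open>Not the orthogonal projection in general, as \<open>perp_basis\<close> need not be
  orthonormal, but a positive semidefinite operator with kernel \<open>RR\<close> and values
  orthogonal to \<open>RR\<close>.\<close>

definition "perp lam = (\<Sum>b\<in>perp_basis. (lam \<bullet> b) *\<^sub>R b)"

lemma linear_perp: "linear perp"
  unfolding perp_def by (rule linearI)
    (simp_all add: inner_add_left scaleR_add_left sum.distrib scaleR_sum_right)

lemma inner_perp: "x \<bullet> perp x = (\<Sum>b\<in>perp_basis. (x \<bullet> b)\<^sup>2)"
  by (simp add: perp_def inner_sum_right power2_eq_square)

lemma inner_perp_nonneg: "0 \<le> x \<bullet> perp x"
  unfolding inner_perp by (simp add: sum_nonneg)

lemma inner_perp_le_0: "x \<bullet> perp x \<le> 0 \<Longrightarrow> x \<in> RR"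
  using inner_perp_nonneg[of x] unfolding inner_perp
  by (simp add: antisym_conv RR_iff sum_nonneg_eq_0_iff finite_perp_basis)

lemma perp_RR: "x \<in> RR \<Longrightarrow> perp x = 0"
  unfolding perp_def RR_iff by (simp add: sum.neutral)

text \<open>\<open>perp x\<close> is orthogonal to \<open>RR\<close>; lying in \<open>RR\<close> as
  well, it is zero, and then so is its quadratic form.\<close>

lemma perp_in_RR: "perp x \<in> RR \<Longrightarrow> x \<in> RR"
proof (rule inner_perp_le_0)
  assume "perp x \<in> RR"
  then have "perp x \<bullet> perp x = 0"
    by (subst (2) perp_def) (simp add: inner_sum_right RR_iff)
  then show "x \<bullet> perp x \<le> 0" by simp
qed

text \<open>The moment map \<open>h\<close> only sees the component of its argument in the range \<open>RR\<close>.
  Subtracting a positive semidefinite form with kernel \<open>RR\<close> makes it a strictly monotone map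
  of the whole space, to which invariance of domain and the inverse function theorem apply.\<close>

definition "H lam = h lam - perp lam"
definition "H' lam \<delta> = h' lam \<delta> - perp \<delta>"

lemma has_derivative_H: "lam \<in> Om \<Longrightarrow> (H has_derivative H' lam) (at lam)"
  unfolding H_def[abs_def] H'_def[abs_def]
  by (intro has_derivative_diff has_derivative_hmap linear_imp_has_derivative linear_perp)

text \<open>Equal values make a nonnegative form equal to a nonpositive one, so both vanish: the
  \<open>perp\<close> part puts the difference into \<open>RR\<close>, and there the integral part
  forces it to be zero.\<close>

lemma inj_on_H: "inj_on H Om"
proof (rule inj_onI)
  fix lam \<mu> assume Om: "lam \<in> Om" "\<mu> \<in> Om" and eq: "H lam = H \<mu>"
  let ?I = "LINT \<theta>|lebesgue_on S. (Q \<mu> \<theta> ** Ls (\<mu> - lam) \<theta> ** Q lam \<theta>) \<bullet> Ls (\<mu> - lam) \<theta>"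
  have "h \<mu> - h lam = perp (\<mu> - lam)"
    using eq by (simp add: H_def linear_diff[OF linear_perp] algebra_simps)
  then have "(\<mu> - lam) \<bullet> perp (\<mu> - lam) = - ?I"
    using hmap_monotone[OF Om] by simp
  then have "(\<mu> - lam) \<bullet> perp (\<mu> - lam) \<le> 0" "?I \<le> 0"
    using LINT_sandwich_nonneg(1)[OF Om, of "\<mu> - lam"] inner_perp_nonneg[of "\<mu> - lam"] by linarith+
  then have "\<mu> - lam = 0"
    using LINT_sandwich_nonneg(2)[OF Om] inner_perp_le_0 by blast
  then show "lam = \<mu>" by simp
qed

lemma H'_eq_0:
  assumes "lam \<in> Om" and "H' lam \<delta> = 0" shows "\<delta> = 0"
proof -
  let ?I = "LINT \<theta>|lebesgue_on S. (Q lam \<theta> ** Ls \<delta> \<theta> ** Q lam \<theta>) \<bullet> Ls \<delta> \<theta>"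
  have "h' lam \<delta> = perp \<delta>" using assms(2) by (simp add: H'_def)
  then have "\<delta> \<bullet> perp \<delta> = - ?I"
    using grad_inner[OF assms(1), of \<delta>] by simp
  then have "\<delta> \<bullet> perp \<delta> \<le> 0" "?I \<le> 0"
    using LINT_sandwich_nonneg(1)[OF assms(1,1), of \<delta>] inner_perp_nonneg[of \<delta>] by linarith+
  then show "\<delta> = 0" using LINT_sandwich_nonneg(2)[OF assms(1,1)] inner_perp_le_0 by blast
qed

lemma linear_H': "lam \<in> Om \<Longrightarrow> linear (H' lam)"
  unfolding H'_def[abs_def] by (intro linear_compose_sub linear_grad linear_perp)

lemma bij_H': assumes "lam \<in> Om" shows "bij (H' lam)"
proof -
  have "inj (H' lam)"
    using linear_injective_0[OF linear_H'[OF assms]] H'_eq_0[OF assms] by blast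
  then show ?thesis
    using linear_injective_imp_surjective[OF linear_H'[OF assms]] by (simp add: bij_def)
qed

text \<open>\<open>h'\<close> takes values in \<open>RR\<close>, so a right-hand side in
  \<open>RR\<close> forces \<open>perp \<delta>\<close> into \<open>RR\<close>. Hence solving with
  \<open>H'\<close> on the whole space solves the equation for \<open>h'\<close> inside
  \<open>RR\<close>.\<close>

lemma H'_RR:
  assumes "lam \<in> Om" and "H' lam \<delta> \<in> RR"
  shows "\<delta> \<in> RR" and "h' lam \<delta> = H' lam \<delta>"
proof -
  have "h' lam \<delta> - H' lam \<delta> \<in> RR"
    using grad_RR[OF assms(1)] assms(2) by (intro subspace_diff subspace_RR)
  then show "\<delta> \<in> RR" using perp_in_RR by (simp add: H'_def)
  then show "h' lam \<delta> = H' lam \<delta>" by (simp add: H'_def perp_RR)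
qed

lemma H_RR:
  assumes "lam \<in> Om" and "H lam \<in> RR"
  shows "lam \<in> RR" and "h lam = H lam"
proof -
  have "h lam - H lam \<in> RR"
    using hmap_RR[OF assms(1)] assms(2) by (intro subspace_diff subspace_RR)
  then show "lam \<in> RR" using perp_in_RR by (simp add: H_def)
  then show "h lam = H lam" by (simp add: H_def perp_RR)
qed

lemma H_eq_h: "lam \<in> RR \<Longrightarrow> H lam = h lam"
  by (simp add: H_def perp_RR)

lemma bij_betw_grad: assumes "lam \<in> Om" shows "bij_betw (h' lam) RR RR"
  unfolding bij_betw_def
proof
  have eq: "h' lam \<delta> = H' lam \<delta>" if "\<delta> \<in> RR" for \<delta> using that by (simp add: H'_def perp_RR)
  show "inj_on (h' lam) RR"
    using bij_H'[OF assms] eq by (auto simp: inj_on_def bij_def)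
  show "h' lam ` RR = RR"
  proof (intro antisym subsetI)
    fix y assume "y \<in> RR"
    moreover obtain \<delta> where "y = H' lam \<delta>" using bij_H'[OF assms] by (metis bij_pointE)
    ultimately show "y \<in> h' lam ` RR" using H'_RR[OF assms] by (metis imageI)
  qed (use grad_RR[OF assms] in blast)
qed

text \<open>Links the relative inverse in the differential equation with the derivative of the
  global inverse \<open>G\<close>.\<close>

lemma inv_into_grad:
  assumes "lam \<in> Om" and "y \<in> RR"
  shows "inv_into RR (h' lam) y = inv (H' lam) y"
proof -
  have y: "H' lam (inv (H' lam) y) = y"
    using bij_H'[OF assms(1)] by (simp add: bij_def surj_f_inv_f)
  then show ?thesis
    using H'_RR[OF assms(1), of "inv (H' lam) y"] assms(2) bij_betw_grad[OF assms(1)]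
    by (metis bij_betw_def inv_into_f_eq)
qed

abbreviation "D \<equiv> dual_pos S Gl Gr"

lemma D_ode_dom: "D \<subseteq> ode_dom S Gl Gr"
  unfolding dual_pos_eq ode_dom_def using bij_betw_grad by (auto simp: Om_def pos_def_matrix_inv(4))

lemma cont_H: "continuous_on Om H"
  using has_derivative_H has_derivative_continuous by (metis continuous_at_imp_continuous_on)

lemma cont_h: "continuous_on Om h"
  using has_derivative_hmap has_derivative_continuous by (metis continuous_at_imp_continuous_on)

lemma open_H_Om: "open (H ` Om)"
  by (rule invariance_of_domain[OF cont_H open_Om inj_on_H])

definition "G = inv_into Om H"

lemma G_H: "lam \<in> Om \<Longrightarrow> G (H lam) = lam"
  unfolding G_def using inj_on_H by simp

lemma has_derivative_G:
  assumes "lam \<in> Om" shows "(G has_derivative inv (H' lam)) (at (H lam))"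
proof (rule has_derivative_inverse_strong[OF open_Om assms cont_H G_H has_derivative_H[OF assms]])
  show "H' lam \<circ> inv (H' lam) = id"
    using bij_H'[OF assms] by (simp add: bij_def surj_iff)
qed

text \<open>Shows that the image of \<open>D\<close> is relatively open in \<open>RR\<close>,
  because the image of \<open>Om\<close> under \<open>H\<close> is open.\<close>

lemma h_D_eq: "h ` D = H ` Om \<inter> RR"
proof (intro antisym subsetI)
  fix y assume "y \<in> h ` D"
  then obtain lam where "lam \<in> RR" "lam \<in> Om" "y = h lam" by (auto simp: dual_pos_eq)
  then show "y \<in> H ` Om \<inter> RR" using hmap_RR H_eq_h by (metis IntI imageI)
next
  fix y assume "y \<in> H ` Om \<inter> RR"
  then obtain lam where "lam \<in> Om" "y = H lam" "H lam \<in> RR" by blast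
  then show "y \<in> h ` D" unfolding dual_pos_eq using H_RR by (metis IntI imageI)
qed

lemma G_h: "lam \<in> D \<Longrightarrow> G (h lam) = lam"
  using G_H H_eq_h by (metis IntD1 IntD2 dual_pos_eq)

lemma h_D_subset: "h ` D \<subseteq> moment_int S Gl Gr"
  unfolding hmap_def moment_int_def dual_pos_eq using Q_herm_L2_pos by blast

section \<open>A priori bounds\<close>

lemma cont_Re_trace_Q:
  assumes "lam \<in> Om" shows "continuous_on S (\<lambda>\<theta>. Re (trace (Q lam \<theta>)))"
  unfolding Re_trace_eq_inner by (intro continuous_intros cont_Q assms)

text \<open>Since \<open>S\<close> is one-dimensional, the reciprocal of the distance to a point of \<open>S\<close> is not
  integrable.  So a bound on the integral of \<open>trace (L\<^sup>*(\<lambda>)\<^sup>-\<^sup>1)\<close> keeps \<open>L\<^sup>*(\<lambda>)\<close> away from singular matrices.\<close>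

lemma Om_ge_uniform:
  obtains e where "e > 0" "\<And>lam. lam \<in> Om \<Longrightarrow> norm lam \<le> M \<Longrightarrow>
    (LINT \<theta>|lebesgue_on S. Re (trace (Q lam \<theta>))) \<le> C \<Longrightarrow> lam \<in> Om_ge e"
proof -
  obtain K where K: "K > 0" "\<And>lam x y. x \<in> S \<Longrightarrow> y \<in> S \<Longrightarrow> norm (Ls lam x - Ls lam y) \<le> K * norm lam * \<bar>x - y\<bar>"
    using Ls_lipschitz by metis
  define k where "k = K * (\<bar>M\<bar> + 1)"
  have k: "k > 0" using K(1) by (simp add: k_def)
  \<comment> \<open>Half the length of the interval: from any point of \<open>S\<close> there is
    room for a subinterval of this length to the left or to the right.\<close>
  define l where "l = (b - a) / 2"
  have l: "l > 0" using ab by (simp add: l_def)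
  show ?thesis
  \<comment> \<open>Solving ln (q + k l) - ln q <= k C for the value q of the form gives q (exp (k
    C) - 1) >= k l, and this slightly weaker bound.\<close>
  proof (rule that[of "k * l / exp (k * C)"])
    show "k * l / exp (k * C) > 0" using k l by simp
    fix lam assume lam: "lam \<in> Om" and M: "norm lam \<le> M"
      and C: "(LINT \<theta>|lebesgue_on S. Re (trace (Q lam \<theta>))) \<le> C"
    have unit: "k * l / exp (k * C) \<le> v \<bullet> (Ls lam \<theta> *v v)" if \<theta>: "\<theta> \<in> S" and v: "norm v = 1" for \<theta> v
    proof -
      define q where "q = v \<bullet> (Ls lam \<theta> *v v)"
      have v0: "v \<noteq> 0" using v by auto
      have q: "q > 0" using lam \<theta> v0 by (simp add: q_def Om_def pos_def_def)
      define g where "g x = 1 / (q + k * \<bar>x - \<theta>\<bar>)" for x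
      have den: "q + k * \<bar>x - \<theta>\<bar> > 0" for x using q k by (simp add: add_pos_nonneg)
      have g_le: "g x \<le> Re (trace (Q lam x))" if x: "x \<in> S" for x
      proof -
        have "v \<bullet> (Ls lam x *v v) - q = v \<bullet> ((Ls lam x - Ls lam \<theta>) *v v)"
          by (simp add: q_def matvec.diff_left inner_diff_right)
        also have "\<dots> \<le> norm v * norm ((Ls lam x - Ls lam \<theta>) *v v)" by (rule norm_cauchy_schwarz)
        also have "\<dots> \<le> norm (Ls lam x - Ls lam \<theta>)"
          using norm_matrix_vector_mult_le[of "Ls lam x - Ls lam \<theta>" v] v by simp
        also have "\<dots> \<le> K * norm lam * \<bar>x - \<theta>\<bar>" by (rule K(2)[OF x \<theta>])
        also have "\<dots> \<le> k * \<bar>x - \<theta>\<bar>"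
          unfolding k_def using K(1) M by (intro mult_right_mono mult_left_mono) auto
        finally have le: "v \<bullet> (Ls lam x *v v) \<le> q + k * \<bar>x - \<theta>\<bar>" by simp
        have pd: "pos_def (Ls lam x)" using lam x by (simp add: Om_def)
        have "0 < v \<bullet> (Ls lam x *v v)" using pd v0 by (simp add: pos_def_def)
        then have "g x \<le> 1 / (v \<bullet> (Ls lam x *v v))"
          unfolding g_def using le by (intro divide_left_mono) (auto intro!: mult_pos_pos den)
        also have "\<dots> \<le> Re (trace (Q lam x))"
          unfolding rat_density_def by (rule Re_trace_inv_ge[OF pd v])
        finally show ?thesis .
      qed
      have cont_g: "continuous_on X g" for X
        unfolding g_def using den by (intro continuous_intros) (metis less_irrefl)
      obtain J where J: "J \<subseteq> S" "(g has_integral (ln (q + k * l) - ln q) / k) J"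
      proof (cases "\<theta> \<le> (a + b) / 2")
        case True
        then have "{\<theta>..\<theta> + l} \<subseteq> S" using \<theta> unfolding S_eq l_def by (auto simp: field_simps)
        then show ?thesis
          using has_integral_reciprocal(1)[OF q k, of l \<theta>] l that unfolding g_def by (metis less_imp_le)
      next
        case False
        then have "{\<theta> - l..\<theta>} \<subseteq> S" using \<theta> unfolding S_eq l_def by (auto simp: field_simps)
        then show ?thesis
          using has_integral_reciprocal(2)[OF q k, of l \<theta>] l that unfolding g_def by (metis less_imp_le)
      qed
      have int_g: "g integrable_on S"
        unfolding S_eq by (rule integrable_continuous_real[OF cont_g])
      have "(ln (q + k * l) - ln q) / k = integral J g" using J(2) by (simp add: integral_unique)
      also have "\<dots> \<le> integral S g"
        using J int_g den by (intro integral_subset_le) (auto simp: g_def less_imp_le has_integral_integrable)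
      also have "\<dots> = (LINT x|lebesgue_on S. g x)"
        by (rule lebesgue_integral_eq_integral[symmetric]) (auto intro: cont_integrable[OF cont_g])
      also have "\<dots> \<le> (LINT x|lebesgue_on S. Re (trace (Q lam x)))"
        by (rule Bochner_Integration.integral_mono)
          (use g_le in \<open>auto intro!: cont_integrable cont_g cont_Re_trace_Q lam\<close>)
      also have "\<dots> \<le> C" by (rule C)
      finally have "ln (q + k * l) - ln q \<le> k * C"
        using k by (simp add: pos_divide_le_eq mult.commute)
      moreover have "q + k * l > 0" using k q l by (simp add: add_pos_pos)
      ultimately have "ln ((q + k * l) / q) \<le> k * C"
        using q by (simp add: ln_div)
      then have "(q + k * l) / q \<le> exp (k * C)"
        using k q l by (metis add_pos_pos divide_pos_pos exp_le_cancel_iff exp_ln mult_pos_pos)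
      then have "q + k * l \<le> exp (k * C) * q" using q by (simp add: divide_le_eq)
      then have "k * l \<le> exp (k * C) * q" using q by linarith
      then show ?thesis by (simp add: q_def divide_le_eq mult.commute)
    qed
    have "k * l / exp (k * C) * (x \<bullet> x) \<le> x \<bullet> (Ls lam \<theta> *v x)" if \<theta>: "\<theta> \<in> S" for \<theta> x
    proof (cases "x = 0")
      case False
      have "k * l / exp (k * C) \<le> ((1 / norm x) *\<^sub>R x) \<bullet> (Ls lam \<theta> *v ((1 / norm x) *\<^sub>R x))"
        by (rule unit[OF \<theta>]) (use False in simp)
      also have "\<dots> = (x \<bullet> (Ls lam \<theta> *v x)) / (norm x)\<^sup>2"
        by (simp add: matvec.scaleR_right power2_eq_square)
      finally have "k * l / exp (k * C) * (norm x)\<^sup>2 \<le> x \<bullet> (Ls lam \<theta> *v x)"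
        using False by (simp add: pos_le_divide_eq)
      then show ?thesis by (simp add: power2_norm_eq_inner)
    qed simp
    then show "lam \<in> Om_ge (k * l / exp (k * C))" by (simp add: Om_ge_def herm_ge_def)
  qed
qed

text \<open>Pairing with a fixed interior point replaces the trace of the inverse by a linear
  functional of \<open>h lam\<close>, which is known along the residual path.\<close>

lemma LINT_trace_Q_le:
  assumes "lam0 \<in> Om_ge e" and "lam \<in> Om"
  shows "e * (LINT \<theta>|lebesgue_on S. Re (trace (Q lam \<theta>))) \<le> lam0 \<bullet> h lam"
proof -
  have "e * (LINT \<theta>|lebesgue_on S. Re (trace (Q lam \<theta>))) = (LINT \<theta>|lebesgue_on S. e * Re (trace (Q lam \<theta>)))"
    by simp
  also have "\<dots> \<le> (LINT \<theta>|lebesgue_on S. Ls lam0 \<theta> \<bullet> Q lam \<theta>)"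
  proof (rule Bochner_Integration.integral_mono)
    show "integrable (lebesgue_on S) (\<lambda>\<theta>. e * Re (trace (Q lam \<theta>)))"
      by (intro cont_integrable continuous_intros cont_Re_trace_Q assms)
    show "integrable (lebesgue_on S) (\<lambda>\<theta>. Ls lam0 \<theta> \<bullet> Q lam \<theta>)"
      by (rule pairing_integrable[OF Q_herm_L2[OF assms(2)]])
    fix \<theta> assume "\<theta> \<in> space (lebesgue_on S)"
    then have \<theta>: "\<theta> \<in> S" by simp
    show "e * Re (trace (Q lam \<theta>)) \<le> Ls lam0 \<theta> \<bullet> Q lam \<theta>"
      using inner_herm_ge[OF pos_def_imp_herm_ge_0[OF Q_pos_def[OF assms(2) \<theta>]], of e "Ls lam0 \<theta>"] assms(1) \<theta>
      by (simp add: Om_ge_def inner_commute)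
  qed
  also have "\<dots> = lam0 \<bullet> h lam"
    unfolding hmap_def by (rule pairing[OF Q_herm_L2[OF assms(2)], symmetric])
  finally show ?thesis .
qed

lemma inner_hmap_self:
  assumes "lam \<in> Om" shows "lam \<bullet> h lam = (b - a) * real CARD('m)"
proof -
  have "lam \<bullet> h lam = (LINT \<theta>|lebesgue_on S. real CARD('m))"
    unfolding hmap_def pairing[OF Q_herm_L2[OF assms]]
    by (intro Bochner_Integration.integral_cong) (auto simp: inner_Ls_Q[OF assms])
  then show ?thesis unfolding integral_const_S by simp
qed

lemma Om_ge_0_scaleR: "lam \<in> Om_ge 0 \<Longrightarrow> r \<ge> 0 \<Longrightarrow> r *\<^sub>R lam \<in> Om_ge 0"
  by (auto simp: Om_ge_def herm_ge_def moment_adj_scaleR matvec.scaleR_left hermitian_scaleR)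

lemma Om_subset_Om_ge_0: "Om \<subseteq> Om_ge 0"
  by (auto simp: Om_def Om_ge_def pos_def_imp_herm_ge_0)

text \<open>The pairing with \<open>R\<close> is positive on the compact set of unit vectors of
  \<open>RR\<close> in the closed cone: at a zero, positive definiteness of \<rho> would force the
  adjoint to vanish almost everywhere. Its minimum there gives \<open>c\<close>, by
  homogeneity.\<close>

lemma coercive:
  assumes "R \<in> moment_int S Gl Gr"
  obtains c where "c > 0" and "\<And>lam. lam \<in> D \<Longrightarrow> c * norm lam \<le> lam \<bullet> R"
proof -
  obtain \<rho> where \<rho>: "\<rho> \<in> herm_L2_pos S" and R: "R = L \<rho>"
    using assms by (auto simp: moment_int_def)
  have \<rho>2: "\<rho> \<in> herm_L2 S" and \<rho>pd: "\<And>\<theta>. \<theta> \<in> S \<Longrightarrow> pos_def (\<rho> \<theta>)"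
    using \<rho> by (auto simp: herm_L2_pos_def)
  define X where "X = sphere 0 1 \<inter> (RR \<inter> Om_ge 0)"
  have "compact X" unfolding X_def
    by (intro compact_Int_closed closed_Int closed_subspace subspace_RR closed_Om_ge) simp
  have pos: "0 < lam \<bullet> R" if lam: "lam \<in> X" for lam
  proof -
    have nn: "0 \<le> Ls lam \<theta> \<bullet> \<rho> \<theta>" if "\<theta> \<in> S" for \<theta>
      using inner_herm_ge[of "Ls lam \<theta>" 0 "\<rho> \<theta>"] pos_def_imp_herm_ge_0[OF \<rho>pd[OF that]] lam that
      by (simp add: X_def Om_ge_def)
    have int: "lam \<bullet> R = (LINT \<theta>|lebesgue_on S. Ls lam \<theta> \<bullet> \<rho> \<theta>)"
      unfolding R by (rule pairing[OF \<rho>2])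
    have "0 \<le> lam \<bullet> R" unfolding int by (intro Bochner_Integration.integral_nonneg) (simp add: nn)
    moreover have "lam \<bullet> R \<noteq> 0"
    proof
      assume "lam \<bullet> R = 0"
      then have "AE \<theta> in lebesgue_on S. Ls lam \<theta> \<bullet> \<rho> \<theta> = 0"
        unfolding int by (subst (asm) integral_nonneg_eq_0_iff_AE)
          (auto intro!: AE_I2 nn pairing_integrable \<rho>2)
      moreover have "Ls lam \<theta> = 0" if "\<theta> \<in> S" "Ls lam \<theta> \<bullet> \<rho> \<theta> = 0" for \<theta>
        using inner_pos_def_eq_0[OF _ \<rho>pd] that lam by (auto simp: X_def Om_ge_def)
      ultimately have "AE \<theta> in lebesgue_on S. Ls lam \<theta> = 0"
        using AE_space[of "lebesgue_on S"] by (auto elim: eventually_elim2)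
      then have "lam = 0" using RR_eq_0 lam by (auto simp: X_def)
      then show False using lam by (simp add: X_def)
    qed
    ultimately show ?thesis by simp
  qed
  obtain c where c: "c > 0" "\<And>lam. lam \<in> X \<Longrightarrow> c \<le> lam \<bullet> R"
  proof (cases "X = {}")
    case True
    then show ?thesis using that[of 1] by simp
  next
    case False
    have "continuous_on X (\<lambda>lam. lam \<bullet> R)" by (intro continuous_intros)
    from continuous_attains_inf[OF \<open>compact X\<close> False this]
    show ?thesis using that pos by blast
  qed
  show ?thesis
  proof (rule that[OF c(1)])
    fix lam assume lam: "lam \<in> D"
    show "c * norm lam \<le> lam \<bullet> R"
    proof (cases "lam = 0")
      case False
      then have "(1 / norm lam) *\<^sub>R lam \<in> X"
        using lam Om_subset_Om_ge_0 Om_ge_0_scaleR[of lam "1 / norm lam"] subspace_scale[OF subspace_RR]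
        by (auto simp: X_def dual_pos_eq)
      then have "c \<le> (1 / norm lam) *\<^sub>R lam \<bullet> R" by (rule c(2))
      then show ?thesis using False by (simp add: pos_le_divide_eq)
    qed simp
  qed
qed

text \<open>Makes the set of times at which the residual path is attained an interval, also when
  \<open>R\<close> itself is not attained.\<close>

lemma convex_moment_int: "convex (moment_int S Gl Gr)"
  unfolding convex_def
proof (intro ballI allI impI)
  fix x y u v assume x: "x \<in> moment_int S Gl Gr" and y: "y \<in> moment_int S Gl Gr"
    and uv: "0 \<le> u" "0 \<le> v" "u + v = (1 :: real)"
  obtain \<rho> \<sigma> where \<rho>: "\<rho> \<in> herm_L2_pos S" "x = L \<rho>" and \<sigma>: "\<sigma> \<in> herm_L2_pos S" "y = L \<sigma>"
    using x y by (auto simp: moment_int_def)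
  have L2: "(\<lambda>\<theta>. u *\<^sub>R \<rho> \<theta>) \<in> herm_L2 S" "(\<lambda>\<theta>. v *\<^sub>R \<sigma> \<theta>) \<in> herm_L2 S"
    using \<rho> \<sigma> by (auto intro!: herm_L2_scaleR simp: herm_L2_pos_def)
  have mem: "(\<lambda>\<theta>. u *\<^sub>R \<rho> \<theta> + v *\<^sub>R \<sigma> \<theta>) \<in> herm_L2_pos S"
    using herm_L2_add[OF L2] \<rho>(1) \<sigma>(1) uv by (auto simp: herm_L2_pos_def intro!: pos_def_convex)
  have "L (\<lambda>\<theta>. u *\<^sub>R \<rho> \<theta> + v *\<^sub>R \<sigma> \<theta>) = u *\<^sub>R x + v *\<^sub>R y"
    using L_add[OF L2] L_scaleR \<rho> \<sigma> by (simp add: herm_L2_pos_def)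
  then show "u *\<^sub>R x + v *\<^sub>R y \<in> moment_int S Gl Gr"
    unfolding moment_int_def using imageI[OF mem, of L] by simp
qed

section \<open>Solutions of the differential equation\<close>

text \<open>Along a solution of the differential equation the residual \<open>R - h \<lambda>\<close> decays like
  \<open>exp (-t)\<close>, so \<open>h \<lambda>\<close> runs through the following segment.\<close>

definition "residual_path R lam0 t = R + exp (- t) *\<^sub>R (h lam0 - R)"

lemma residual_path_0 [simp]: "residual_path R lam0 0 = h lam0"
  by (simp add: residual_path_def)

lemma residual_path_convex: "residual_path R lam0 t = (1 - exp (- t)) *\<^sub>R R + exp (- t) *\<^sub>R h lam0"
  by (simp add: residual_path_def algebra_simps)

lemma residual_path_RR: "R \<in> RR \<Longrightarrow> lam0 \<in> D \<Longrightarrow> residual_path R lam0 t \<in> RR"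
  unfolding residual_path_convex dual_pos_eq
  by (intro subspace_add subspace_scale subspace_RR) (auto simp: hmap_RR)

lemma residual_path_has_vector_derivative:
  "(residual_path R lam0 has_vector_derivative R - residual_path R lam0 t) (at t within X)"
  unfolding residual_path_def[abs_def] by (auto intro!: derivative_eq_intros)

lemma residual_path_tendsto: "(residual_path R lam0 \<longlongrightarrow> R) at_top"
proof -
  have "((\<lambda>t::real. exp (- t)) \<longlongrightarrow> 0) at_top"
    by (rule filterlim_compose[OF exp_at_bot filterlim_uminus_at_bot_at_top])
  from tendsto_scaleR[OF this tendsto_const[of "h lam0 - R"]]
  have "((\<lambda>t. exp (- t) *\<^sub>R (h lam0 - R)) \<longlongrightarrow> 0) at_top" by simp
  then show ?thesis
    unfolding residual_path_def[abs_def] using tendsto_add[OF tendsto_const[of R]] by fastforce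
qed

text \<open>A priori bounds confine the solution to a compact subset of \<open>D\<close>; hence the set of times
  at which the segment is attained by \<open>h\<close> on \<open>D\<close> is open and closed.\<close>

lemma residual_path_attained:
  assumes lam0: "lam0 \<in> D" and R: "R \<in> RR"
    and M: "\<And>t lam. t \<ge> 0 \<Longrightarrow> lam \<in> D \<Longrightarrow> h lam = residual_path R lam0 t \<Longrightarrow> norm lam \<le> M"
  shows "\<And>t. t \<ge> 0 \<Longrightarrow> residual_path R lam0 t \<in> h ` D" and "R \<in> h ` D"
proof -
  obtain e0 where e0: "e0 > 0" "lam0 \<in> Om_ge e0"
    using Om_imp_Om_ge lam0 by (auto simp: dual_pos_eq)
  \<comment> \<open>Bounds the pairing of \<open>lam0\<close> with every point of the residual path
    for t >= 0, independently of t.\<close>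
  define N where "N = norm lam0 * (norm R + norm (h lam0 - R))"
  obtain e where e: "e > 0" and unif: "\<And>lam. lam \<in> Om \<Longrightarrow> norm lam \<le> M \<Longrightarrow>
    (LINT \<theta>|lebesgue_on S. Re (trace (Q lam \<theta>))) \<le> N / e0 \<Longrightarrow> lam \<in> Om_ge e"
    using Om_ge_uniform by metis
  define K where "K = cball 0 M \<inter> (RR \<inter> Om_ge e)"
  have "compact K" unfolding K_def
    by (intro compact_Int_closed closed_Int closed_subspace subspace_RR closed_Om_ge) simp
  have KD: "K \<subseteq> D" using Om_ge_subset_Om[OF e] by (auto simp: K_def dual_pos_eq)
  then have "compact (h ` K)"
    by (intro compact_continuous_image \<open>compact K\<close> continuous_on_subset[OF cont_h]) (auto simp: dual_pos_eq)
  then have clK: "closed (h ` K)" by (rule compact_imp_closed)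
  have in_K: "residual_path R lam0 t \<in> h ` K" if t: "t \<ge> 0" and att: "residual_path R lam0 t \<in> h ` D" for t
  proof -
    obtain lam where lam: "lam \<in> D" "h lam = residual_path R lam0 t" using att by force
    have lamM: "norm lam \<le> M" by (rule M[OF t lam])
    have "e0 * (LINT \<theta>|lebesgue_on S. Re (trace (Q lam \<theta>))) \<le> lam0 \<bullet> residual_path R lam0 t"
      using LINT_trace_Q_le[OF e0(2), of lam] lam by (simp add: dual_pos_eq)
    also have "\<dots> \<le> norm lam0 * norm (residual_path R lam0 t)" by (rule norm_cauchy_schwarz)
    also have "norm (residual_path R lam0 t) \<le> norm R + exp (- t) * norm (h lam0 - R)"
      unfolding residual_path_def by (rule norm_triangle_le) simp
    also have "exp (- t) * norm (h lam0 - R) \<le> norm (h lam0 - R)"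
      using t by (intro mult_left_le_one_le) auto
    finally have "e0 * (LINT \<theta>|lebesgue_on S. Re (trace (Q lam \<theta>))) \<le> N"
      by (simp add: N_def mult_left_mono)
    then have "(LINT \<theta>|lebesgue_on S. Re (trace (Q lam \<theta>))) \<le> N / e0"
      using e0(1) by (simp add: pos_le_divide_eq mult.commute)
    then have "lam \<in> K" using unif lam(1) lamM by (auto simp: K_def dual_pos_eq)
    then show ?thesis using lam(2) by (metis imageI)
  qed
  define T where "T = {t. t \<ge> 0 \<and> residual_path R lam0 t \<in> h ` D}"
  have cont: "continuous_on {0..} (residual_path R lam0)"
    unfolding residual_path_def[abs_def] by (intro continuous_intros)
  \<comment> \<open>Two descriptions of the same set: as a preimage of an open set, and below as a
    preimage of the compact image of \<open>K\<close>.\<close>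
  have "T = {0..} \<inter> residual_path R lam0 -` (H ` Om)"
    using residual_path_RR[OF R lam0] by (auto simp: T_def h_D_eq)
  then have "openin (top_of_set {0..}) T"
    using continuous_openin_preimage_gen[OF cont open_H_Om] by simp
  moreover have "T = {0..} \<inter> residual_path R lam0 -` (h ` K)"
  proof -
    have "residual_path R lam0 t \<in> h ` D \<longleftrightarrow> residual_path R lam0 t \<in> h ` K" if "t \<ge> 0" for t
      using in_K[OF that] subsetD[OF image_mono[OF KD]] by (rule iffI)
    then show ?thesis by (simp add: set_eq_iff T_def cong: conj_cong)
  qed
  then have "closedin (top_of_set {0..}) T"
    using continuous_closedin_preimage[OF cont clK] by simp
  moreover have "connected {0::real..}" by (simp add: convex_connected)
  moreover have "0 \<in> T" using lam0 by (simp add: T_def)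
  ultimately have T: "T = {0..}" unfolding connected_clopen by blast
  then show att: "\<And>t. t \<ge> 0 \<Longrightarrow> residual_path R lam0 t \<in> h ` D" by (auto simp: T_def)
  \<comment> \<open>Compactness pays off once more: the limit \<open>R\<close> of the path stays in
    the closed image of \<open>K\<close>, hence is itself attained.\<close>
  have "\<forall>\<^sub>F t in at_top. residual_path R lam0 t \<in> h ` K"
    unfolding eventually_at_top_linorder using att in_K by blast
  then have "R \<in> h ` K" by (intro Lim_in_closed_set[OF clK _ _ residual_path_tendsto]) auto
  then show "R \<in> h ` D" using KD by blast
qed

text \<open>Any path point is a convex combination of \<open>R\<close> and \<open>h lam0\<close>, so
  coercivity at these two endpoints, with the smaller constant, holds at all times. Pairing a
  preimage with its own value is constant by \<open>inner_hmap_self\<close>, which bounds the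
  preimage.\<close>

lemma residual_path_attained_moment_int:
  assumes "lam0 \<in> D" and "R \<in> moment_int S Gl Gr"
  shows "\<And>t. t \<ge> 0 \<Longrightarrow> residual_path R lam0 t \<in> h ` D" and "R \<in> h ` D"
proof -
  have R: "R \<in> RR"
    using assms(2) by (auto simp: moment_int_def moment_range_def herm_L2_pos_def)
  obtain c1 where c1: "c1 > 0" "\<And>lam. lam \<in> D \<Longrightarrow> c1 * norm lam \<le> lam \<bullet> R"
    using coercive[OF assms(2)] by blast
  have "h lam0 \<in> moment_int S Gl Gr" using h_D_subset assms(1) by blast
  then obtain c2 where c2: "c2 > 0" "\<And>lam. lam \<in> D \<Longrightarrow> c2 * norm lam \<le> lam \<bullet> h lam0"
    using coercive by blast
  define c where "c = min c1 c2"
  have c: "c > 0" using c1 c2 by (simp add: c_def)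
  have M: "norm lam \<le> (b - a) * real CARD('m) / c" if "t \<ge> 0" "lam \<in> D" "h lam = residual_path R lam0 t" for t lam
  proof -
    have s: "0 \<le> exp (- t)" "exp (- t) \<le> 1" using that(1) by auto
    have "c * norm lam = (1 - exp (- t)) * (c * norm lam) + exp (- t) * (c * norm lam)"
      by (simp add: algebra_simps)
    also have "\<dots> \<le> (1 - exp (- t)) * (lam \<bullet> R) + exp (- t) * (lam \<bullet> h lam0)"
    proof (intro add_mono mult_left_mono)
      show "c * norm lam \<le> lam \<bullet> R"
        by (rule order_trans[OF _ c1(2)[OF that(2)]]) (simp add: c_def mult_right_mono)
      show "c * norm lam \<le> lam \<bullet> h lam0"
        by (rule order_trans[OF _ c2(2)[OF that(2)]]) (simp add: c_def mult_right_mono)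
    qed (use s in auto)
    also have "\<dots> = lam \<bullet> h lam" by (simp add: that(3) residual_path_convex inner_add_right)
    also have "\<dots> = (b - a) * real CARD('m)"
      using that(2) by (intro inner_hmap_self) (simp add: dual_pos_eq)
    finally show ?thesis using c by (simp add: pos_le_divide_eq mult.commute)
  qed
  show "\<And>t. t \<ge> 0 \<Longrightarrow> residual_path R lam0 t \<in> h ` D"
    by (rule residual_path_attained(1)[OF assms(1) R M])
  show "R \<in> h ` D"
    by (rule residual_path_attained(2)[OF assms(1) R M])
qed

text \<open>Chain rule for \<open>G\<close> along the path: the path has velocity equal to the
  residual, and the derivative of \<open>G\<close> applied to it is the right-hand side by
  \<open>inv_into_grad\<close>.\<close>

lemma ode_solution_path:
  assumes J: "is_interval J" "0 \<in> J" "J \<subseteq> {0..}" and lam0: "lam0 \<in> D" and R: "R \<in> RR"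
    and att: "\<And>t. t \<in> J \<Longrightarrow> residual_path R lam0 t \<in> h ` D"
  shows "ode_solution S Gl Gr R lam0 J (\<lambda>t. G (residual_path R lam0 t))"
    and "\<And>t. t \<in> J \<Longrightarrow> G (residual_path R lam0 t) \<in> D"
    and "\<And>t. t \<in> J \<Longrightarrow> h (G (residual_path R lam0 t)) = residual_path R lam0 t"
proof -
  show D: "G (residual_path R lam0 t) \<in> D" and hG: "h (G (residual_path R lam0 t)) = residual_path R lam0 t" if "t \<in> J" for t
    using att[OF that] G_h by force+
  have der: "((\<lambda>t. G (residual_path R lam0 t)) has_vector_derivative ode_rhs S Gl Gr R (G (residual_path R lam0 t))) (at t within J)"
    if t: "t \<in> J" for t
  proof -
    let ?l = "G (residual_path R lam0 t)"
    have l: "?l \<in> Om" "?l \<in> RR" using D[OF t] by (auto simp: dual_pos_eq)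
    have "H ?l = residual_path R lam0 t" using hG[OF t] H_eq_h[OF l(2)] by simp
    then have "(G has_derivative inv (H' ?l)) (at (residual_path R lam0 t))"
      using has_derivative_G[OF l(1)] by simp
    from has_derivative_at_withinI[OF this]
    have "((G \<circ> residual_path R lam0) has_vector_derivative inv (H' ?l) (R - residual_path R lam0 t)) (at t within J)"
      by (rule vector_derivative_diff_chain_within[OF residual_path_has_vector_derivative])
    moreover have "ode_rhs S Gl Gr R ?l = inv (H' ?l) (R - residual_path R lam0 t)"
      unfolding ode_rhs_def hG[OF t]
      by (rule inv_into_grad[OF l(1) subspace_diff[OF subspace_RR R residual_path_RR[OF R lam0]]])
    ultimately show ?thesis by (simp add: o_def)
  qed
  have "G (residual_path R lam0 0) = lam0" using G_h[OF lam0] by simp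
  then show "ode_solution S Gl Gr R lam0 J (\<lambda>t. G (residual_path R lam0 t))"
    unfolding ode_solution_def using J D D_ode_dom der by auto
qed

text \<open>Uniqueness comes from injectivity of \<open>h\<close> once the solution is known to
  remain in the cone.\<close>

lemma ode_solution_unique:
  assumes lam0: "lam0 \<in> D" and R: "R \<in> RR" and sol: "ode_solution S Gl Gr R lam0 J mu" and t: "t \<in> J"
  shows "mu t \<in> D" and "h (mu t) = residual_path R lam0 t" and "mu t = G (residual_path R lam0 t)"
proof -
  have J: "is_interval J" "0 \<in> J" and mu0: "mu 0 = lam0"
    and dom: "\<And>t. t \<in> J \<Longrightarrow> mu t \<in> ode_dom S Gl Gr"
    and der: "\<And>t. t \<in> J \<Longrightarrow> (mu has_vector_derivative ode_rhs S Gl Gr R (mu t)) (at t within J)"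
    using sol by (auto simp: ode_solution_def)
  have cont: "continuous_on J mu"
    unfolding continuous_on_eq_continuous_within using der has_vector_derivative_continuous by blast
  define T where "T = J \<inter> mu -` Om"
  have "openin (top_of_set J) T"
    unfolding T_def by (rule continuous_openin_preimage_gen[OF cont open_Om])
  \<comment> \<open>On \<open>ode_dom\<close> the open and the closed cone condition coincide, so
    the times spent in the cone form a clopen subset of the interval.\<close>
  moreover have "T = J \<inter> mu -` (Om_ge 0)"
  proof -
    have "mu s \<in> Om" if "s \<in> J" "mu s \<in> Om_ge 0" for s
      using dom[OF that(1)] that(2) herm_ge_0_invertible_imp_pos_def
      by (auto simp: ode_dom_def Om_def Om_ge_def)
    then show ?thesis using Om_subset_Om_ge_0 by (auto simp: T_def)
  qed
  then have "closedin (top_of_set J) T"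
    using continuous_closedin_preimage[OF cont closed_Om_ge] by simp
  moreover have "connected J" using J(1) by (rule is_interval_connected)
  moreover have "0 \<in> T" using J mu0 lam0 by (simp add: T_def dual_pos_eq)
  ultimately have "T = J" unfolding connected_clopen by blast
  then have Om: "mu s \<in> Om" if "s \<in> J" for s using that by (auto simp: T_def)
  then have D: "mu s \<in> D" if "s \<in> J" for s
    using dom[OF that] that by (auto simp: dual_pos_eq ode_dom_def)
  \<comment> \<open>Integrating factor: the residual r = h (mu s) - R satisfies r' = -r.\<close>
  have der0: "((\<lambda>s. exp s *\<^sub>R (h (mu s) - R)) has_vector_derivative 0) (at s within J)" if s: "s \<in> J" for s
  proof -
    have "R - h (mu s) \<in> RR" by (intro subspace_diff subspace_RR R hmap_RR Om s)
    then have rhs: "h' (mu s) (ode_rhs S Gl Gr R (mu s)) = R - h (mu s)"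
      unfolding ode_rhs_def using bij_betw_grad[OF Om[OF s]] by (intro f_inv_into_f) (simp add: bij_betw_def)
    from vector_derivative_diff_chain_within[OF der[OF s] has_derivative_at_withinI[OF has_derivative_hmap[OF Om[OF s]]]]
    have "((\<lambda>s. h (mu s)) has_vector_derivative R - h (mu s)) (at s within J)"
      by (simp add: o_def rhs)
    from has_vector_derivative_diff_const[of _ R, THEN iffD2, OF this]
    have "((\<lambda>s. h (mu s) - R) has_vector_derivative R - h (mu s)) (at s within J)" .
    from has_vector_derivative_scaleR[OF DERIV_subset[OF DERIV_exp subset_UNIV] this]
    show ?thesis by (simp add: algebra_simps)
  qed
  have "\<exists>c. \<forall>s\<in>J. exp s *\<^sub>R (h (mu s) - R) = c"
    using J(1) der0 by (intro has_derivative_zero_constant)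
      (auto simp: has_vector_derivative_def is_interval_convex)
  then have "exp t *\<^sub>R (h (mu t) - R) = h lam0 - R"
    using t J(2) mu0 by (metis exp_zero scaleR_one)
  then have "exp (- t) *\<^sub>R (exp t *\<^sub>R (h (mu t) - R)) = exp (- t) *\<^sub>R (h lam0 - R)" by simp
  then have "h (mu t) - R = exp (- t) *\<^sub>R (h lam0 - R)"
    by (simp add: exp_minus_inverse mult.commute[of "exp (- t)"])
  then show "h (mu t) = residual_path R lam0 t"
    unfolding residual_path_def by (metis add.commute diff_add_cancel)
  then show "mu t = G (residual_path R lam0 t)" using G_h[OF D[OF t]] by simp
  show "mu t \<in> D" by (rule D[OF t])
qed

section \<open>Entropy\<close>

text \<open>Klein's inequality in both orders encloses the difference of the values at two points;
  both bounds tend to 0 because \<open>Ls lam x \<bullet> Q lam x\<close> equals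
  \<open>CARD('m)\<close>. Continuity of the logarithm itself is thus bypassed.\<close>

lemma cont_trace_log_Q:
  assumes "lam \<in> Om" shows "continuous_on S (\<lambda>\<theta>. Re (trace (mat_log (Q lam \<theta>))))"
  unfolding continuous_on_def
proof
  fix x assume x: "x \<in> S"
  let ?f = "\<lambda>\<theta>. Re (trace (mat_log (Q lam \<theta>)))"
  note inv = matrix_inv_Q[OF assms] and self = inner_Ls_Q[OF assms x]
  have tL: "(Ls lam \<longlongrightarrow> Ls lam x) (at x within S)" and tQ: "(Q lam \<longlongrightarrow> Q lam x) (at x within S)"
    using cont_Ls[of lam] cont_Q[OF assms] x by (auto simp: continuous_on_def)
  show "(?f \<longlongrightarrow> ?f x) (at x within S)"
  proof (rule tendsto_sandwich)
    show "\<forall>\<^sub>F y in at x within S. ?f x - (Ls lam y \<bullet> Q lam x - real CARD('m)) \<le> ?f y"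
      using Klein_log(1)[OF Q_pos_def[OF assms x] Q_pos_def[OF assms]] inv
      by (auto simp: eventually_at_filter intro!: always_eventually) (smt (verit))
    show "\<forall>\<^sub>F y in at x within S. ?f y \<le> ?f x + (Ls lam x \<bullet> Q lam y - real CARD('m))"
      using Klein_log(1)[OF Q_pos_def[OF assms] Q_pos_def[OF assms x]] inv[OF x]
      by (auto simp: eventually_at_filter intro!: always_eventually) (smt (verit))
    have "((\<lambda>y. ?f x - (Ls lam y \<bullet> Q lam x - real CARD('m))) \<longlongrightarrow>
        ?f x - (Ls lam x \<bullet> Q lam x - real CARD('m))) (at x within S)"
      by (intro tendsto_intros tL)
    then show "((\<lambda>y. ?f x - (Ls lam y \<bullet> Q lam x - real CARD('m))) \<longlongrightarrow> ?f x) (at x within S)"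
      by (simp add: self)
    have "((\<lambda>y. ?f x + (Ls lam x \<bullet> Q lam y - real CARD('m))) \<longlongrightarrow>
        ?f x + (Ls lam x \<bullet> Q lam x - real CARD('m))) (at x within S)"
      by (intro tendsto_intros tQ)
    then show "((\<lambda>y. ?f x + (Ls lam x \<bullet> Q lam y - real CARD('m))) \<longlongrightarrow> ?f x) (at x within S)"
      by (simp add: self)
  qed
qed

text \<open>For every density with moment \<open>R\<close> the linear term of Klein's inequality
  integrates to the pairing of \<open>lam\<close> with \<open>R\<close>, that is m (b - a), and
  cancels the constant. What remains is the comparison of entropies.\<close>

lemma unique_entropy_minimizer_Q:
  assumes lam: "lam \<in> D" and R: "h lam = R"
  shows "unique_entropy_minimizer S Gl Gr R (Q lam)"
proof -
  have Om: "lam \<in> Om" using lam by (simp add: dual_pos_eq)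
  let ?f = "\<lambda>\<sigma> \<theta>. Re (trace (mat_log (\<sigma> \<theta> :: complex^'m^'m)))"
  have int_Q: "integrable (lebesgue_on S) (?f (Q lam))"
    by (rule cont_integrable[OF cont_trace_log_Q[OF Om]])
  have dens: "Q lam \<in> densities S Gl Gr R"
    using Q_herm_L2_pos[OF Om] R by (simp add: densities_def hmap_def)
  note inv = matrix_inv_Q[OF Om]
  have key: "(LINT \<theta>|lebesgue_on S. ?f \<sigma> \<theta>) \<le> (LINT \<theta>|lebesgue_on S. ?f (Q lam) \<theta>)"
    "(LINT \<theta>|lebesgue_on S. ?f \<sigma> \<theta>) = (LINT \<theta>|lebesgue_on S. ?f (Q lam) \<theta>) \<Longrightarrow> AE \<theta> in lebesgue_on S. \<sigma> \<theta> = Q lam \<theta>"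
    if \<sigma>: "\<sigma> \<in> densities S Gl Gr R" and int: "integrable (lebesgue_on S) (?f \<sigma>)" for \<sigma>
  proof -
    have \<sigma>2: "\<sigma> \<in> herm_L2 S" and pd: "\<And>\<theta>. \<theta> \<in> S \<Longrightarrow> pos_def (\<sigma> \<theta>)" and LR: "L \<sigma> = R"
      using \<sigma> by (auto simp: densities_def herm_L2_pos_def)
    define g where "g \<theta> = (Ls lam \<theta> \<bullet> \<sigma> \<theta> - real CARD('m)) - (?f \<sigma> \<theta> - ?f (Q lam) \<theta>)" for \<theta>
    have int_m: "integrable (lebesgue_on S) (\<lambda>\<theta>. real CARD('m))"
      by (intro cont_integrable continuous_on_const)
    have g_int: "integrable (lebesgue_on S) g"
      unfolding g_def[abs_def]
      by (intro Bochner_Integration.integrable_diff pairing_integrable \<sigma>2 int int_Q int_m)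
    have g0: "0 \<le> g \<theta>" if "\<theta> \<in> S" for \<theta>
      using Klein_log(1)[OF pd[OF that] Q_pos_def[OF Om that]] inv[OF that] by (simp add: g_def)
    have "(LINT \<theta>|lebesgue_on S. g \<theta>) =
        ((LINT \<theta>|lebesgue_on S. Ls lam \<theta> \<bullet> \<sigma> \<theta>) - (LINT \<theta>|lebesgue_on S. real CARD('m))) -
        ((LINT \<theta>|lebesgue_on S. ?f \<sigma> \<theta>) - (LINT \<theta>|lebesgue_on S. ?f (Q lam) \<theta>))"
      unfolding g_def[abs_def]
      by (simp only: Bochner_Integration.integral_diff Bochner_Integration.integrable_diff pairing_integrable \<sigma>2 int int_Q int_m)
    also have "(LINT \<theta>|lebesgue_on S. Ls lam \<theta> \<bullet> \<sigma> \<theta>) = lam \<bullet> h lam"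
      using pairing[OF \<sigma>2] LR R by simp
    also have "\<dots> = (LINT \<theta>|lebesgue_on S. real CARD('m))"
      unfolding inner_hmap_self[OF Om] integral_const_S by simp
    finally have eq: "(LINT \<theta>|lebesgue_on S. ?f \<sigma> \<theta>) =
        (LINT \<theta>|lebesgue_on S. ?f (Q lam) \<theta>) - (LINT \<theta>|lebesgue_on S. g \<theta>)"
      by simp
    have "0 \<le> (LINT \<theta>|lebesgue_on S. g \<theta>)"
      by (intro Bochner_Integration.integral_nonneg) (simp add: g0)
    with eq show "(LINT \<theta>|lebesgue_on S. ?f \<sigma> \<theta>) \<le> (LINT \<theta>|lebesgue_on S. ?f (Q lam) \<theta>)" by simp
    assume "(LINT \<theta>|lebesgue_on S. ?f \<sigma> \<theta>) = (LINT \<theta>|lebesgue_on S. ?f (Q lam) \<theta>)"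
    with eq have "(LINT \<theta>|lebesgue_on S. g \<theta>) = 0" by simp
    then have "AE \<theta> in lebesgue_on S. g \<theta> = 0"
      by (subst (asm) integral_nonneg_eq_0_iff_AE) (auto intro!: AE_I2 g0 g_int)
    moreover have "\<sigma> \<theta> = Q lam \<theta>" if "\<theta> \<in> S" "g \<theta> = 0" for \<theta>
      using Klein_log(2)[OF pd[OF that(1)] Q_pos_def[OF Om that(1)]] inv[OF that(1)] that(2)
      by (simp add: g_def)
    ultimately show "AE \<theta> in lebesgue_on S. \<sigma> \<theta> = Q lam \<theta>"
      using AE_space[of "lebesgue_on S"] by (auto elim: eventually_elim2)
  qed
  have ent_Q: "entropy S (Q lam) = ereal (- (LINT \<theta>|lebesgue_on S. ?f (Q lam) \<theta>))"
    using int_Q by (simp add: entropy_def)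
  have le: "entropy S (Q lam) \<le> entropy S \<sigma>" if "\<sigma> \<in> densities S Gl Gr R" for \<sigma>
    unfolding ent_Q using key(1)[OF that] by (simp add: entropy_def)
  show ?thesis
    unfolding unique_entropy_minimizer_def entropy_minimizer_def is_arg_min_def
  proof (intro conjI allI impI dens)
    show "\<nexists>y. y \<in> densities S Gl Gr R \<and> entropy S y < entropy S (Q lam)"
      using le by (auto simp: not_less[symmetric])
    fix \<sigma> assume \<sigma>: "\<sigma> \<in> densities S Gl Gr R \<and> (\<nexists>y. y \<in> densities S Gl Gr R \<and> entropy S y < entropy S \<sigma>)"
    then have eq: "entropy S \<sigma> = entropy S (Q lam)"
      using le[of \<sigma>] dens by (meson antisym not_less)
    \<comment> \<open>A finite value excludes the infinite branch of \<open>entropy\<close>, so the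
      equality case of \<open>key\<close> is available.\<close>
    then have int: "integrable (lebesgue_on S) (?f \<sigma>)"
      unfolding ent_Q by (auto simp: entropy_def split: if_splits)
    show "AE \<theta> in lebesgue_on S. \<sigma> \<theta> = Q lam \<theta>"
      using \<sigma> int eq unfolding ent_Q by (intro key(2)) (auto simp: entropy_def)
  qed
qed

end

theorem theorem4:
  fixes a b :: real
    and S :: "real set"
    and Gl :: "real \<Rightarrow> complex^'m^'nl"
    and Gr :: "real \<Rightarrow> complex^'nr^'m"
    and R :: "complex^'nr^'nl"
  assumes "a < b" and "S = {a..b}"
    and "C1_on S Gl" and "C1_on S Gr"
  shows
    "(dual_pos S Gl Gr \<noteq> {} \<and> R \<in> moment_int S Gl Gr \<longrightarrow>
       (\<exists>\<rho>\<in>rat_densities S Gl Gr. unique_entropy_minimizer S Gl Gr R \<rho>) \<and>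
       (\<forall>lam0\<in>dual_pos S Gl Gr. \<exists>lam.
          ode_solution S Gl Gr R lam0 {0..} lam \<and>
          (\<forall>J mu. ode_solution S Gl Gr R lam0 J mu \<longrightarrow> (\<forall>t\<in>J. mu t = lam t)) \<and>
          (\<forall>t\<ge>0. lam t \<in> dual_pos S Gl Gr) \<and>
          (\<exists>lamhat\<in>dual_pos S Gl Gr.
             (lam \<longlongrightarrow> lamhat) at_top \<and>
             moment_map S Gl Gr (rat_density Gl Gr lamhat) = R \<and>
             unique_entropy_minimizer S Gl Gr R (rat_density Gl Gr lamhat)) \<and>
          (\<forall>t\<ge>0. ((\<lambda>s. (norm (R - hmap S Gl Gr (lam s)))\<^sup>2) has_real_derivative
                    - 2 * (norm (R - hmap S Gl Gr (lam t)))\<^sup>2) (at t within {0..})))) \<and>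
     (R \<in> moment_range S Gl Gr \<and> R \<notin> moment_int S Gl Gr \<longrightarrow>
       (\<forall>lam0\<in>dual_pos S Gl Gr.
          (\<exists>J lam. maximal_dual_solution S Gl Gr R lam0 J lam) \<and>
          (\<forall>J lam. maximal_dual_solution S Gl Gr R lam0 J lam \<longrightarrow> \<not> bounded (lam ` J))))"
proof (intro conjI impI)
  interpret moment_problem a b S Gl Gr
    using assms by unfold_locales
  {
    assume asm: "dual_pos S Gl Gr \<noteq> {} \<and> R \<in> moment_int S Gl Gr"
    then have R: "R \<in> moment_int S Gl Gr" by simp
    then have RRR: "R \<in> RR" by (auto simp: moment_int_def moment_range_def herm_L2_pos_def)
    obtain lam1 where "lam1 \<in> D" using asm by blast
    then have "R \<in> h ` D" using R by (rule residual_path_attained_moment_int(2))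
    then obtain lamhat where lamhat: "lamhat \<in> D" "h lamhat = R" by blast
    note unique = unique_entropy_minimizer_Q[OF lamhat]
    show "\<exists>\<rho>\<in>rat_densities S Gl Gr. unique_entropy_minimizer S Gl Gr R \<rho>"
      using lamhat(1) unique by (auto simp: rat_densities_def)
    show "\<forall>lam0\<in>dual_pos S Gl Gr. \<exists>lam.
          ode_solution S Gl Gr R lam0 {0..} lam \<and>
          (\<forall>J mu. ode_solution S Gl Gr R lam0 J mu \<longrightarrow> (\<forall>t\<in>J. mu t = lam t)) \<and>
          (\<forall>t\<ge>0. lam t \<in> dual_pos S Gl Gr) \<and>
          (\<exists>lamhat\<in>dual_pos S Gl Gr.
             (lam \<longlongrightarrow> lamhat) at_top \<and>
             moment_map S Gl Gr (rat_density Gl Gr lamhat) = R \<and>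
             unique_entropy_minimizer S Gl Gr R (rat_density Gl Gr lamhat)) \<and>
          (\<forall>t\<ge>0. ((\<lambda>s. (norm (R - hmap S Gl Gr (lam s)))\<^sup>2) has_real_derivative
                    - 2 * (norm (R - hmap S Gl Gr (lam t)))\<^sup>2) (at t within {0..}))"
    proof
      fix lam0 assume lam0: "lam0 \<in> D"
      define lam where "lam t = G (residual_path R lam0 t)" for t
      have ray: "is_interval {0::real..}" "0 \<in> {0::real..}" "{0::real..} \<subseteq> {0..}"
        by (simp_all add: is_interval_ci)
      have "residual_path R lam0 t \<in> h ` D" if "t \<in> {0..}" for t
        using residual_path_attained_moment_int(1)[OF lam0 R] that by simp
      note sol = ode_solution_path[OF ray lam0 RRR this, folded lam_def]
      \<comment> \<open>On \<open>RR\<close> the maps \<open>h\<close> and \<open>H\<close> agree,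
        so \<open>R\<close> is the value of \<open>H\<close> at \<open>lamhat\<close>, where its
        inverse is differentiable.\<close>
      have "isCont G R"
        using has_derivative_continuous[OF has_derivative_G[of lamhat]] lamhat H_eq_h
        by (simp add: dual_pos_eq)
      then have "((\<lambda>t. G (residual_path R lam0 t)) \<longlongrightarrow> G R) at_top"
        by (rule isCont_tendsto_compose[OF _ residual_path_tendsto])
      then have lim: "(lam \<longlongrightarrow> lamhat) at_top"
        using G_h[OF lamhat(1)] lamhat(2) by (simp add: lam_def[abs_def])
      define V where "V s = (norm (R - h (lam s)))\<^sup>2" for s
      \<comment> \<open>The closed form is known only for s >= 0, which is why the derivative below
        is taken within the half-line.\<close>
      have V: "V s = exp (- 2 * s) * (norm (h lam0 - R))\<^sup>2" if "s \<in> {0..}" for s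
      proof -
        have "R - h (lam s) = - (exp (- s) *\<^sub>R (h lam0 - R))"
          using sol(3)[of s] that by (simp add: residual_path_def)
        then show ?thesis
          by (simp add: V_def power_mult_distrib exp_double[symmetric])
      qed
      have V': "(V has_real_derivative - 2 * V t) (at t within {0..})" if t: "t \<in> {0..}" for t
      proof -
        have "((\<lambda>s. exp (- 2 * s) * (norm (h lam0 - R))\<^sup>2) has_real_derivative - 2 * V t) (at t within {0..})"
          unfolding V[OF t] by (auto intro!: derivative_eq_intros)
        then show ?thesis
          unfolding has_field_derivative_def by (rule has_derivative_transform[OF t V, rotated])
      qed
      show "\<exists>lam. ode_solution S Gl Gr R lam0 {0..} lam \<and>
          (\<forall>J mu. ode_solution S Gl Gr R lam0 J mu \<longrightarrow> (\<forall>t\<in>J. mu t = lam t)) \<and>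
          (\<forall>t\<ge>0. lam t \<in> dual_pos S Gl Gr) \<and>
          (\<exists>lamhat\<in>dual_pos S Gl Gr.
             (lam \<longlongrightarrow> lamhat) at_top \<and>
             moment_map S Gl Gr (rat_density Gl Gr lamhat) = R \<and>
             unique_entropy_minimizer S Gl Gr R (rat_density Gl Gr lamhat)) \<and>
          (\<forall>t\<ge>0. ((\<lambda>s. (norm (R - hmap S Gl Gr (lam s)))\<^sup>2) has_real_derivative
                    - 2 * (norm (R - hmap S Gl Gr (lam t)))\<^sup>2) (at t within {0..}))"
      proof (intro exI[of _ lam] conjI allI impI ballI bexI[of _ lamhat])
        show "ode_solution S Gl Gr R lam0 {0..} lam" by (rule sol(1))
        show "mu t = lam t" if "ode_solution S Gl Gr R lam0 J mu" "t \<in> J" for J mu t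
          unfolding lam_def by (rule ode_solution_unique(3)[OF lam0 RRR that])
        show "lam t \<in> D" if "0 \<le> t" for t using sol(2) that by simp
        show "((\<lambda>s. (norm (R - h (lam s)))\<^sup>2) has_real_derivative
            - 2 * (norm (R - h (lam t)))\<^sup>2) (at t within {0..})" if "0 \<le> t" for t
          using V'[of t] that by (simp add: V_def[abs_def])
      qed (use lim lamhat unique in \<open>auto simp: hmap_def\<close>)
    qed
  }
  assume asm: "R \<in> moment_range S Gl Gr \<and> R \<notin> moment_int S Gl Gr"
  then have R: "R \<in> RR" and notin: "R \<notin> moment_int S Gl Gr" by auto
  show "\<forall>lam0\<in>dual_pos S Gl Gr.
          (\<exists>J lam. maximal_dual_solution S Gl Gr R lam0 J lam) \<and>
          (\<forall>J lam. maximal_dual_solution S Gl Gr R lam0 J lam \<longrightarrow> \<not> bounded (lam ` J))"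
  proof
    fix lam0 assume lam0: "lam0 \<in> D"
    \<comment> \<open>Existence of one point \<open>lam0\<close> of the dual cone already makes
      every element of \<open>moment_int\<close> a value of \<open>h\<close>, so the image of
      \<open>D\<close> is convex.\<close>
    have hD: "h ` D = moment_int S Gl Gr"
      using h_D_subset residual_path_attained_moment_int(2)[OF lam0] by blast
    define J where "J = {t. 0 \<le> t \<and> residual_path R lam0 t \<in> h ` D}"
    define lam where "lam t = G (residual_path R lam0 t)" for t
    have J_down: "s \<in> J" if "t \<in> J" "0 \<le> s" "s \<le> t" for s t
    proof (cases "t = 0")
      case False
      then have t: "t > 0" using that by simp
      \<comment> \<open>The weight that places the path at time s on the segment from its value at 0
        to its value at t.\<close>
      define r where "r = (1 - exp (- s)) / (1 - exp (- t))"
      have r: "0 \<le> r" "r \<le> 1" "r * (1 - exp (- t)) = 1 - exp (- s)"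
        using that(2,3) t by (auto simp: r_def divide_le_eq)
      have "(1 - r) + r * exp (- t) = exp (- s)"
        using r(3) by (simp add: algebra_simps)
      then have "residual_path R lam0 s = (1 - r) *\<^sub>R h lam0 + r *\<^sub>R residual_path R lam0 t"
        unfolding residual_path_convex
        by (simp add: r(3)[symmetric] scaleR_add_right scaleR_add_left[symmetric] add.left_commute
            add.commute)
      also have "\<dots> \<in> moment_int S Gl Gr"
        using that(1) lam0 r(1,2) hD by (intro convexD[OF convex_moment_int]) (auto simp: J_def)
      finally show ?thesis using that(2) by (simp add: J_def hD)
    qed (use that in simp)
    have J: "is_interval J" "0 \<in> J" "J \<subseteq> {0..}"
    proof -
      have J0: "0 \<le> t" if "t \<in> J" for t using that by (simp add: J_def)
      show "is_interval J" unfolding is_interval_1 using J_down J0 order_trans by metis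
      show "0 \<in> J" using lam0 by (simp add: J_def)
      show "J \<subseteq> {0..}" using J0 by auto
    qed
    have att: "\<And>t. t \<in> J \<Longrightarrow> residual_path R lam0 t \<in> h ` D" by (simp add: J_def)
    note sol = ode_solution_path[OF J lam0 R att, folded lam_def]
    have extends: "J' \<subseteq> J" "\<And>t. t \<in> J' \<Longrightarrow> mu t = lam t"
      if "ode_solution S Gl Gr R lam0 J' mu" for J' mu
    proof
      fix t assume t: "t \<in> J'"
      have "0 \<le> t" using that t by (auto simp: ode_solution_def)
      then show "t \<in> J"
        using imageI[OF ode_solution_unique(1)[OF lam0 R that t], of h]
          ode_solution_unique(2)[OF lam0 R that t] by (simp add: J_def)
    next
      show "mu t = lam t" if "t \<in> J'" for t
        unfolding lam_def
        by (rule ode_solution_unique(3)[OF lam0 R \<open>ode_solution S Gl Gr R lam0 J' mu\<close> that])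
    qed
    have "maximal_dual_solution S Gl Gr R lam0 J lam"
      unfolding maximal_dual_solution_def using sol extends(1) by blast
    moreover have "\<not> bounded (mu ` J')" if max: "maximal_dual_solution S Gl Gr R lam0 J' mu" for J' mu
    proof
      assume bdd: "bounded (mu ` J')"
      have mu: "ode_solution S Gl Gr R lam0 J' mu" using max by (simp add: maximal_dual_solution_def)
      \<comment> \<open>The pair of \<open>J\<close> and \<open>lam\<close> extends every solution
        from \<open>lam0\<close>, so a maximal one cannot be shorter.\<close>
      have "J = J'"
        using max sol extends[OF mu] unfolding maximal_dual_solution_def by (metis image_subsetI)
      then have "bounded (lam ` J)" using bdd extends(2)[OF mu] by (metis image_cong)
      then obtain M where M: "\<And>t. t \<in> J \<Longrightarrow> norm (lam t) \<le> M"
        unfolding bounded_iff by blast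
      have "R \<in> h ` D"
      proof (rule residual_path_attained(2)[OF lam0 R])
        \<comment> \<open>Every time at which the path is attained lies in \<open>J\<close>, and its
          preimage is \<open>lam t\<close>; boundedness of the solution is therefore exactly the a
          priori bound required.\<close>
        fix t l assume "0 \<le> t" and l: "l \<in> D" "h l = residual_path R lam0 t"
        then have "t \<in> J" by (force simp: J_def)
        moreover have "lam t = l" using G_h[OF l(1)] l(2) by (simp add: lam_def)
        ultimately show "norm l \<le> M" using M by blast
      qed
      then show False using notin h_D_subset by blast
    qed
    ultimately show "(\<exists>J lam. maximal_dual_solution S Gl Gr R lam0 J lam) \<and>
        (\<forall>J lam. maximal_dual_solution S Gl Gr R lam0 J lam \<longrightarrow> \<not> bounded (lam ` J))"
      by blast
  qed
qed

end
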